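(* Let $K_\lambda G$ be an infinite twisted group algebra of a group $G$ over a field $K$, let $\Delta U$ be the $FC$-center of its unit group $U(K_\lambda G)$, and let $t(\Delta U)$ be the subgroup of $\Delta U$ consisting of all elements of finite order in $\Delta U$. Then all elements of the commutator subgroup of $t(\Delta U)$ are unipotent and central in $\Delta U$.
   Context: Let $G$ be a group, $K$ a field, $U(K)=K\setminus\{0\}$, and $\lambda:G\times G\to U(K)$, $(g,h)\mapsto\lambda_{g,h}$, a $2$-cocycle with respect to the trivial action of $G$, i.e. $\lambda_{g,h}\lambda_{gh,k}=\lambda_{h,k}\lambda_{g,hk}$ for all $g,h,k\in G$. The twisted group algebra $K_\lambda G$ is the associative $K$-algebra with $K$-basis $\{u_g\mid g\in G\}$ and multiplication determined by $u_gu_h=\lambda_{g,h}u_{gh}$ and distributivity. $U(K_\lambda G)$ is its group of units. $\Delta U$, the $FC$-center of $U(K_\lambda G)$, is the subgroup of all elements of $U(K_\lambda G)$ having only finitely many conjugates in $U(K_\lambda G)$. The elements of finite order of $\Delta U$ form a normal subgroup $t(\Delta U)$ (B.H. Neumann). A unit of the form $1+x$ with $x\in K_\lambda G$ nilpotent is called unipotent. *)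

theory Defs
  imports "HOL-Algebra.Module" "HOL-Algebra.Generated_Groups"
begin

section \<open>Twisted group algebras\<close>

definition two_cocycle ::
  "('g, 'a) monoid_scheme \<Rightarrow> ('k, 'b) ring_scheme \<Rightarrow> ('g \<Rightarrow> 'g \<Rightarrow> 'k) \<Rightarrow> bool" where
  "two_cocycle G K \<Lambda> \<longleftrightarrow>
     (\<forall>g \<in> carrier G. \<forall>h \<in> carrier G. \<Lambda> g h \<in> carrier K - {\<zero>\<^bsub>K\<^esub>}) \<and>
     (\<forall>g \<in> carrier G. \<forall>h \<in> carrier G. \<forall>k \<in> carrier G.
        \<Lambda> g h \<otimes>\<^bsub>K\<^esub> \<Lambda> (g \<otimes>\<^bsub>G\<^esub> h) k = \<Lambda> h k \<otimes>\<^bsub>K\<^esub> \<Lambda> g (h \<otimes>\<^bsub>G\<^esub> k))"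

definition tga_supp :: "('k, 'b) ring_scheme \<Rightarrow> ('g \<Rightarrow> 'k) \<Rightarrow> 'g set" where
  "tga_supp K a = {g. a g \<noteq> \<zero>\<^bsub>K\<^esub>}"

definition tga_basis :: "('k, 'b) ring_scheme \<Rightarrow> 'g \<Rightarrow> 'g \<Rightarrow> 'k" where
  "tga_basis K g = (\<lambda>x. if x = g then \<one>\<^bsub>K\<^esub> else \<zero>\<^bsub>K\<^esub>)"

text \<open>An element \<open>\<Sum> a\<^sub>g u\<^sub>g\<close> is represented by its coefficient function \<open>a\<close>, extended by zero
  outside the carrier of \<open>G\<close>; the basis element \<open>u\<^sub>g\<close> is \<open>tga_basis K g\<close>. The cocycle is not
  assumed to be normalised, so the unity is \<open>\<Lambda>(1,1)\<^sup>-\<^sup>1 u\<^sub>1\<close> rather than \<open>u\<^sub>1\<close>.\<close>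

definition twisted_group_algebra ::
  "('g, 'a) monoid_scheme \<Rightarrow> ('k, 'b) ring_scheme \<Rightarrow> ('g \<Rightarrow> 'g \<Rightarrow> 'k) \<Rightarrow> ('k, 'g \<Rightarrow> 'k) module"
where
  "twisted_group_algebra G K \<Lambda> =
    \<lparr> carrier = {a. (\<forall>g. a g \<in> carrier K) \<and> tga_supp K a \<subseteq> carrier G \<and> finite (tga_supp K a)},
      mult = (\<lambda>a b x. \<Oplus>\<^bsub>K\<^esub>g \<in> tga_supp K a. \<Oplus>\<^bsub>K\<^esub>h \<in> tga_supp K b.
                if g \<otimes>\<^bsub>G\<^esub> h = x then a g \<otimes>\<^bsub>K\<^esub> b h \<otimes>\<^bsub>K\<^esub> \<Lambda> g h else \<zero>\<^bsub>K\<^esub>),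
      one = (\<lambda>x. if x = \<one>\<^bsub>G\<^esub> then inv\<^bsub>K\<^esub> (\<Lambda> \<one>\<^bsub>G\<^esub> \<one>\<^bsub>G\<^esub>) else \<zero>\<^bsub>K\<^esub>),
      zero = (\<lambda>x. \<zero>\<^bsub>K\<^esub>),
      add = (\<lambda>a b x. a x \<oplus>\<^bsub>K\<^esub> b x),
      smult = (\<lambda>s a x. s \<otimes>\<^bsub>K\<^esub> a x) \<rparr>"

section \<open>Unipotent elements, the FC-center, elements of finite order\<close>

definition nilpotent_elem :: "('a, 'b) ring_scheme \<Rightarrow> 'a \<Rightarrow> bool" where
  "nilpotent_elem R x \<longleftrightarrow> x \<in> carrier R \<and> (\<exists>n::nat. x [^]\<^bsub>R\<^esub> n = \<zero>\<^bsub>R\<^esub>)"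

definition unipotent :: "('a, 'b) ring_scheme \<Rightarrow> 'a \<Rightarrow> bool" where
  "unipotent R u \<longleftrightarrow> u \<in> Units R \<and> (\<exists>x. nilpotent_elem R x \<and> u = \<one>\<^bsub>R\<^esub> \<oplus>\<^bsub>R\<^esub> x)"

definition FC_center :: "('a, 'b) monoid_scheme \<Rightarrow> 'a set" where
  "FC_center U =
     {x \<in> carrier U. finite {y \<otimes>\<^bsub>U\<^esub> x \<otimes>\<^bsub>U\<^esub> inv\<^bsub>U\<^esub> y | y. y \<in> carrier U}}"

definition torsion_elems :: "('a, 'b) monoid_scheme \<Rightarrow> 'a set \<Rightarrow> 'a set" where
  "torsion_elems U S = {x \<in> S. \<exists>n::nat. n > 0 \<and> x [^]\<^bsub>U\<^esub> n = \<one>\<^bsub>U\<^esub>}"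

section \<open>The twisted group algebra is a unital ring and a vector space over \<open>K\<close>\<close>

lemma (in abelian_monoid) finsum_swap:
  assumes "finite A" "finite B" "\<And>x y. x \<in> A \<Longrightarrow> y \<in> B \<Longrightarrow> f x y \<in> carrier G"
  shows "(\<Oplus>x\<in>A. \<Oplus>y\<in>B. f x y) = (\<Oplus>y\<in>B. \<Oplus>x\<in>A. f x y)"
  using assms(1,3)
proof (induction A rule: finite_induct)
  case empty
  then show ?case by simp
next
  case (insert a A)
  have "(\<Oplus>x\<in>insert a A. \<Oplus>y\<in>B. f x y) = (\<Oplus>y\<in>B. f a y) \<oplus> (\<Oplus>x\<in>A. \<Oplus>y\<in>B. f x y)"
    using insert by (intro finsum_insert) (auto intro!: finsum_closed)
  also have "\<dots> = (\<Oplus>y\<in>B. f a y) \<oplus> (\<Oplus>y\<in>B. \<Oplus>x\<in>A. f x y)"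
    using insert by simp
  also have "\<dots> = (\<Oplus>y\<in>B. f a y \<oplus> (\<Oplus>x\<in>A. f x y))"
    using insert by (intro finsum_addf[symmetric]) (auto intro!: finsum_closed)
  also have "\<dots> = (\<Oplus>y\<in>B. \<Oplus>x\<in>insert a A. f x y)"
    using insert by (intro finsum_cong') (auto intro!: finsum_closed simp: Pi_iff)
  finally show ?case .
qed

lemma (in abelian_monoid) finsum_eqI:
  assumes "\<And>x. x \<in> A \<Longrightarrow> f x = g x" "\<And>x. x \<in> A \<Longrightarrow> g x \<in> carrier G"
  shows "finsum G f A = finsum G g A"
  using assms by (intro finsum_cong') auto

lemma (in abelian_monoid) finsum_mono_supp:
  assumes "finite A" "S \<subseteq> A" "\<And>x. x \<in> A \<Longrightarrow> f x \<in> carrier G" "\<And>x. x \<in> A - S \<Longrightarrow> f x = \<zero>"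
  shows "finsum G f A = finsum G f S"
  using assms by (intro add.finprod_mono_neutral_cong_right) auto

lemma (in abelian_monoid) finsum_delta:
  assumes "finite A" "a \<in> A" "f a \<in> carrier G"
  shows "(\<Oplus>x\<in>A. if a = x then f x else \<zero>) = f a"
proof -
  have "(\<Oplus>x\<in>A. if a = x then f x else \<zero>) = (\<Oplus>x\<in>{a}. if a = x then f x else \<zero>)"
    using assms by (intro finsum_mono_supp) auto
  also have "\<dots> = f a"
    using assms by simp
  finally show ?thesis .
qed

locale tga = G: group G + K: field K
  for G :: "('g, 'a) monoid_scheme" and K :: "('k, 'b) ring_scheme" +
  fixes \<Lambda> :: "'g \<Rightarrow> 'g \<Rightarrow> 'k"
  assumes cocycle: "two_cocycle G K \<Lambda>"
begin

abbreviation "R \<equiv> twisted_group_algebra G K \<Lambda>"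

lemma L_closed [simp]: "g \<in> carrier G \<Longrightarrow> h \<in> carrier G \<Longrightarrow> \<Lambda> g h \<in> carrier K"
  and L_nonzero [simp]: "g \<in> carrier G \<Longrightarrow> h \<in> carrier G \<Longrightarrow> \<Lambda> g h \<noteq> \<zero>\<^bsub>K\<^esub>"
  and L_cocycle: "g \<in> carrier G \<Longrightarrow> h \<in> carrier G \<Longrightarrow> k \<in> carrier G \<Longrightarrow>
     \<Lambda> g h \<otimes>\<^bsub>K\<^esub> \<Lambda> (g \<otimes>\<^bsub>G\<^esub> h) k = \<Lambda> h k \<otimes>\<^bsub>K\<^esub> \<Lambda> g (h \<otimes>\<^bsub>G\<^esub> k)"
  using cocycle unfolding two_cocycle_def by auto

lemma carrier_iff:
  "a \<in> carrier R \<longleftrightarrow>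
     (\<forall>g. a g \<in> carrier K) \<and> tga_supp K a \<subseteq> carrier G \<and> finite (tga_supp K a)"
  by (simp add: twisted_group_algebra_def)

lemma carrierI:
  assumes "\<And>g. a g \<in> carrier K" "finite A" "A \<subseteq> carrier G" "\<And>g. g \<notin> A \<Longrightarrow> a g = \<zero>\<^bsub>K\<^esub>"
  shows "a \<in> carrier R"
proof -
  have "tga_supp K a \<subseteq> A"
    using assms(4) by (auto simp: tga_supp_def)
  then show ?thesis
    using assms by (auto simp: carrier_iff finite_subset)
qed

lemma coeff_closed: "a \<in> carrier R \<Longrightarrow> a g \<in> carrier K"
  by (simp add: carrier_iff)

lemma supp_finite: "a \<in> carrier R \<Longrightarrow> finite (tga_supp K a)"
  by (simp add: carrier_iff)

lemma supp_carrier: "a \<in> carrier R \<Longrightarrow> tga_supp K a \<subseteq> carrier G"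
  by (simp add: carrier_iff)

lemma supp_carrierD: "a \<in> carrier R \<Longrightarrow> g \<in> tga_supp K a \<Longrightarrow> g \<in> carrier G"
  by (auto simp: carrier_iff)

lemma coeff_zero: "g \<notin> tga_supp K a \<Longrightarrow> a g = \<zero>\<^bsub>K\<^esub>"
  by (simp add: tga_supp_def)

lemma add_eq: "a \<oplus>\<^bsub>R\<^esub> b = (\<lambda>x. a x \<oplus>\<^bsub>K\<^esub> b x)"
  and zero_eq: "\<zero>\<^bsub>R\<^esub> = (\<lambda>x. \<zero>\<^bsub>K\<^esub>)"
  and one_eq: "\<one>\<^bsub>R\<^esub> = (\<lambda>x. if x = \<one>\<^bsub>G\<^esub> then inv\<^bsub>K\<^esub> (\<Lambda> \<one>\<^bsub>G\<^esub> \<one>\<^bsub>G\<^esub>) else \<zero>\<^bsub>K\<^esub>)"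
  and smult_eq: "s \<odot>\<^bsub>R\<^esub> a = (\<lambda>x. s \<otimes>\<^bsub>K\<^esub> a x)"
  by (simp_all add: twisted_group_algebra_def)

definition summand :: "('g \<Rightarrow> 'k) \<Rightarrow> ('g \<Rightarrow> 'k) \<Rightarrow> 'g \<Rightarrow> 'g \<Rightarrow> 'g \<Rightarrow> 'k" where
  "summand a b x g h = (if g \<otimes>\<^bsub>G\<^esub> h = x then a g \<otimes>\<^bsub>K\<^esub> b h \<otimes>\<^bsub>K\<^esub> \<Lambda> g h else \<zero>\<^bsub>K\<^esub>)"

lemma summand_closed:
  "a \<in> carrier R \<Longrightarrow> b \<in> carrier R \<Longrightarrow> g \<in> carrier G \<Longrightarrow> h \<in> carrier G \<Longrightarrow> summand a b x g h \<in> carrier K"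
  by (simp add: summand_def coeff_closed)

lemma mult_eq:
  assumes a: "a \<in> carrier R" and b: "b \<in> carrier R"
    and A: "finite A" "tga_supp K a \<subseteq> A" "A \<subseteq> carrier G"
    and B: "finite B" "tga_supp K b \<subseteq> B" "B \<subseteq> carrier G"
  shows "(a \<otimes>\<^bsub>R\<^esub> b) x = (\<Oplus>\<^bsub>K\<^esub>g\<in>A. \<Oplus>\<^bsub>K\<^esub>h\<in>B. summand a b x g h)"
proof -
  have "(a \<otimes>\<^bsub>R\<^esub> b) x = (\<Oplus>\<^bsub>K\<^esub>g\<in>tga_supp K a. \<Oplus>\<^bsub>K\<^esub>h\<in>tga_supp K b. summand a b x g h)"
    by (simp add: twisted_group_algebra_def summand_def)
  also have "\<dots> = (\<Oplus>\<^bsub>K\<^esub>g\<in>tga_supp K a. \<Oplus>\<^bsub>K\<^esub>h\<in>B. summand a b x g h)"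
  proof (rule K.finsum_eqI)
    show "(\<Oplus>\<^bsub>K\<^esub>h\<in>B. summand a b x g h) \<in> carrier K" if "g \<in> tga_supp K a" for g
      using that a b A B by (intro K.finsum_closed) (auto intro!: summand_closed)
  next
    fix g assume g: "g \<in> tga_supp K a"
    have gG: "g \<in> carrier G"
      using a g by (rule supp_carrierD)
    have z: "summand a b x g h = \<zero>\<^bsub>K\<^esub>" if "h \<in> B - tga_supp K b" for h
      using that a gG B by (auto simp: summand_def coeff_zero coeff_closed)
    show "(\<Oplus>\<^bsub>K\<^esub>h\<in>tga_supp K b. summand a b x g h) = (\<Oplus>\<^bsub>K\<^esub>h\<in>B. summand a b x g h)"
      using a b B gG z by (intro K.finsum_mono_supp[symmetric]) (auto intro!: summand_closed)
  qed
  also have "\<dots> = (\<Oplus>\<^bsub>K\<^esub>g\<in>A. \<Oplus>\<^bsub>K\<^esub>h\<in>B. summand a b x g h)"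
  proof (rule K.finsum_mono_supp[symmetric, OF A(1,2)])
    show "(\<Oplus>\<^bsub>K\<^esub>h\<in>B. summand a b x g h) \<in> carrier K" if "g \<in> A" for g
      using that a b A B by (intro K.finsum_closed) (auto intro!: summand_closed)
    show "(\<Oplus>\<^bsub>K\<^esub>h\<in>B. summand a b x g h) = \<zero>\<^bsub>K\<^esub>" if g: "g \<in> A - tga_supp K a" for g
    proof -
      have "summand a b x g h = \<zero>\<^bsub>K\<^esub>" if "h \<in> B" for h
        using that g b A B by (auto simp: summand_def coeff_zero coeff_closed subset_iff)
      then have "(\<Oplus>\<^bsub>K\<^esub>h\<in>B. summand a b x g h) = (\<Oplus>\<^bsub>K\<^esub>h\<in>B. \<zero>\<^bsub>K\<^esub>)"
        by (intro K.finsum_cong') auto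
      then show ?thesis by simp
    qed
  qed
  finally show ?thesis .
qed

lemma mult_coeff_closed:
  assumes "a \<in> carrier R" "b \<in> carrier R"
  shows "(a \<otimes>\<^bsub>R\<^esub> b) x \<in> carrier K"
  using assms unfolding
    mult_eq[OF assms supp_finite[OF assms(1)] order_refl supp_carrier[OF assms(1)]
       supp_finite[OF assms(2)] order_refl supp_carrier[OF assms(2)]]
  by (intro K.finsum_closed) (auto intro!: summand_closed K.finsum_closed dest: supp_carrierD)

lemma mult_supp:
  assumes a: "a \<in> carrier R" and b: "b \<in> carrier R"
    and x: "x \<notin> (\<lambda>(g, h). g \<otimes>\<^bsub>G\<^esub> h) ` (tga_supp K a \<times> tga_supp K b)"
  shows "(a \<otimes>\<^bsub>R\<^esub> b) x = \<zero>\<^bsub>K\<^esub>"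
proof -
  have t: "summand a b x g h = \<zero>\<^bsub>K\<^esub>" if "g \<in> tga_supp K a" "h \<in> tga_supp K b" for g h
    using x that by (force simp: summand_def)
  have i: "(\<Oplus>\<^bsub>K\<^esub>h\<in>tga_supp K b. summand a b x g h) = \<zero>\<^bsub>K\<^esub>" if "g \<in> tga_supp K a" for g
  proof -
    have "(\<Oplus>\<^bsub>K\<^esub>h\<in>tga_supp K b. summand a b x g h) = (\<Oplus>\<^bsub>K\<^esub>h\<in>tga_supp K b. \<zero>\<^bsub>K\<^esub>)"
      using t that by (intro K.finsum_cong') auto
    then show ?thesis by simp
  qed
  have "(\<Oplus>\<^bsub>K\<^esub>g\<in>tga_supp K a. \<Oplus>\<^bsub>K\<^esub>h\<in>tga_supp K b. summand a b x g h) = (\<Oplus>\<^bsub>K\<^esub>g\<in>tga_supp K a. \<zero>\<^bsub>K\<^esub>)"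
    using i by (intro K.finsum_cong') auto
  then show ?thesis
    using mult_eq[OF a b supp_finite[OF a] order_refl supp_carrier[OF a]
       supp_finite[OF b] order_refl supp_carrier[OF b]] by simp
qed

lemma mult_closed:
  assumes "a \<in> carrier R" "b \<in> carrier R"
  shows "a \<otimes>\<^bsub>R\<^esub> b \<in> carrier R"
proof (rule carrierI[of _ "(\<lambda>(g, h). g \<otimes>\<^bsub>G\<^esub> h) ` (tga_supp K a \<times> tga_supp K b)"])
  show "finite ((\<lambda>(g, h). g \<otimes>\<^bsub>G\<^esub> h) ` (tga_supp K a \<times> tga_supp K b))"
    using assms by (auto simp: supp_finite)
  show "(\<lambda>(g, h). g \<otimes>\<^bsub>G\<^esub> h) ` (tga_supp K a \<times> tga_supp K b) \<subseteq> carrier G"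
    using assms by (auto dest: supp_carrierD)
qed (use assms in \<open>auto intro: mult_coeff_closed mult_supp\<close>)

lemma add_closed:
  assumes "a \<in> carrier R" "b \<in> carrier R"
  shows "a \<oplus>\<^bsub>R\<^esub> b \<in> carrier R"
  using assms
  by (intro carrierI[of _ "tga_supp K a \<union> tga_supp K b"])
     (auto simp: add_eq coeff_closed supp_finite coeff_zero dest: supp_carrierD)

lemma zero_closed: "\<zero>\<^bsub>R\<^esub> \<in> carrier R"
  by (intro carrierI[of _ "{}"]) (auto simp: zero_eq)

lemma inv_closed: "a \<in> carrier K \<Longrightarrow> a \<noteq> \<zero>\<^bsub>K\<^esub> \<Longrightarrow> inv\<^bsub>K\<^esub> a \<in> carrier K"
  by (simp add: K.field_Units)

lemma one_closed: "\<one>\<^bsub>R\<^esub> \<in> carrier R"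
  by (intro carrierI[of _ "{\<one>\<^bsub>G\<^esub>}"]) (auto simp: one_eq inv_closed)

lemma smult_closed: "s \<in> carrier K \<Longrightarrow> a \<in> carrier R \<Longrightarrow> s \<odot>\<^bsub>R\<^esub> a \<in> carrier R"
  by (intro carrierI[of _ "tga_supp K a"])
     (auto simp: smult_eq coeff_closed supp_finite coeff_zero dest: supp_carrierD)

lemma basis_closed: "g \<in> carrier G \<Longrightarrow> tga_basis K g \<in> carrier R"
  by (intro carrierI[of _ "{g}"]) (auto simp: tga_basis_def)

lemma basis_mult:
  assumes g: "g \<in> carrier G" and h: "h \<in> carrier G"
  shows "tga_basis K g \<otimes>\<^bsub>R\<^esub> tga_basis K h = \<Lambda> g h \<odot>\<^bsub>R\<^esub> tga_basis K (g \<otimes>\<^bsub>G\<^esub> h)"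
proof
  fix x
  have "(tga_basis K g \<otimes>\<^bsub>R\<^esub> tga_basis K h) x =
      (\<Oplus>\<^bsub>K\<^esub>g'\<in>{g}. \<Oplus>\<^bsub>K\<^esub>h'\<in>{h}. summand (tga_basis K g) (tga_basis K h) x g' h')"
    by (rule mult_eq[OF basis_closed[OF g] basis_closed[OF h]])
       (use g h in \<open>auto simp: tga_supp_def tga_basis_def\<close>)
  also have "\<dots> = summand (tga_basis K g) (tga_basis K h) x g h"
    using g h by (simp add: summand_closed basis_closed)
  also have "\<dots> = (\<Lambda> g h \<odot>\<^bsub>R\<^esub> tga_basis K (g \<otimes>\<^bsub>G\<^esub> h)) x"
    using g h by (simp add: summand_def tga_basis_def smult_eq)
  finally show "(tga_basis K g \<otimes>\<^bsub>R\<^esub> tga_basis K h) x = (\<Lambda> g h \<odot>\<^bsub>R\<^esub> tga_basis K (g \<otimes>\<^bsub>G\<^esub> h)) x" .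
qed

lemma abelian_group_R: "abelian_group R"
proof (rule abelian_groupI)
  fix a assume a: "a \<in> carrier R"
  have "(\<lambda>x. \<ominus>\<^bsub>K\<^esub> a x) \<in> carrier R"
    using a by (intro carrierI[of _ "tga_supp K a"])
      (auto simp: coeff_closed supp_finite coeff_zero dest: supp_carrierD)
  moreover have "(\<lambda>x. \<ominus>\<^bsub>K\<^esub> a x) \<oplus>\<^bsub>R\<^esub> a = \<zero>\<^bsub>R\<^esub>"
    using a by (auto simp: add_eq zero_eq coeff_closed K.l_neg)
  ultimately show "\<exists>y\<in>carrier R. y \<oplus>\<^bsub>R\<^esub> a = \<zero>\<^bsub>R\<^esub>"
    by blast
qed (auto simp: add_closed zero_closed, auto simp: add_eq zero_eq coeff_closed K.a_ac)

lemma module_R: "module K R"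
  by (rule moduleI[OF K.is_cring abelian_group_R])
     (auto simp: smult_closed,
      auto simp: smult_eq add_eq coeff_closed K.l_distr K.r_distr K.m_assoc)

lemma mult_assoc_left:
  assumes a: "a \<in> carrier R" and b: "b \<in> carrier R" and c: "c \<in> carrier R"
  shows "((a \<otimes>\<^bsub>R\<^esub> b) \<otimes>\<^bsub>R\<^esub> c) x =
    (\<Oplus>\<^bsub>K\<^esub>g\<in>tga_supp K a. \<Oplus>\<^bsub>K\<^esub>h\<in>tga_supp K b. \<Oplus>\<^bsub>K\<^esub>l\<in>tga_supp K c.
       if g \<otimes>\<^bsub>G\<^esub> h \<otimes>\<^bsub>G\<^esub> l = x
       then a g \<otimes>\<^bsub>K\<^esub> b h \<otimes>\<^bsub>K\<^esub> c l \<otimes>\<^bsub>K\<^esub> (\<Lambda> g h \<otimes>\<^bsub>K\<^esub> \<Lambda> (g \<otimes>\<^bsub>G\<^esub> h) l) else \<zero>\<^bsub>K\<^esub>)"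
proof -
  define A B C where ABC: "A = tga_supp K a" "B = tga_supp K b" "C = tga_supp K c"
  define P where "P = (\<lambda>(g, h). g \<otimes>\<^bsub>G\<^esub> h) ` (A \<times> B)"
  have fin: "finite A" "finite B" "finite C" "finite P"
    using a b c by (auto simp: ABC P_def supp_finite)
  have sub: "\<And>g. g \<in> A \<Longrightarrow> g \<in> carrier G" "\<And>g. g \<in> B \<Longrightarrow> g \<in> carrier G"
    "\<And>g. g \<in> C \<Longrightarrow> g \<in> carrier G" "\<And>g. g \<in> P \<Longrightarrow> g \<in> carrier G"
    using a b c by (auto simp: ABC P_def dest: supp_carrierD)
  have PI: "g \<otimes>\<^bsub>G\<^esub> h \<in> P" if "g \<in> A" "h \<in> B" for g h
    using that by (auto simp: P_def)
  define F where "F g h l k = (if k \<otimes>\<^bsub>G\<^esub> l = x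
      then a g \<otimes>\<^bsub>K\<^esub> b h \<otimes>\<^bsub>K\<^esub> \<Lambda> g h \<otimes>\<^bsub>K\<^esub> c l \<otimes>\<^bsub>K\<^esub> \<Lambda> k l else \<zero>\<^bsub>K\<^esub>)" for g h l k
  define T where "T g h l k = (if g \<otimes>\<^bsub>G\<^esub> h = k then F g h l k else \<zero>\<^bsub>K\<^esub>)" for g h l k
  have F_closed: "F g h l k \<in> carrier K" if "g \<in> A" "h \<in> B" "l \<in> C" "k \<in> P" for g h l k
    using that a b c sub by (simp add: F_def coeff_closed)
  have T_closed: "T g h l k \<in> carrier K" if "g \<in> A" "h \<in> B" "l \<in> C" "k \<in> P" for g h l k
    using that F_closed by (simp add: T_def)
  have ab: "a \<otimes>\<^bsub>R\<^esub> b \<in> carrier R"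
    using a b by (rule mult_closed)
  have "((a \<otimes>\<^bsub>R\<^esub> b) \<otimes>\<^bsub>R\<^esub> c) x = (\<Oplus>\<^bsub>K\<^esub>k\<in>P. \<Oplus>\<^bsub>K\<^esub>l\<in>C. summand (a \<otimes>\<^bsub>R\<^esub> b) c x k l)"
    using mult_supp[OF a b] fin sub
    by (intro mult_eq[OF ab c]) (auto simp: P_def ABC tga_supp_def[of _ "a \<otimes>\<^bsub>R\<^esub> b"])
  also have "\<dots> = (\<Oplus>\<^bsub>K\<^esub>k\<in>P. \<Oplus>\<^bsub>K\<^esub>l\<in>C. \<Oplus>\<^bsub>K\<^esub>g\<in>A. \<Oplus>\<^bsub>K\<^esub>h\<in>B. T g h l k)"
  proof (rule K.finsum_eqI, rule K.finsum_eqI)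
    fix k l assume k: "k \<in> P" and l: "l \<in> C"
    show "summand (a \<otimes>\<^bsub>R\<^esub> b) c x k l = (\<Oplus>\<^bsub>K\<^esub>g\<in>A. \<Oplus>\<^bsub>K\<^esub>h\<in>B. T g h l k)"
    proof (cases "k \<otimes>\<^bsub>G\<^esub> l = x")
      case True
      have "summand (a \<otimes>\<^bsub>R\<^esub> b) c x k l =
          (\<Oplus>\<^bsub>K\<^esub>g\<in>A. \<Oplus>\<^bsub>K\<^esub>h\<in>B. summand a b k g h) \<otimes>\<^bsub>K\<^esub> (c l \<otimes>\<^bsub>K\<^esub> \<Lambda> k l)"
        using True k l sub a b c mult_eq[OF a b, of A B k] fin mult_coeff_closed[OF a b, of k]
        by (auto simp: summand_def[of "a \<otimes>\<^bsub>R\<^esub> b"] ABC K.m_assoc coeff_closed subset_iff)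
      also have "\<dots> = (\<Oplus>\<^bsub>K\<^esub>g\<in>A. (\<Oplus>\<^bsub>K\<^esub>h\<in>B. summand a b k g h) \<otimes>\<^bsub>K\<^esub> (c l \<otimes>\<^bsub>K\<^esub> \<Lambda> k l))"
        using k l sub a b c fin
        by (intro K.finsum_ldistr) (auto intro!: K.finsum_closed summand_closed simp: coeff_closed)
      also have "\<dots> = (\<Oplus>\<^bsub>K\<^esub>g\<in>A. \<Oplus>\<^bsub>K\<^esub>h\<in>B. T g h l k)"
      proof (rule K.finsum_eqI)
        fix g assume g: "g \<in> A"
        have "(\<Oplus>\<^bsub>K\<^esub>h\<in>B. summand a b k g h) \<otimes>\<^bsub>K\<^esub> (c l \<otimes>\<^bsub>K\<^esub> \<Lambda> k l) =
            (\<Oplus>\<^bsub>K\<^esub>h\<in>B. summand a b k g h \<otimes>\<^bsub>K\<^esub> (c l \<otimes>\<^bsub>K\<^esub> \<Lambda> k l))"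
          using k l g sub a b c fin
          by (intro K.finsum_ldistr) (auto intro!: summand_closed simp: coeff_closed)
        also have "\<dots> = (\<Oplus>\<^bsub>K\<^esub>h\<in>B. T g h l k)"
          using k l g sub a b c True
          by (intro K.finsum_cong')
             (auto simp: summand_def T_def F_def K.m_assoc coeff_closed)
        finally show "(\<Oplus>\<^bsub>K\<^esub>h\<in>B. summand a b k g h) \<otimes>\<^bsub>K\<^esub> (c l \<otimes>\<^bsub>K\<^esub> \<Lambda> k l) = (\<Oplus>\<^bsub>K\<^esub>h\<in>B. T g h l k)" .
      qed (use k l T_closed in \<open>auto intro!: K.finsum_closed\<close>)
      finally show ?thesis .
    next
      case False
      then have "T g h l k = \<zero>\<^bsub>K\<^esub>" for g h
        by (simp add: T_def F_def)
      then show ?thesis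
        using False by (simp add: summand_def)
    qed
  qed (use T_closed in \<open>auto intro!: K.finsum_closed\<close>)
  also have "\<dots> = (\<Oplus>\<^bsub>K\<^esub>k\<in>P. \<Oplus>\<^bsub>K\<^esub>g\<in>A. \<Oplus>\<^bsub>K\<^esub>l\<in>C. \<Oplus>\<^bsub>K\<^esub>h\<in>B. T g h l k)"
  proof (rule K.finsum_eqI, rule K.finsum_swap)
  qed (use T_closed fin in \<open>auto intro!: K.finsum_closed\<close>)
  also have "\<dots> = (\<Oplus>\<^bsub>K\<^esub>g\<in>A. \<Oplus>\<^bsub>K\<^esub>k\<in>P. \<Oplus>\<^bsub>K\<^esub>l\<in>C. \<Oplus>\<^bsub>K\<^esub>h\<in>B. T g h l k)"
    using T_closed fin by (intro K.finsum_swap) (auto intro!: K.finsum_closed)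
  also have "\<dots> = (\<Oplus>\<^bsub>K\<^esub>g\<in>A. \<Oplus>\<^bsub>K\<^esub>k\<in>P. \<Oplus>\<^bsub>K\<^esub>h\<in>B. \<Oplus>\<^bsub>K\<^esub>l\<in>C. T g h l k)"
  proof (rule K.finsum_eqI, rule K.finsum_eqI, rule K.finsum_swap)
  qed (use T_closed fin in \<open>auto intro!: K.finsum_closed\<close>)
  also have "\<dots> = (\<Oplus>\<^bsub>K\<^esub>g\<in>A. \<Oplus>\<^bsub>K\<^esub>h\<in>B. \<Oplus>\<^bsub>K\<^esub>k\<in>P. \<Oplus>\<^bsub>K\<^esub>l\<in>C. T g h l k)"
  proof (rule K.finsum_eqI, rule K.finsum_swap)
  qed (use T_closed fin in \<open>auto intro!: K.finsum_closed\<close>)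
  also have "\<dots> = (\<Oplus>\<^bsub>K\<^esub>g\<in>A. \<Oplus>\<^bsub>K\<^esub>h\<in>B. \<Oplus>\<^bsub>K\<^esub>l\<in>C. \<Oplus>\<^bsub>K\<^esub>k\<in>P. T g h l k)"
  proof (rule K.finsum_eqI, rule K.finsum_eqI, rule K.finsum_swap)
  qed (use T_closed fin in \<open>auto intro!: K.finsum_closed\<close>)
  also have "\<dots> = (\<Oplus>\<^bsub>K\<^esub>g\<in>A. \<Oplus>\<^bsub>K\<^esub>h\<in>B. \<Oplus>\<^bsub>K\<^esub>l\<in>C. F g h l (g \<otimes>\<^bsub>G\<^esub> h))"
    unfolding T_def
  proof (rule K.finsum_eqI, rule K.finsum_eqI, rule K.finsum_eqI, rule K.finsum_delta)
  qed (use F_closed fin PI in \<open>auto intro!: K.finsum_closed\<close>)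
  also have "\<dots> = (\<Oplus>\<^bsub>K\<^esub>g\<in>A. \<Oplus>\<^bsub>K\<^esub>h\<in>B. \<Oplus>\<^bsub>K\<^esub>l\<in>C.
       if g \<otimes>\<^bsub>G\<^esub> h \<otimes>\<^bsub>G\<^esub> l = x
       then a g \<otimes>\<^bsub>K\<^esub> b h \<otimes>\<^bsub>K\<^esub> c l \<otimes>\<^bsub>K\<^esub> (\<Lambda> g h \<otimes>\<^bsub>K\<^esub> \<Lambda> (g \<otimes>\<^bsub>G\<^esub> h) l) else \<zero>\<^bsub>K\<^esub>)"
  proof (rule K.finsum_eqI, rule K.finsum_eqI, rule K.finsum_eqI)
  qed (use a b c sub in \<open>auto simp: F_def coeff_closed K.m_ac intro!: K.finsum_closed\<close>)
  finally show ?thesis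
    by (simp only: ABC)
qed

lemma mult_assoc_right:
  assumes a: "a \<in> carrier R" and b: "b \<in> carrier R" and c: "c \<in> carrier R"
  shows "(a \<otimes>\<^bsub>R\<^esub> (b \<otimes>\<^bsub>R\<^esub> c)) x =
    (\<Oplus>\<^bsub>K\<^esub>g\<in>tga_supp K a. \<Oplus>\<^bsub>K\<^esub>h\<in>tga_supp K b. \<Oplus>\<^bsub>K\<^esub>l\<in>tga_supp K c.
       if g \<otimes>\<^bsub>G\<^esub> (h \<otimes>\<^bsub>G\<^esub> l) = x
       then a g \<otimes>\<^bsub>K\<^esub> b h \<otimes>\<^bsub>K\<^esub> c l \<otimes>\<^bsub>K\<^esub> (\<Lambda> h l \<otimes>\<^bsub>K\<^esub> \<Lambda> g (h \<otimes>\<^bsub>G\<^esub> l)) else \<zero>\<^bsub>K\<^esub>)"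
proof -
  define A B C where ABC: "A = tga_supp K a" "B = tga_supp K b" "C = tga_supp K c"
  define P where "P = (\<lambda>(g, h). g \<otimes>\<^bsub>G\<^esub> h) ` (B \<times> C)"
  have fin: "finite A" "finite B" "finite C" "finite P"
    using a b c by (auto simp: ABC P_def supp_finite)
  have sub: "\<And>g. g \<in> A \<Longrightarrow> g \<in> carrier G" "\<And>g. g \<in> B \<Longrightarrow> g \<in> carrier G"
    "\<And>g. g \<in> C \<Longrightarrow> g \<in> carrier G" "\<And>g. g \<in> P \<Longrightarrow> g \<in> carrier G"
    using a b c by (auto simp: ABC P_def dest: supp_carrierD)
  have PI: "h \<otimes>\<^bsub>G\<^esub> l \<in> P" if "h \<in> B" "l \<in> C" for h l
    using that by (auto simp: P_def)
  define F where "F g h l k = (if g \<otimes>\<^bsub>G\<^esub> k = x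
      then a g \<otimes>\<^bsub>K\<^esub> \<Lambda> g k \<otimes>\<^bsub>K\<^esub> (b h \<otimes>\<^bsub>K\<^esub> c l \<otimes>\<^bsub>K\<^esub> \<Lambda> h l) else \<zero>\<^bsub>K\<^esub>)" for g h l k
  define T where "T g h l k = (if h \<otimes>\<^bsub>G\<^esub> l = k then F g h l k else \<zero>\<^bsub>K\<^esub>)" for g h l k
  have F_closed: "F g h l k \<in> carrier K" if "g \<in> A" "h \<in> B" "l \<in> C" "k \<in> P" for g h l k
    using that a b c sub by (simp add: F_def coeff_closed)
  have T_closed: "T g h l k \<in> carrier K" if "g \<in> A" "h \<in> B" "l \<in> C" "k \<in> P" for g h l k
    using that F_closed by (simp add: T_def)
  have bc: "b \<otimes>\<^bsub>R\<^esub> c \<in> carrier R"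
    using b c by (rule mult_closed)
  have "(a \<otimes>\<^bsub>R\<^esub> (b \<otimes>\<^bsub>R\<^esub> c)) x = (\<Oplus>\<^bsub>K\<^esub>g\<in>A. \<Oplus>\<^bsub>K\<^esub>k\<in>P. summand a (b \<otimes>\<^bsub>R\<^esub> c) x g k)"
    using mult_supp[OF b c] fin sub
    by (intro mult_eq[OF a bc]) (auto simp: P_def ABC tga_supp_def[of _ "b \<otimes>\<^bsub>R\<^esub> c"])
  also have "\<dots> = (\<Oplus>\<^bsub>K\<^esub>g\<in>A. \<Oplus>\<^bsub>K\<^esub>k\<in>P. \<Oplus>\<^bsub>K\<^esub>h\<in>B. \<Oplus>\<^bsub>K\<^esub>l\<in>C. T g h l k)"
  proof (rule K.finsum_eqI, rule K.finsum_eqI)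
    fix g k assume g: "g \<in> A" and k: "k \<in> P"
    show "summand a (b \<otimes>\<^bsub>R\<^esub> c) x g k = (\<Oplus>\<^bsub>K\<^esub>h\<in>B. \<Oplus>\<^bsub>K\<^esub>l\<in>C. T g h l k)"
    proof (cases "g \<otimes>\<^bsub>G\<^esub> k = x")
      case True
      have "summand a (b \<otimes>\<^bsub>R\<^esub> c) x g k =
          a g \<otimes>\<^bsub>K\<^esub> \<Lambda> g k \<otimes>\<^bsub>K\<^esub> (\<Oplus>\<^bsub>K\<^esub>h\<in>B. \<Oplus>\<^bsub>K\<^esub>l\<in>C. summand b c k h l)"
        using True k g sub a b c mult_eq[OF b c, of B C k] fin mult_coeff_closed[OF b c, of k]
        by (auto simp: summand_def[of a] ABC K.m_ac coeff_closed subset_iff)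
      also have "\<dots> = (\<Oplus>\<^bsub>K\<^esub>h\<in>B. a g \<otimes>\<^bsub>K\<^esub> \<Lambda> g k \<otimes>\<^bsub>K\<^esub> (\<Oplus>\<^bsub>K\<^esub>l\<in>C. summand b c k h l))"
        using k g sub a b c fin
        by (intro K.finsum_rdistr) (auto intro!: K.finsum_closed summand_closed simp: coeff_closed)
      also have "\<dots> = (\<Oplus>\<^bsub>K\<^esub>h\<in>B. \<Oplus>\<^bsub>K\<^esub>l\<in>C. T g h l k)"
      proof (rule K.finsum_eqI)
        fix h assume h: "h \<in> B"
        have "a g \<otimes>\<^bsub>K\<^esub> \<Lambda> g k \<otimes>\<^bsub>K\<^esub> (\<Oplus>\<^bsub>K\<^esub>l\<in>C. summand b c k h l) =
            (\<Oplus>\<^bsub>K\<^esub>l\<in>C. a g \<otimes>\<^bsub>K\<^esub> \<Lambda> g k \<otimes>\<^bsub>K\<^esub> summand b c k h l)"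
          using k g h sub a b c fin
          by (intro K.finsum_rdistr) (auto intro!: summand_closed simp: coeff_closed)
        also have "\<dots> = (\<Oplus>\<^bsub>K\<^esub>l\<in>C. T g h l k)"
          using k g h sub a b c True
          by (intro K.finsum_cong') (auto simp: summand_def T_def F_def coeff_closed)
        finally show "a g \<otimes>\<^bsub>K\<^esub> \<Lambda> g k \<otimes>\<^bsub>K\<^esub> (\<Oplus>\<^bsub>K\<^esub>l\<in>C. summand b c k h l) = (\<Oplus>\<^bsub>K\<^esub>l\<in>C. T g h l k)" .
      qed (use g k T_closed in \<open>auto intro!: K.finsum_closed\<close>)
      finally show ?thesis .
    next
      case False
      then have "T g h l k = \<zero>\<^bsub>K\<^esub>" for h l
        by (simp add: T_def F_def)
      then show ?thesis
        using False by (simp add: summand_def)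
    qed
  qed (use T_closed in \<open>auto intro!: K.finsum_closed\<close>)
  also have "\<dots> = (\<Oplus>\<^bsub>K\<^esub>g\<in>A. \<Oplus>\<^bsub>K\<^esub>h\<in>B. \<Oplus>\<^bsub>K\<^esub>k\<in>P. \<Oplus>\<^bsub>K\<^esub>l\<in>C. T g h l k)"
  proof (rule K.finsum_eqI, rule K.finsum_swap)
  qed (use T_closed fin in \<open>auto intro!: K.finsum_closed\<close>)
  also have "\<dots> = (\<Oplus>\<^bsub>K\<^esub>g\<in>A. \<Oplus>\<^bsub>K\<^esub>h\<in>B. \<Oplus>\<^bsub>K\<^esub>l\<in>C. \<Oplus>\<^bsub>K\<^esub>k\<in>P. T g h l k)"
  proof (rule K.finsum_eqI, rule K.finsum_eqI, rule K.finsum_swap)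
  qed (use T_closed fin in \<open>auto intro!: K.finsum_closed\<close>)
  also have "\<dots> = (\<Oplus>\<^bsub>K\<^esub>g\<in>A. \<Oplus>\<^bsub>K\<^esub>h\<in>B. \<Oplus>\<^bsub>K\<^esub>l\<in>C. F g h l (h \<otimes>\<^bsub>G\<^esub> l))"
    unfolding T_def
  proof (rule K.finsum_eqI, rule K.finsum_eqI, rule K.finsum_eqI, rule K.finsum_delta)
  qed (use F_closed fin PI in \<open>auto intro!: K.finsum_closed\<close>)
  also have "\<dots> = (\<Oplus>\<^bsub>K\<^esub>g\<in>A. \<Oplus>\<^bsub>K\<^esub>h\<in>B. \<Oplus>\<^bsub>K\<^esub>l\<in>C.
       if g \<otimes>\<^bsub>G\<^esub> (h \<otimes>\<^bsub>G\<^esub> l) = x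
       then a g \<otimes>\<^bsub>K\<^esub> b h \<otimes>\<^bsub>K\<^esub> c l \<otimes>\<^bsub>K\<^esub> (\<Lambda> h l \<otimes>\<^bsub>K\<^esub> \<Lambda> g (h \<otimes>\<^bsub>G\<^esub> l)) else \<zero>\<^bsub>K\<^esub>)"
  proof (rule K.finsum_eqI, rule K.finsum_eqI, rule K.finsum_eqI)
  qed (use a b c sub in \<open>auto simp: F_def coeff_closed K.m_ac intro!: K.finsum_closed\<close>)
  finally show ?thesis
    by (simp only: ABC)
qed

lemma mult_assoc:
  assumes a: "a \<in> carrier R" and b: "b \<in> carrier R" and c: "c \<in> carrier R"
  shows "(a \<otimes>\<^bsub>R\<^esub> b) \<otimes>\<^bsub>R\<^esub> c = a \<otimes>\<^bsub>R\<^esub> (b \<otimes>\<^bsub>R\<^esub> c)"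
proof
  fix x
  note sub = supp_carrierD[OF a] supp_carrierD[OF b] supp_carrierD[OF c]
  show "((a \<otimes>\<^bsub>R\<^esub> b) \<otimes>\<^bsub>R\<^esub> c) x = (a \<otimes>\<^bsub>R\<^esub> (b \<otimes>\<^bsub>R\<^esub> c)) x"
    unfolding mult_assoc_left[OF assms] mult_assoc_right[OF assms]
  proof (rule K.finsum_eqI, rule K.finsum_eqI, rule K.finsum_eqI)
  qed (use a b c sub in \<open>auto simp: coeff_closed L_cocycle G.m_assoc intro!: K.finsum_closed\<close>)
qed

lemma L_one_left:
  assumes g: "g \<in> carrier G"
  shows "\<Lambda> \<one>\<^bsub>G\<^esub> g = \<Lambda> \<one>\<^bsub>G\<^esub> \<one>\<^bsub>G\<^esub>"
proof -
  have "\<Lambda> \<one>\<^bsub>G\<^esub> g \<otimes>\<^bsub>K\<^esub> \<Lambda> \<one>\<^bsub>G\<^esub> \<one>\<^bsub>G\<^esub> = \<Lambda> \<one>\<^bsub>G\<^esub> g \<otimes>\<^bsub>K\<^esub> \<Lambda> \<one>\<^bsub>G\<^esub> g"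
    using L_cocycle[of "\<one>\<^bsub>G\<^esub>" "\<one>\<^bsub>G\<^esub>" g] g by (simp add: K.m_comm)
  then show ?thesis
    using g K.m_lcancel[of "\<Lambda> \<one>\<^bsub>G\<^esub> g"] by simp
qed

lemma L_one_right:
  assumes g: "g \<in> carrier G"
  shows "\<Lambda> g \<one>\<^bsub>G\<^esub> = \<Lambda> \<one>\<^bsub>G\<^esub> \<one>\<^bsub>G\<^esub>"
proof -
  have "\<Lambda> g \<one>\<^bsub>G\<^esub> \<otimes>\<^bsub>K\<^esub> \<Lambda> g \<one>\<^bsub>G\<^esub> = \<Lambda> g \<one>\<^bsub>G\<^esub> \<otimes>\<^bsub>K\<^esub> \<Lambda> \<one>\<^bsub>G\<^esub> \<one>\<^bsub>G\<^esub>"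
    using L_cocycle[of g "\<one>\<^bsub>G\<^esub>" "\<one>\<^bsub>G\<^esub>"] g by (simp add: K.m_comm)
  then show ?thesis
    using g K.m_lcancel[of "\<Lambda> g \<one>\<^bsub>G\<^esub>"] by simp
qed

lemma inv_L_one:
  "inv\<^bsub>K\<^esub> (\<Lambda> \<one>\<^bsub>G\<^esub> \<one>\<^bsub>G\<^esub>) \<otimes>\<^bsub>K\<^esub> \<Lambda> \<one>\<^bsub>G\<^esub> \<one>\<^bsub>G\<^esub> = \<one>\<^bsub>K\<^esub>"
  "inv\<^bsub>K\<^esub> (\<Lambda> \<one>\<^bsub>G\<^esub> \<one>\<^bsub>G\<^esub>) \<in> carrier K"
  by (auto simp: K.field_Units inv_closed)

lemma one_mult:
  assumes a: "a \<in> carrier R"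
  shows "\<one>\<^bsub>R\<^esub> \<otimes>\<^bsub>R\<^esub> a = a"
proof
  fix x
  let ?A = "insert x (tga_supp K a) \<inter> carrier G"
  have A: "finite ?A" "tga_supp K a \<subseteq> ?A" "?A \<subseteq> carrier G"
    using a by (auto simp: supp_finite dest: supp_carrierD)
  have t: "summand \<one>\<^bsub>R\<^esub> a x \<one>\<^bsub>G\<^esub> h = (if x = h then a h else \<zero>\<^bsub>K\<^esub>)" if "h \<in> ?A" for h
  proof -
    have "inv\<^bsub>K\<^esub> (\<Lambda> \<one>\<^bsub>G\<^esub> \<one>\<^bsub>G\<^esub>) \<otimes>\<^bsub>K\<^esub> a h \<otimes>\<^bsub>K\<^esub> \<Lambda> \<one>\<^bsub>G\<^esub> \<one>\<^bsub>G\<^esub>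
        = a h \<otimes>\<^bsub>K\<^esub> (inv\<^bsub>K\<^esub> (\<Lambda> \<one>\<^bsub>G\<^esub> \<one>\<^bsub>G\<^esub>) \<otimes>\<^bsub>K\<^esub> \<Lambda> \<one>\<^bsub>G\<^esub> \<one>\<^bsub>G\<^esub>)"
      using a inv_L_one(2) by (simp add: coeff_closed K.m_ac)
    then have "inv\<^bsub>K\<^esub> (\<Lambda> \<one>\<^bsub>G\<^esub> \<one>\<^bsub>G\<^esub>) \<otimes>\<^bsub>K\<^esub> a h \<otimes>\<^bsub>K\<^esub> \<Lambda> \<one>\<^bsub>G\<^esub> h = a h"
      using that a inv_L_one(1) L_one_left[of h] by (simp add: coeff_closed)
    then show ?thesis
      using that by (auto simp: summand_def one_eq)
  qed
  have "(\<one>\<^bsub>R\<^esub> \<otimes>\<^bsub>R\<^esub> a) x = (\<Oplus>\<^bsub>K\<^esub>g\<in>{\<one>\<^bsub>G\<^esub>}. \<Oplus>\<^bsub>K\<^esub>h\<in>?A. summand \<one>\<^bsub>R\<^esub> a x g h)"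
    by (rule mult_eq[OF one_closed a _ _ _ A]) (auto simp: tga_supp_def one_eq)
  also have "\<dots> = (\<Oplus>\<^bsub>K\<^esub>h\<in>?A. summand \<one>\<^bsub>R\<^esub> a x \<one>\<^bsub>G\<^esub> h)"
    using a one_closed by (simp add: summand_closed)
  also have "\<dots> = (\<Oplus>\<^bsub>K\<^esub>h\<in>?A. if x = h then a h else \<zero>\<^bsub>K\<^esub>)"
    using a t by (intro K.finsum_cong') (auto simp: coeff_closed)
  also have "\<dots> = a x"
  proof (cases "x \<in> carrier G")
    case True
    then show ?thesis
      using A a by (intro K.finsum_delta) (auto simp: coeff_closed)
  next
    case False
    then have "(\<Oplus>\<^bsub>K\<^esub>h\<in>?A. if x = h then a h else \<zero>\<^bsub>K\<^esub>) = (\<Oplus>\<^bsub>K\<^esub>h\<in>?A. \<zero>\<^bsub>K\<^esub>)"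
      by (intro K.finsum_cong') auto
    moreover have "a x = \<zero>\<^bsub>K\<^esub>"
      using False a by (meson coeff_zero supp_carrierD)
    ultimately show ?thesis
      by simp
  qed
  finally show "(\<one>\<^bsub>R\<^esub> \<otimes>\<^bsub>R\<^esub> a) x = a x" .
qed

lemma mult_one:
  assumes a: "a \<in> carrier R"
  shows "a \<otimes>\<^bsub>R\<^esub> \<one>\<^bsub>R\<^esub> = a"
proof
  fix x
  let ?A = "insert x (tga_supp K a) \<inter> carrier G"
  have A: "finite ?A" "tga_supp K a \<subseteq> ?A" "?A \<subseteq> carrier G"
    using a by (auto simp: supp_finite dest: supp_carrierD)
  have t: "summand a \<one>\<^bsub>R\<^esub> x g \<one>\<^bsub>G\<^esub> = (if x = g then a g else \<zero>\<^bsub>K\<^esub>)" if "g \<in> ?A" for g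
  proof -
    have "a g \<otimes>\<^bsub>K\<^esub> inv\<^bsub>K\<^esub> (\<Lambda> \<one>\<^bsub>G\<^esub> \<one>\<^bsub>G\<^esub>) \<otimes>\<^bsub>K\<^esub> \<Lambda> \<one>\<^bsub>G\<^esub> \<one>\<^bsub>G\<^esub>
        = a g \<otimes>\<^bsub>K\<^esub> (inv\<^bsub>K\<^esub> (\<Lambda> \<one>\<^bsub>G\<^esub> \<one>\<^bsub>G\<^esub>) \<otimes>\<^bsub>K\<^esub> \<Lambda> \<one>\<^bsub>G\<^esub> \<one>\<^bsub>G\<^esub>)"
      using a inv_L_one(2) by (simp add: coeff_closed K.m_assoc)
    then have "a g \<otimes>\<^bsub>K\<^esub> inv\<^bsub>K\<^esub> (\<Lambda> \<one>\<^bsub>G\<^esub> \<one>\<^bsub>G\<^esub>) \<otimes>\<^bsub>K\<^esub> \<Lambda> g \<one>\<^bsub>G\<^esub> = a g"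
      using that a inv_L_one(1) L_one_right[of g] by (simp add: coeff_closed)
    then show ?thesis
      using that by (auto simp: summand_def one_eq)
  qed
  have "(a \<otimes>\<^bsub>R\<^esub> \<one>\<^bsub>R\<^esub>) x = (\<Oplus>\<^bsub>K\<^esub>g\<in>?A. \<Oplus>\<^bsub>K\<^esub>h\<in>{\<one>\<^bsub>G\<^esub>}. summand a \<one>\<^bsub>R\<^esub> x g h)"
    by (rule mult_eq[OF a one_closed A]) (auto simp: tga_supp_def one_eq)
  also have "\<dots> = (\<Oplus>\<^bsub>K\<^esub>g\<in>?A. if x = g then a g else \<zero>\<^bsub>K\<^esub>)"
  proof (rule K.finsum_eqI)
    fix g assume g: "g \<in> ?A"
    have "(\<Oplus>\<^bsub>K\<^esub>h\<in>{\<one>\<^bsub>G\<^esub>}. summand a \<one>\<^bsub>R\<^esub> x g h) = summand a \<one>\<^bsub>R\<^esub> x g \<one>\<^bsub>G\<^esub>"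
      using g a one_closed by (simp add: summand_closed)
    then show "(\<Oplus>\<^bsub>K\<^esub>h\<in>{\<one>\<^bsub>G\<^esub>}. summand a \<one>\<^bsub>R\<^esub> x g h) = (if x = g then a g else \<zero>\<^bsub>K\<^esub>)"
      using t[OF g] by simp
  qed (use a in \<open>auto simp: coeff_closed\<close>)
  also have "\<dots> = a x"
  proof (cases "x \<in> carrier G")
    case True
    then show ?thesis
      using A a by (intro K.finsum_delta) (auto simp: coeff_closed)
  next
    case False
    then have "(\<Oplus>\<^bsub>K\<^esub>h\<in>?A. if x = h then a h else \<zero>\<^bsub>K\<^esub>) = (\<Oplus>\<^bsub>K\<^esub>h\<in>?A. \<zero>\<^bsub>K\<^esub>)"
      by (intro K.finsum_cong') auto
    moreover have "a x = \<zero>\<^bsub>K\<^esub>"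
      using False a by (meson coeff_zero supp_carrierD)
    ultimately show ?thesis
      by simp
  qed
  finally show "(a \<otimes>\<^bsub>R\<^esub> \<one>\<^bsub>R\<^esub>) x = a x" .
qed

lemma l_distr_R:
  assumes a: "a \<in> carrier R" and b: "b \<in> carrier R" and c: "c \<in> carrier R"
  shows "(a \<oplus>\<^bsub>R\<^esub> b) \<otimes>\<^bsub>R\<^esub> c = a \<otimes>\<^bsub>R\<^esub> c \<oplus>\<^bsub>R\<^esub> b \<otimes>\<^bsub>R\<^esub> c"
proof
  fix x
  let ?A = "tga_supp K a \<union> tga_supp K b" and ?C = "tga_supp K c"
  have A: "finite ?A" "?A \<subseteq> carrier G" and C: "finite ?C" "?C \<subseteq> ?C" "?C \<subseteq> carrier G"
    using a b c by (auto simp: supp_finite dest: supp_carrierD)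
  have "tga_supp K (a \<oplus>\<^bsub>R\<^esub> b) \<subseteq> ?A"
    by (auto simp: tga_supp_def add_eq)
  then have "((a \<oplus>\<^bsub>R\<^esub> b) \<otimes>\<^bsub>R\<^esub> c) x = (\<Oplus>\<^bsub>K\<^esub>g\<in>?A. \<Oplus>\<^bsub>K\<^esub>h\<in>?C. summand (a \<oplus>\<^bsub>R\<^esub> b) c x g h)"
    using A C by (intro mult_eq[OF add_closed[OF a b] c]) auto
  also have "\<dots> = (\<Oplus>\<^bsub>K\<^esub>g\<in>?A. \<Oplus>\<^bsub>K\<^esub>h\<in>?C. summand a c x g h \<oplus>\<^bsub>K\<^esub> summand b c x g h)"
  proof (rule K.finsum_eqI, rule K.finsum_eqI)
  qed (use a b c A(2) C(3) in
      \<open>auto simp: summand_def add_eq coeff_closed K.l_distr subset_iff intro!: K.finsum_closed\<close>)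
  also have "\<dots> = (\<Oplus>\<^bsub>K\<^esub>g\<in>?A. (\<Oplus>\<^bsub>K\<^esub>h\<in>?C. summand a c x g h) \<oplus>\<^bsub>K\<^esub> (\<Oplus>\<^bsub>K\<^esub>h\<in>?C. summand b c x g h))"
  proof (rule K.finsum_eqI, rule K.finsum_addf)
  qed (use a b c A(2) C(3) in \<open>auto intro!: K.finsum_closed summand_closed\<close>)
  also have "\<dots> = (\<Oplus>\<^bsub>K\<^esub>g\<in>?A. \<Oplus>\<^bsub>K\<^esub>h\<in>?C. summand a c x g h) \<oplus>\<^bsub>K\<^esub> (\<Oplus>\<^bsub>K\<^esub>g\<in>?A. \<Oplus>\<^bsub>K\<^esub>h\<in>?C. summand b c x g h)"
    using a b c A(2) C(3)
    by (intro K.finsum_addf funcsetI K.finsum_closed) (auto intro!: summand_closed)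
  also have "\<dots> = (a \<otimes>\<^bsub>R\<^esub> c \<oplus>\<^bsub>R\<^esub> b \<otimes>\<^bsub>R\<^esub> c) x"
    using A C by (simp add: add_eq mult_eq[OF a c, of ?A ?C] mult_eq[OF b c, of ?A ?C])
  finally show "((a \<oplus>\<^bsub>R\<^esub> b) \<otimes>\<^bsub>R\<^esub> c) x = (a \<otimes>\<^bsub>R\<^esub> c \<oplus>\<^bsub>R\<^esub> b \<otimes>\<^bsub>R\<^esub> c) x" .
qed

lemma r_distr_R:
  assumes a: "a \<in> carrier R" and b: "b \<in> carrier R" and c: "c \<in> carrier R"
  shows "c \<otimes>\<^bsub>R\<^esub> (a \<oplus>\<^bsub>R\<^esub> b) = c \<otimes>\<^bsub>R\<^esub> a \<oplus>\<^bsub>R\<^esub> c \<otimes>\<^bsub>R\<^esub> b"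
proof
  fix x
  let ?A = "tga_supp K a \<union> tga_supp K b" and ?C = "tga_supp K c"
  have A: "finite ?A" "?A \<subseteq> carrier G" and C: "finite ?C" "?C \<subseteq> ?C" "?C \<subseteq> carrier G"
    using a b c by (auto simp: supp_finite dest: supp_carrierD)
  have "tga_supp K (a \<oplus>\<^bsub>R\<^esub> b) \<subseteq> ?A"
    by (auto simp: tga_supp_def add_eq)
  then have "(c \<otimes>\<^bsub>R\<^esub> (a \<oplus>\<^bsub>R\<^esub> b)) x = (\<Oplus>\<^bsub>K\<^esub>g\<in>?C. \<Oplus>\<^bsub>K\<^esub>h\<in>?A. summand c (a \<oplus>\<^bsub>R\<^esub> b) x g h)"
    using A C by (intro mult_eq[OF c add_closed[OF a b]]) auto
  also have "\<dots> = (\<Oplus>\<^bsub>K\<^esub>g\<in>?C. \<Oplus>\<^bsub>K\<^esub>h\<in>?A. summand c a x g h \<oplus>\<^bsub>K\<^esub> summand c b x g h)"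
  proof (rule K.finsum_eqI, rule K.finsum_eqI)
  qed (use a b c A(2) C(3) in
      \<open>auto simp: summand_def add_eq coeff_closed K.l_distr K.r_distr subset_iff intro!: K.finsum_closed\<close>)
  also have "\<dots> = (\<Oplus>\<^bsub>K\<^esub>g\<in>?C. (\<Oplus>\<^bsub>K\<^esub>h\<in>?A. summand c a x g h) \<oplus>\<^bsub>K\<^esub> (\<Oplus>\<^bsub>K\<^esub>h\<in>?A. summand c b x g h))"
  proof (rule K.finsum_eqI, rule K.finsum_addf)
  qed (use a b c A(2) C(3) in \<open>auto intro!: K.finsum_closed summand_closed\<close>)
  also have "\<dots> = (\<Oplus>\<^bsub>K\<^esub>g\<in>?C. \<Oplus>\<^bsub>K\<^esub>h\<in>?A. summand c a x g h) \<oplus>\<^bsub>K\<^esub> (\<Oplus>\<^bsub>K\<^esub>g\<in>?C. \<Oplus>\<^bsub>K\<^esub>h\<in>?A. summand c b x g h)"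
    using a b c A(2) C(3)
    by (intro K.finsum_addf funcsetI K.finsum_closed) (auto intro!: summand_closed)
  also have "\<dots> = (c \<otimes>\<^bsub>R\<^esub> a \<oplus>\<^bsub>R\<^esub> c \<otimes>\<^bsub>R\<^esub> b) x"
    using A C by (simp add: add_eq mult_eq[OF c a, of ?C ?A] mult_eq[OF c b, of ?C ?A])
  finally show "(c \<otimes>\<^bsub>R\<^esub> (a \<oplus>\<^bsub>R\<^esub> b)) x = (c \<otimes>\<^bsub>R\<^esub> a \<oplus>\<^bsub>R\<^esub> c \<otimes>\<^bsub>R\<^esub> b) x" .
qed

theorem ring_R: "ring R"
  by (intro ringI abelian_group_R monoidI)
     (auto simp: mult_closed one_closed mult_assoc one_mult mult_one l_distr_R r_distr_R)

end

end

theory Submission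
  imports Defs "HOL-Algebra.Multiplicative_Group" "HOL-Algebra.Polynomial_Divisibility"
    "HOL-Number_Theory.Cong"
begin

text \<open>
  Let \<open>a\<close>, \<open>b\<close> be elements of finite order in the FC-center. If \<open>K\<close> is infinite, then \<open>b - c\<close>
  is a unit for all but finitely many scalars \<open>c\<close>, so two different such units conjugate \<open>a\<close>
  to the same element, which forces \<open>a b = b a\<close>.

  If \<open>K\<close> is finite, then \<open>G\<close> is infinite. A nilpotent \<open>x\<close> with finitely many conjugates commutes
  with every \<open>a\<close> with finitely many conjugates: for infinitely many group elements \<open>h\<close>, all
  commuting with \<open>x\<close> and \<open>a\<close> up to a fixed factor, the units \<open>1 + u\<^sub>h x\<close> conjugate \<open>a\<close> to the same
  element, so \<open>u\<^sub>h d (1 + u\<^sub>h x)\<^sup>-\<^sup>1\<close> with \<open>d = x a - a x\<close> does not depend on \<open>h\<close>. If \<open>d \<noteq> 0\<close>, multiply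
  by \<open>x\<^sup>m\<close> where \<open>d x\<^sup>m \<noteq> 0 = d x\<^sup>m\<^sup>+\<^sup>1\<close>: then \<open>u\<^sub>h d x\<^sup>m\<close> takes the same value infinitely often, which is
  impossible by comparing supports.

  By Dietzmann's argument \<open>a\<close> and \<open>b\<close> generate a finite ring, all of whose nilpotent elements are
  central by the above. Its quotient by the nilpotent elements is a finite reduced ring, hence
  commutative by Wedderburn's theorem. So \<open>a b - b a\<close> is nilpotent, and therefore the commutator
  of \<open>a\<close> and \<open>b\<close> is unipotent and commutes with the FC-center.
\<close>

section \<open>Dietzmann's lemma\<close>

context monoid
begin

definition list_prod :: "'a list \<Rightarrow> 'a" where
  "list_prod ws = foldr (\<otimes>) ws \<one>"

lemma list_prod_simps [simp]:
  "list_prod [] = \<one>" "list_prod (w # ws) = w \<otimes> list_prod ws"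
  by (simp_all add: list_prod_def)

lemma list_prod_closed [simp]: "set ws \<subseteq> carrier G \<Longrightarrow> list_prod ws \<in> carrier G"
  by (induction ws) auto

lemma list_prod_append:
  "set us \<subseteq> carrier G \<Longrightarrow> set ws \<subseteq> carrier G \<Longrightarrow>
    list_prod (us @ ws) = list_prod us \<otimes> list_prod ws"
  by (induction us) (auto simp: m_assoc)

end

lemma (in group) list_prod_move_front:
  assumes Y: "Y \<subseteq> carrier G" "\<And>x y. x \<in> Y \<Longrightarrow> y \<in> carrier G \<Longrightarrow> inv y \<otimes> x \<otimes> y \<in> Y"
    and x: "x \<in> Y" and ws: "set ws \<subseteq> Y" and k: "k \<le> count_list ws x"
  shows "\<exists>ws'. set ws' \<subseteq> Y \<and> length ws = k + length ws' \<and> list_prod ws = x [^] k \<otimes> list_prod ws'"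
  using ws k
proof (induction ws arbitrary: k)
  case Nil
  then show ?case by (intro exI[of _ "[]"]) auto
next
  case (Cons y ws)
  have c: "x \<in> carrier G" "y \<in> carrier G" "set ws \<subseteq> carrier G"
    using Cons.prems Y x by auto
  show ?case
  proof (cases "k = 0")
    case True
    then show ?thesis
      using Cons.prems c by (intro exI[of _ "y # ws"]) auto
  next
    case k0: False
    show ?thesis
    proof (cases "y = x")
      case True
      have "k - 1 \<le> count_list ws x" "set ws \<subseteq> Y"
        using Cons.prems True k0 by simp_all
      from Cons.IH[OF this(2,1)] obtain ws' where ws': "set ws' \<subseteq> Y"
        "length ws = (k - 1) + length ws'" "list_prod ws = x [^] (k - 1) \<otimes> list_prod ws'"
        by blast
      have e: "x [^] k = x \<otimes> x [^] (k - 1)"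
        using k0 c nat_pow_Suc2[of x "k - 1"] by (simp del: nat_pow_Suc)
      have "set ws' \<subseteq> carrier G" using ws' Y by auto
      then show ?thesis
        using ws' True c k0 by (intro exI[of _ ws']) (auto simp: e m_assoc)
    next
      case False
      then have "k \<le> count_list ws x" "set ws \<subseteq> Y"
        using Cons.prems by simp_all
      from Cons.IH[OF this(2,1)] obtain ws' where ws': "set ws' \<subseteq> Y"
        "length ws = k + length ws'" "list_prod ws = x [^] k \<otimes> list_prod ws'"
        by blast
      have s: "set ws' \<subseteq> carrier G" using ws' Y by auto
      have "x [^] k \<otimes> (inv (x [^] k) \<otimes> y \<otimes> x [^] k \<otimes> list_prod ws')
          = (x [^] k \<otimes> inv (x [^] k)) \<otimes> (y \<otimes> (x [^] k \<otimes> list_prod ws'))"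
        using c s by (simp only: m_assoc list_prod_closed nat_pow_closed inv_closed m_closed)
      also have "\<dots> = y \<otimes> (x [^] k \<otimes> list_prod ws')"
        using c s by simp
      finally show ?thesis
        using ws' Y Cons.prems c
        by (intro exI[of _ "(inv (x [^] k) \<otimes> y \<otimes> x [^] k) # ws'"]) auto
    qed
  qed
qed

lemma (in group) finite_list_prods:
  assumes Y: "Y \<subseteq> carrier G" "\<And>x y. x \<in> Y \<Longrightarrow> y \<in> carrier G \<Longrightarrow> inv y \<otimes> x \<otimes> y \<in> Y"
    and fin: "finite Y" and n: "n > 0" "\<And>x. x \<in> Y \<Longrightarrow> x [^] (n::nat) = \<one>"
  shows "finite {list_prod ws | ws. set ws \<subseteq> Y}"
proof (rule finite_subset)
  show "finite (list_prod ` {ws. set ws \<subseteq> Y \<and> length ws \<le> card Y * n})"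
    by (intro finite_imageI finite_lists_length_le fin)
  have "list_prod ws \<in> list_prod ` {ws. set ws \<subseteq> Y \<and> length ws \<le> card Y * n}"
    if "set ws \<subseteq> Y" for ws
    using that
  proof (induction "length ws" arbitrary: ws rule: less_induct)
    case less
    show ?case
    proof (cases "length ws \<le> card Y * n")
      case True
      then show ?thesis using less.prems by blast
    next
      case False
      have "\<exists>x\<in>Y. n \<le> count_list ws x"
      proof (rule ccontr)
        assume "\<not> ?thesis"
        then have "count_list ws x \<le> n" if "x \<in> Y" for x
          using that by force
        then have "(\<Sum>x\<in>Y. count_list ws x) \<le> card Y * n"
          using sum_bounded_above[of Y "count_list ws" n] by auto
        then show False
          using False sum_count_set[OF less.prems fin] by simp
      qed
      then obtain x where x: "x \<in> Y" "n \<le> count_list ws x" by blast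
      from list_prod_move_front[OF Y x(1) less.prems x(2)]
      obtain ws' where ws': "set ws' \<subseteq> Y" "length ws = n + length ws'"
        "list_prod ws = x [^] n \<otimes> list_prod ws'" by auto
      then have "list_prod ws = list_prod ws'"
        using n(2)[OF x(1)] Y by (metis l_one list_prod_closed order_trans)
      then show ?thesis
        using less.hyps[of ws'] ws' n by simp
    qed
  qed
  then show "{list_prod ws | ws. set ws \<subseteq> Y}
      \<subseteq> list_prod ` {ws. set ws \<subseteq> Y \<and> length ws \<le> card Y * n}"
    by blast
qed

section \<open>Wedderburn's little theorem\<close>

lemma (in ring) pow_sum_step:
  assumes "x \<in> carrier R"
  shows "x \<otimes> (\<Oplus>k\<in>{..<n::nat}. x [^] k) \<oplus> \<one> = (\<Oplus>k\<in>{..<n}. x [^] k) \<oplus> x [^] n"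
proof (induction n)
  case 0
  then show ?case using assms by simp
next
  case (Suc n)
  let ?S = "\<Oplus>k\<in>{..<n}. x [^] k"
  have S: "?S \<in> carrier R" using assms by (intro finsum_closed) auto
  have e: "(\<Oplus>k\<in>{..<Suc n}. x [^] k) = x [^] n \<oplus> ?S"
    using assms by (simp add: lessThan_Suc)
  have p: "x \<otimes> x [^] n = x [^] Suc n"
    using nat_pow_Suc2[OF assms, of n] by (simp only:)
  have "x \<otimes> (x [^] n \<oplus> ?S) \<oplus> \<one> = x [^] Suc n \<oplus> (x \<otimes> ?S \<oplus> \<one>)"
    using assms S by (simp add: r_distr p a_assoc del: nat_pow_Suc)
  also have "\<dots> = x [^] Suc n \<oplus> (?S \<oplus> x [^] n)"
    by (simp only: Suc.IH)
  also have "\<dots> = (x [^] n \<oplus> ?S) \<oplus> x [^] Suc n"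
    using assms S by (simp add: a_ac)
  finally show ?case unfolding e .
qed

lemma (in ring) pow_commute:
  assumes "x \<in> carrier R" "y \<in> carrier R" "x \<otimes> y = y \<otimes> x"
  shows "x [^] (n::nat) \<otimes> y = y \<otimes> x [^] n"
  using assms by (induction n) (auto simp: m_assoc, metis m_assoc nat_pow_closed)

lemma (in abelian_monoid) finsum_single:
  assumes "finite A" "a \<in> A" "f a \<in> carrier G" "\<And>x. x \<in> A \<Longrightarrow> x \<noteq> a \<Longrightarrow> f x = \<zero>"
  shows "finsum G f A = f a"
proof -
  have "finsum G f A = (\<Oplus>x\<in>A. if a = x then f x else \<zero>)"
    using assms by (intro finsum_cong') auto
  then show ?thesis using assms finsum_delta[of A a f] by simp
qed

lemma (in abelian_group) finsum_rotate:
  assumes f: "\<And>k::nat. f k \<in> carrier G" "f m = f 0"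
  shows "(\<Oplus>k\<in>{..<m}. f (Suc k)) = (\<Oplus>k\<in>{..<m}. f k)"
proof -
  have "(\<Oplus>k\<in>{..<Suc m}. f k) = f m \<oplus> (\<Oplus>k\<in>{..<m}. f k)"
    using f(1) by (simp add: lessThan_Suc)
  moreover have "(\<Oplus>k\<in>{..<Suc m}. f k) = f 0 \<oplus> (\<Oplus>k\<in>Suc ` {..<m}. f k)"
    using f(1) by (simp add: lessThan_Suc_eq_insert_0)
  moreover have "(\<Oplus>k\<in>Suc ` {..<m}. f k) = (\<Oplus>k\<in>{..<m}. f (Suc k))"
    using f(1) by (intro add.finprod_reindex) auto
  ultimately have "f 0 \<oplus> (\<Oplus>k\<in>{..<m}. f (Suc k)) = f 0 \<oplus> (\<Oplus>k\<in>{..<m}. f k)"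
    using f(2) by metis
  then show ?thesis
    by (subst (asm) add.Units_l_cancel) (use f(1) in \<open>auto intro!: finsum_closed\<close>)
qed

locale finite_division_ring = ring +
  assumes finite_carrier: "finite (carrier R)"
    and Units_eq: "Units R = carrier R - {\<zero>}"
begin

lemma one_nonzero: "\<one> \<noteq> \<zero>"
  using Units_one_closed Units_eq by auto

lemma mult_eq_zero:
  assumes "a \<in> carrier R" "b \<in> carrier R" "a \<otimes> b = \<zero>"
  shows "a = \<zero> \<or> b = \<zero>"
  using assms Units_eq by (metis Diff_iff Units_l_cancel r_null singletonD zero_closed)

lemma pow_sum_eq_zero:
  assumes x: "x \<in> carrier R" "x [^] n = \<one>" "x \<noteq> \<one>"
  shows "(\<Oplus>k\<in>{..<n::nat}. x [^] k) = \<zero>"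
proof -
  let ?S = "\<Oplus>k\<in>{..<n}. x [^] k"
  have S: "?S \<in> carrier R" using x by (intro finsum_closed) auto
  have "x \<otimes> ?S = ?S"
    using pow_sum_step[OF x(1), of n] x S by (simp add: add.right_cancel)
  then have "(x \<ominus> \<one>) \<otimes> ?S = \<zero>"
    using x S by (simp add: minus_eq l_distr l_minus r_neg)
  then show ?thesis
    using mult_eq_zero[of "x \<ominus> \<one>" ?S] x S by simp
qed

end

text \<open>The nonzero elements of a maximal commutative subset form a group as in this locale. To show
  that \<open>\<gamma>\<close> is central, suppose that it is not. Fourier analysis over \<open>\<langle>\<gamma>\<rangle>\<close> provides an \<open>x\<close> that
  does not commute with \<open>\<gamma>\<close> but normalizes \<open>\<langle>\<gamma>\<rangle>\<close>; it also takes the place of polynomial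
  identities and of Dedekind's independence of characters. Hilbert 90 shows that \<open>x\<close> can be
  changed by a power of \<open>\<gamma>\<close> to some \<open>v \<noteq> 1\<close> with \<open>v\<^sup>m = 1\<close>, where \<open>m\<close> is the order of the
  automorphism induced by \<open>x\<close>. Then \<open>1 + v + \<dots> + v\<^sup>m\<^sup>-\<^sup>1 = 0\<close>, although these summands
  have distinct eigenvalues under conjugation.\<close>

locale self_centralizing_cyclic = finite_division_ring +
  fixes \<gamma> :: 'a and M :: nat
  assumes \<gamma>: "\<gamma> \<in> carrier R" and M: "M > 0"
    and pow_eq_iff: "\<And>i k. \<gamma> [^] i = \<gamma> [^] k \<longleftrightarrow> [i = k] (mod M)"
    and centralizer: "\<And>x. x \<in> carrier R \<Longrightarrow> x \<noteq> \<zero> \<Longrightarrow> x \<otimes> \<gamma> = \<gamma> \<otimes> x \<Longrightarrow> \<exists>i::nat. x = \<gamma> [^] i"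
    and M_nonzero: "[M] \<cdot> \<one> \<noteq> \<zero>"
begin

lemma \<gamma>_pow_closed [simp]: "\<gamma> [^] (n::nat) \<in> carrier R"
  using \<gamma> by simp

lemma pow_M: "\<gamma> [^] M = \<one>"
  using pow_eq_iff[of M 0] by (simp add: cong_def)

lemma \<gamma>_mult: "\<gamma> [^] (a::nat) \<otimes> \<gamma> [^] (b::nat) = \<gamma> [^] (a + b)"
  using \<gamma> by (simp add: nat_pow_mult)

lemma character_sum:
  "(\<Oplus>k\<in>{..<M}. (\<gamma> [^] (n::nat)) [^] k) = (if [n = 0] (mod M) then [M] \<cdot> \<one> else \<zero>)"
proof (cases "[n = 0] (mod M)")
  case True
  then have "\<gamma> [^] n = \<one>" using pow_eq_iff[of n 0] by simp
  then show ?thesis using True by (simp add: add.finprod_const)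
next
  case False
  then have "\<gamma> [^] n \<noteq> \<one>" using pow_eq_iff[of n 0] by simp
  moreover have "(\<gamma> [^] n) [^] M = \<one>"
    using \<gamma> pow_M by (metis mult.commute nat_pow_one nat_pow_pow)
  ultimately show ?thesis
    using pow_sum_eq_zero[of "\<gamma> [^] n" M] False by simp
qed

lemma character_sum_shift:
  "(\<Oplus>k\<in>{..<M}. \<gamma> [^] ((n::nat) * k) \<otimes> \<gamma> [^] (M * k - k)) = (if [n = 1] (mod M) then [M] \<cdot> \<one> else \<zero>)"
proof -
  have "\<gamma> [^] (n * k) \<otimes> \<gamma> [^] (M * k - k) = (\<gamma> [^] (n + (M - 1))) [^] k" for k
  proof -
    have "M * k - k = (M - 1) * k" by (simp add: diff_mult_distrib)
    then show ?thesis
      unfolding \<gamma>_mult nat_pow_pow[OF \<gamma>] by (simp add: algebra_simps)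
  qed
  then have "(\<Oplus>k\<in>{..<M}. \<gamma> [^] (n * k) \<otimes> \<gamma> [^] (M * k - k))
      = (\<Oplus>k\<in>{..<M}. (\<gamma> [^] (n + (M - 1))) [^] k)"
    by (simp only:)
  moreover have "[n + (M - 1) = 0] (mod M) \<longleftrightarrow> [n = 1] (mod M)"
  proof -
    have "[n + (M - 1) = 0] (mod M) \<longleftrightarrow> [n + (M - 1) = 1 + (M - 1)] (mod M)"
      using M by (simp add: cong_def)
    also have "\<dots> \<longleftrightarrow> [n = 1] (mod M)"
      by (rule cong_add_rcancel_nat)
    finally show ?thesis .
  qed
  ultimately show ?thesis by (simp only: character_sum)
qed

lemma eigenvector_exists:
  assumes x0: "x0 \<in> carrier R" "x0 \<otimes> \<gamma> \<noteq> \<gamma> \<otimes> x0"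
  obtains x j where "x \<in> carrier R" "x \<otimes> \<gamma> \<noteq> \<gamma> \<otimes> x" "\<gamma> \<otimes> x = x \<otimes> \<gamma> [^] (j::nat)"
proof -
  \<comment> \<open>The exponent \<open>M k - k\<close> represents \<open>-k\<close> modulo \<open>M\<close>, so \<open>y\<close> is the Fourier transform of
    \<open>k \<mapsto> \<gamma>\<^sup>k x0 \<gamma>\<^sup>-\<^sup>j\<^sup>k\<close>.\<close>
  define y where "y j = (\<Oplus>k\<in>{..<M}. \<gamma> [^] k \<otimes> x0 \<otimes> \<gamma> [^] (j * (M * k - k)))" for j :: nat
  have y_closed: "y j \<in> carrier R" for j
    unfolding y_def using x0 by (intro finsum_closed) auto
  have y_eig: "\<gamma> \<otimes> y j = y j \<otimes> \<gamma> [^] j" for j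
  proof -
    define f where "f k = \<gamma> [^] k \<otimes> x0 \<otimes> \<gamma> [^] (j * (M * k - k))" for k :: nat
    have fc: "f k \<in> carrier R" for k using x0 by (simp add: f_def)
    have step: "\<gamma> \<otimes> f k = f (Suc k) \<otimes> \<gamma> [^] j" for k
    proof -
      have "[j * (M * k - k) = j * (M * Suc k - Suc k) + j] (mod M)"
      proof -
        have "j * (M * Suc k - Suc k) + j = j * (M * k - k) + M * j"
          using M by (cases M) (simp_all add: algebra_simps)
        then show ?thesis by (simp add: cong_def)
      qed
      then have "\<gamma> [^] (j * (M * Suc k - Suc k)) \<otimes> \<gamma> [^] j = \<gamma> [^] (j * (M * k - k))"
        unfolding \<gamma>_mult pow_eq_iff by (rule cong_sym)
      then have "f (Suc k) \<otimes> \<gamma> [^] j = \<gamma> [^] Suc k \<otimes> x0 \<otimes> \<gamma> [^] (j * (M * k - k))"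
        using x0 unfolding f_def by (simp only: m_assoc \<gamma>_pow_closed m_closed)
      also have "\<gamma> [^] Suc k = \<gamma> \<otimes> \<gamma> [^] k"
        using \<gamma> by (rule nat_pow_Suc2)
      finally show ?thesis
        using x0 \<gamma> unfolding f_def by (simp only: m_assoc \<gamma>_pow_closed m_closed)
    qed
    have wrap: "f M = f 0"
    proof -
      have "\<gamma> [^] (j * (M * M - M)) = \<gamma> [^] (0::nat)"
        unfolding pow_eq_iff by (simp add: cong_def flip: right_diff_distrib')
      then show ?thesis by (simp add: f_def pow_M)
    qed
    have "\<gamma> \<otimes> y j = (\<Oplus>k\<in>{..<M}. \<gamma> \<otimes> f k)"
      unfolding y_def f_def[symmetric] using \<gamma> fc by (intro finsum_rdistr) auto
    also have "\<dots> = (\<Oplus>k\<in>{..<M}. f (Suc k) \<otimes> \<gamma> [^] j)"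
      by (simp add: step)
    also have "\<dots> = (\<Oplus>k\<in>{..<M}. f (Suc k)) \<otimes> \<gamma> [^] j"
      using fc by (intro finsum_ldistr[symmetric]) auto
    also have "(\<Oplus>k\<in>{..<M}. f (Suc k)) = (\<Oplus>k\<in>{..<M}. f k)"
      using fc wrap by (rule finsum_rotate)
    finally show ?thesis by (simp add: y_def f_def)
  qed
  have inner: "(\<Oplus>j\<in>{..<M}. \<gamma> [^] k \<otimes> x0 \<otimes> \<gamma> [^] (j * (M * k - k)))
      = (if k = 0 then x0 \<otimes> ([M] \<cdot> \<one>) else \<zero>)" if "k < M" for k
  proof -
    have "(\<Oplus>j\<in>{..<M}. \<gamma> [^] k \<otimes> x0 \<otimes> \<gamma> [^] (j * (M * k - k)))
        = (\<Oplus>j\<in>{..<M}. \<gamma> [^] k \<otimes> x0 \<otimes> (\<gamma> [^] (M * k - k)) [^] j)"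
      using x0 \<gamma> by (intro finsum_cong') (auto simp: nat_pow_pow mult.commute)
    also have "\<dots> = \<gamma> [^] k \<otimes> x0 \<otimes> (\<Oplus>j\<in>{..<M}. (\<gamma> [^] (M * k - k)) [^] j)"
      using x0 \<gamma> by (intro finsum_rdistr[symmetric]) auto
    also have "\<dots> = (if k = 0 then x0 \<otimes> ([M] \<cdot> \<one>) else \<zero>)"
    proof (cases "k = 0")
      case False
      have "\<not> M dvd (M * k - k)"
      proof
        assume "M dvd M * k - k"
        then have "M dvd M * k - (M * k - k)" using dvd_triv_left by (rule dvd_diff_nat[rotated])
        moreover have "M * k - (M * k - k) = k" using M by simp
        ultimately show False using False that by (auto dest: dvd_imp_le)
      qed
      then show ?thesis
        using x0 False by (simp add: character_sum cong_0_iff)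
    next
      case True
      then show ?thesis
        using x0 character_sum[of 0] by simp
    qed
    finally show ?thesis .
  qed
  have "(\<Oplus>j\<in>{..<M}. y j) =
      (\<Oplus>k\<in>{..<M}. \<Oplus>j\<in>{..<M}. \<gamma> [^] k \<otimes> x0 \<otimes> \<gamma> [^] (j * (M * k - k)))"
    unfolding y_def using x0 by (intro finsum_swap) auto
  also have "\<dots> = (\<Oplus>k\<in>{..<M}. if k = 0 then x0 \<otimes> ([M] \<cdot> \<one>) else \<zero>)"
    using inner x0 by (intro finsum_cong') auto
  also have "\<dots> = x0 \<otimes> ([M] \<cdot> \<one>)"
    using x0 M by (subst finsum_single[of _ 0]) auto
  finally have sum_y: "(\<Oplus>j\<in>{..<M}. y j) = x0 \<otimes> ([M] \<cdot> \<one>)" .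
  have "\<exists>j. y j \<otimes> \<gamma> \<noteq> \<gamma> \<otimes> y j"
  proof (rule ccontr)
    assume "\<not> ?thesis"
    then have c: "y j \<otimes> \<gamma> = \<gamma> \<otimes> y j" for j by auto
    have "(\<Oplus>j\<in>{..<M}. y j) \<otimes> \<gamma> = (\<Oplus>j\<in>{..<M}. y j \<otimes> \<gamma>)"
      using y_closed \<gamma> by (intro finsum_ldistr) auto
    also have "\<dots> = \<gamma> \<otimes> (\<Oplus>j\<in>{..<M}. y j)"
      unfolding c using y_closed \<gamma> by (intro finsum_rdistr[symmetric]) auto
    finally have "x0 \<otimes> ([M] \<cdot> \<one>) \<otimes> \<gamma> = \<gamma> \<otimes> (x0 \<otimes> ([M] \<cdot> \<one>))"
      unfolding sum_y .
    moreover have cen: "[M] \<cdot> \<one> \<otimes> \<gamma> = \<gamma> \<otimes> [M] \<cdot> \<one>"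
      using \<gamma> by (simp add: add_pow_ldistr add_pow_rdistr)
    ultimately have "(x0 \<otimes> \<gamma>) \<otimes> [M] \<cdot> \<one> = (\<gamma> \<otimes> x0) \<otimes> [M] \<cdot> \<one>"
      using x0 \<gamma> by (metis add.nat_pow_closed m_assoc one_closed)
    then have "(x0 \<otimes> \<gamma> \<ominus> \<gamma> \<otimes> x0) \<otimes> [M] \<cdot> \<one> = \<zero>"
      using x0 \<gamma> by (simp add: minus_eq l_distr l_minus r_neg)
    then have "x0 \<otimes> \<gamma> \<ominus> \<gamma> \<otimes> x0 = \<zero>"
      using mult_eq_zero[of "x0 \<otimes> \<gamma> \<ominus> \<gamma> \<otimes> x0" "[M] \<cdot> \<one>"] M_nonzero x0 \<gamma> by simp
    then show False
      using x0 \<gamma> by simp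
  qed
  then show ?thesis
    using that y_closed y_eig by blast
qed

end

context self_centralizing_cyclic
begin

lemma twisted_pow:
  assumes x: "x \<in> carrier R" "\<gamma> \<otimes> x = x \<otimes> \<gamma> [^] (j::nat)"
  shows "\<gamma> [^] (n::nat) \<otimes> x [^] (i::nat) = x [^] i \<otimes> \<gamma> [^] (j ^ i * n)"
proof -
  have one: "\<gamma> [^] n \<otimes> x = x \<otimes> \<gamma> [^] (j * n)" for n :: nat
  proof (induction n)
    case (Suc n)
    have "\<gamma> [^] Suc n \<otimes> x = \<gamma> [^] n \<otimes> (\<gamma> \<otimes> x)"
      using x \<gamma> by (simp add: m_assoc)
    also have "\<dots> = (\<gamma> [^] n \<otimes> x) \<otimes> \<gamma> [^] j"
      using x(1) by (simp add: x(2) m_assoc)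
    also have "\<dots> = x \<otimes> \<gamma> [^] (j * Suc n)"
      using x(1) by (simp add: Suc.IH m_assoc \<gamma>_mult add.commute)
    finally show ?case .
  qed (use x in simp)
  show ?thesis
  proof (induction i)
    case (Suc i)
    have "\<gamma> [^] n \<otimes> x [^] Suc i = (\<gamma> [^] n \<otimes> x [^] i) \<otimes> x"
      using x(1) by (simp add: m_assoc)
    also have "\<dots> = x [^] i \<otimes> (\<gamma> [^] (j ^ i * n) \<otimes> x)"
      using x(1) by (simp add: Suc.IH m_assoc)
    also have "\<dots> = x [^] Suc i \<otimes> \<gamma> [^] (j ^ Suc i * n)"
      using x(1) by (simp add: one m_assoc mult.assoc)
    finally show ?case .
  qed (use x in simp)
qed

lemma twisted_mult_pow:
  assumes x: "x \<in> carrier R" "\<gamma> \<otimes> x = x \<otimes> \<gamma> [^] (j::nat)"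
  shows "(x \<otimes> \<gamma> [^] (t::nat)) [^] (k::nat) = x [^] k \<otimes> \<gamma> [^] (t * (\<Sum>l<k. j ^ l))"
proof (induction k)
  case (Suc k)
  let ?S = "\<lambda>k. \<Sum>l<k. j ^ l"
  have S: "?S (Suc k) = j * ?S k + 1"
    by (simp add: sum.lessThan_Suc_shift sum_distrib_left del: sum.lessThan_Suc)
  have "(x \<otimes> \<gamma> [^] t) [^] Suc k = x [^] k \<otimes> (\<gamma> [^] (t * ?S k) \<otimes> x) \<otimes> \<gamma> [^] t"
    using x(1) by (simp add: Suc.IH m_assoc)
  also have "\<gamma> [^] (t * ?S k) \<otimes> x = x \<otimes> \<gamma> [^] (j * (t * ?S k))"
    using twisted_pow[OF x, of "t * ?S k" 1] x(1) by simp
  also have "x [^] k \<otimes> (x \<otimes> \<gamma> [^] (j * (t * ?S k))) \<otimes> \<gamma> [^] t = x [^] Suc k \<otimes> \<gamma> [^] (j * (t * ?S k) + t)"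
    using x(1) by (simp add: m_assoc \<gamma>_mult)
  also have "j * (t * ?S k) + t = t * ?S (Suc k)"
    unfolding S by (simp add: algebra_simps)
  finally show ?case .
qed (use x in simp)

text \<open>Hilbert 90 for the automorphism \<open>\<gamma> \<mapsto> \<gamma>\<^sup>j\<close>, in terms of exponents of \<open>\<gamma>\<close> modulo \<open>M\<close>.\<close>

lemma hilbert_90:
  fixes j m i0 :: nat
  assumes m: "m > 0" and jm: "[j ^ m = 1] (mod M)"
    and ji: "\<And>i. 0 < i \<Longrightarrow> i < m \<Longrightarrow> \<not> [j ^ i = 1] (mod M)"
    and norm: "[i0 * (\<Sum>l<m. j ^ l) = 0] (mod M)"
    and x: "x \<in> Units R" "\<gamma> \<otimes> x = x \<otimes> \<gamma> [^] j"
  shows "\<exists>n::nat. [j * n + i0 = n] (mod M)"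
proof -
  define S where "S k = (\<Sum>l<k. j ^ l)" for k
  define g where "g k i = \<gamma> [^] (j ^ i * k + i0 * S i)" for k i :: nat
  define b where "b k = (\<Oplus>i\<in>{..<m}. g k i)" for k
  have xc: "x \<in> carrier R" using x by auto
  have gc [simp]: "g k i \<in> carrier R" for k i by (simp add: g_def)
  have bc: "b k \<in> carrier R" for k unfolding b_def by (intro finsum_closed) auto
  have S_Suc: "S (Suc k) = j * S k + 1" for k
    unfolding S_def by (simp add: sum.lessThan_Suc_shift sum_distrib_left del: sum.lessThan_Suc)
  have b_eq: "b k \<otimes> x \<otimes> \<gamma> [^] i0 = x \<otimes> b k" for k
  proof -
    have step: "g k i \<otimes> (x \<otimes> \<gamma> [^] i0) = x \<otimes> g k (Suc i)" for i
    proof -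
      have "g k i \<otimes> (x \<otimes> \<gamma> [^] i0) = x \<otimes> (\<gamma> [^] (j * (j ^ i * k + i0 * S i)) \<otimes> \<gamma> [^] i0)"
        using twisted_pow[OF xc x(2), of "j ^ i * k + i0 * S i" 1] xc
        by (simp add: g_def flip: m_assoc)
      also have "\<gamma> [^] (j * (j ^ i * k + i0 * S i)) \<otimes> \<gamma> [^] i0 = g k (Suc i)"
        unfolding \<gamma>_mult g_def S_Suc by (simp add: algebra_simps)
      finally show ?thesis .
    qed
    have wrap: "g k m = g k 0"
      unfolding g_def pow_eq_iff using cong_add[OF cong_mult[OF jm cong_refl, of k] norm]
      by (simp add: S_def)
    have rot: "(\<Oplus>i\<in>{..<m}. g k (Suc i)) = b k"
      unfolding b_def using gc wrap by (rule finsum_rotate)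
    have "b k \<otimes> (x \<otimes> \<gamma> [^] i0) = (\<Oplus>i\<in>{..<m}. g k i \<otimes> (x \<otimes> \<gamma> [^] i0))"
      unfolding b_def using xc by (intro finsum_ldistr) auto
    also have "\<dots> = x \<otimes> (\<Oplus>i\<in>{..<m}. g k (Suc i))"
      unfolding step using xc by (intro finsum_rdistr[symmetric]) auto
    finally show ?thesis
      unfolding rot using xc bc by (simp add: m_assoc)
  qed
  have "\<exists>k. b k \<noteq> \<zero>"
  proof (rule ccontr)
    assume "\<not> ?thesis"
    then have b0: "b k = \<zero>" for k by auto
    have "\<zero> = (\<Oplus>k\<in>{..<M}. b k \<otimes> \<gamma> [^] (M * k - k))"
      by (simp add: b0)
    also have "\<dots> = (\<Oplus>k\<in>{..<M}. \<Oplus>i\<in>{..<m}. g k i \<otimes> \<gamma> [^] (M * k - k))"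
      unfolding b_def by (intro finsum_cong' finsum_ldistr) auto
    also have "\<dots> = (\<Oplus>i\<in>{..<m}. \<Oplus>k\<in>{..<M}. g k i \<otimes> \<gamma> [^] (M * k - k))"
      by (intro finsum_swap) auto
    also have "\<dots> = (\<Oplus>i\<in>{..<m}. if i = 0 then [M] \<cdot> \<one> else \<zero>)"
    proof (intro finsum_cong' refl)
      fix i assume i: "i \<in> {..<m}"
      have "g k i \<otimes> \<gamma> [^] (M * k - k)
          = \<gamma> [^] (i0 * S i) \<otimes> (\<gamma> [^] (j ^ i * k) \<otimes> \<gamma> [^] (M * k - k))" for k
        unfolding g_def \<gamma>_mult by (simp add: algebra_simps)
      then have "(\<Oplus>k\<in>{..<M}. g k i \<otimes> \<gamma> [^] (M * k - k))
          = \<gamma> [^] (i0 * S i) \<otimes> (\<Oplus>k\<in>{..<M}. \<gamma> [^] (j ^ i * k) \<otimes> \<gamma> [^] (M * k - k))"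
        by (simp add: finsum_rdistr)
      then show "(\<Oplus>k\<in>{..<M}. g k i \<otimes> \<gamma> [^] (M * k - k)) = (if i = 0 then [M] \<cdot> \<one> else \<zero>)"
        unfolding character_sum_shift using ji[of i] i by (cases "i = 0") (auto simp: S_def)
    qed auto
    also have "\<dots> = [M] \<cdot> \<one>"
      using m by (subst finsum_single[of _ 0]) auto
    finally show False using M_nonzero by simp
  qed
  then obtain k where k: "b k \<noteq> \<zero>" ..
  have "b k \<otimes> \<gamma> = \<gamma> \<otimes> b k"
  proof -
    have "b k \<otimes> \<gamma> = (\<Oplus>i\<in>{..<m}. g k i \<otimes> \<gamma>)"
      unfolding b_def using \<gamma> by (intro finsum_ldistr) auto
    also have "\<dots> = (\<Oplus>i\<in>{..<m}. \<gamma> \<otimes> g k i)"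
      using \<gamma> by (intro finsum_cong') (auto simp: g_def pow_commute)
    also have "\<dots> = \<gamma> \<otimes> b k"
      unfolding b_def using \<gamma> by (intro finsum_rdistr[symmetric]) auto
    finally show ?thesis .
  qed
  then obtain n :: nat where n: "b k = \<gamma> [^] n"
    using centralizer[OF bc k] by auto
  have "x \<otimes> \<gamma> [^] (j * n + i0) = \<gamma> [^] n \<otimes> x \<otimes> \<gamma> [^] i0"
    using twisted_pow[OF xc x(2), of n 1] xc by (simp add: m_assoc \<gamma>_mult)
  also have "\<dots> = x \<otimes> \<gamma> [^] n"
    using b_eq[of k] unfolding n .
  finally have "\<gamma> [^] (j * n + i0) = \<gamma> [^] n"
    using x by simp
  then show ?thesis unfolding pow_eq_iff by blast
qed

end

lemma (in monoid) Units_finite_order: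
  assumes fin: "finite (carrier G)" and x: "x \<in> Units G"
  shows "\<exists>n::nat. n > 0 \<and> x [^] n = \<one>"
proof -
  interpret U: group "units_of G" by (rule units_group)
  have f: "finite (carrier (units_of G))"
    using fin Units_closed by (auto simp: units_of_carrier intro: finite_subset)
  have "x [^]\<^bsub>units_of G\<^esub> order (units_of G) = \<one>"
    using U.pow_order_eq_1[of x] x by (simp add: units_of_carrier units_of_one)
  then show ?thesis
    using U.order_gt_0_iff_finite f x units_of_pow[of x] by (intro exI[of _ "order (units_of G)"]) auto
qed

context self_centralizing_cyclic
begin

lemma no_eigenvector_root_of_unity:
  fixes j m :: nat
  assumes m: "m > 0" and ji: "\<And>i. 0 < i \<Longrightarrow> i < m \<Longrightarrow> \<not> [j ^ i = 1] (mod M)"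
    and v: "v \<in> carrier R" "\<gamma> \<otimes> v = v \<otimes> \<gamma> [^] j" "v [^] m = \<one>" "v \<noteq> \<one>"
  shows False
proof -
  have z: "(\<Oplus>i\<in>{..<m}. v [^] i) = \<zero>"
    using v by (intro pow_sum_eq_zero) auto
  have "\<zero> = (\<Oplus>k\<in>{..<M}. \<gamma> [^] k \<otimes> (\<Oplus>i\<in>{..<m}. v [^] i) \<otimes> \<gamma> [^] (M * k - k))"
    by (simp add: z)
  also have "\<dots> = (\<Oplus>k\<in>{..<M}. \<Oplus>i\<in>{..<m}. v [^] i \<otimes> (\<gamma> [^] (j ^ i * k) \<otimes> \<gamma> [^] (M * k - k)))"
  proof (intro finsum_cong' refl)
    fix k
    have "\<gamma> [^] k \<otimes> (\<Oplus>i\<in>{..<m}. v [^] i) \<otimes> \<gamma> [^] (M * k - k)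
        = (\<Oplus>i\<in>{..<m}. \<gamma> [^] k \<otimes> v [^] i \<otimes> \<gamma> [^] (M * k - k))"
      using v by (simp add: finsum_rdistr finsum_ldistr)
    also have "\<dots> = (\<Oplus>i\<in>{..<m}. v [^] i \<otimes> (\<gamma> [^] (j ^ i * k) \<otimes> \<gamma> [^] (M * k - k)))"
      using v by (intro finsum_cong') (auto simp: twisted_pow[OF v(1,2)] m_assoc)
    finally show "\<gamma> [^] k \<otimes> (\<Oplus>i\<in>{..<m}. v [^] i) \<otimes> \<gamma> [^] (M * k - k)
        = (\<Oplus>i\<in>{..<m}. v [^] i \<otimes> (\<gamma> [^] (j ^ i * k) \<otimes> \<gamma> [^] (M * k - k)))" .
  qed (use v in \<open>auto intro!: finsum_closed\<close>)
  also have "\<dots> = (\<Oplus>i\<in>{..<m}. \<Oplus>k\<in>{..<M}. v [^] i \<otimes> (\<gamma> [^] (j ^ i * k) \<otimes> \<gamma> [^] (M * k - k)))"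
    using v by (intro finsum_swap) auto
  also have "\<dots> = (\<Oplus>i\<in>{..<m}. if i = 0 then [M] \<cdot> \<one> else \<zero>)"
  proof (intro finsum_cong' refl)
    fix i assume i: "i \<in> {..<m}"
    have "(\<Oplus>k\<in>{..<M}. v [^] i \<otimes> (\<gamma> [^] (j ^ i * k) \<otimes> \<gamma> [^] (M * k - k)))
        = v [^] i \<otimes> (\<Oplus>k\<in>{..<M}. \<gamma> [^] (j ^ i * k) \<otimes> \<gamma> [^] (M * k - k))"
      using v by (intro finsum_rdistr[symmetric]) auto
    also have "\<dots> = (if i = 0 then [M] \<cdot> \<one> else \<zero>)"
      unfolding character_sum_shift using v ji[of i] i by (cases "i = 0") auto
    finally show "(\<Oplus>k\<in>{..<M}. v [^] i \<otimes> (\<gamma> [^] (j ^ i * k) \<otimes> \<gamma> [^] (M * k - k)))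
        = (if i = 0 then [M] \<cdot> \<one> else \<zero>)" .
  qed auto
  also have "\<dots> = [M] \<cdot> \<one>"
    using m by (subst finsum_single[of _ 0]) auto
  finally show False using M_nonzero by simp
qed

theorem \<gamma>_central:
  assumes x0: "x0 \<in> carrier R"
  shows "x0 \<otimes> \<gamma> = \<gamma> \<otimes> x0"
proof (rule ccontr)
  assume nc: "x0 \<otimes> \<gamma> \<noteq> \<gamma> \<otimes> x0"
  obtain x j where x: "x \<in> carrier R" "x \<otimes> \<gamma> \<noteq> \<gamma> \<otimes> x" "\<gamma> \<otimes> x = x \<otimes> \<gamma> [^] (j::nat)"
    using eigenvector_exists[OF x0 nc] by blast
  have xU: "x \<in> Units R"
    using x \<gamma> by (auto simp: Units_eq)
  have pU: "x [^] i \<in> Units R" for i :: nat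
    using xU by (rule Units_pow_closed)
  have eig: "\<gamma> \<otimes> x [^] i = x [^] i \<otimes> \<gamma> [^] (j ^ i)" for i
    using twisted_pow[OF x(1,3), of 1 i] \<gamma> by simp
  have comm_iff: "x [^] i \<otimes> \<gamma> = \<gamma> \<otimes> x [^] i \<longleftrightarrow> [j ^ i = 1] (mod M)" for i
  proof -
    have "x [^] i \<otimes> \<gamma> = \<gamma> \<otimes> x [^] i \<longleftrightarrow> x [^] i \<otimes> \<gamma> [^] (1::nat) = x [^] i \<otimes> \<gamma> [^] (j ^ i)"
      using \<gamma> by (simp add: eig)
    also have "\<dots> \<longleftrightarrow> \<gamma> [^] (1::nat) = \<gamma> [^] (j ^ i)"
      using pU by (rule Units_l_cancel) (use \<gamma> in auto)
    finally show ?thesis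
      unfolding pow_eq_iff by (simp add: cong_sym_eq)
  qed
  define P where "P i \<longleftrightarrow> i > 0 \<and> x [^] i \<otimes> \<gamma> = \<gamma> \<otimes> x [^] i" for i :: nat
  obtain n0 :: nat where "n0 > 0" "x [^] n0 = \<one>"
    using Units_finite_order[OF finite_carrier xU] by blast
  then have "P n0" using \<gamma> by (simp add: P_def)
  define m where "m = (LEAST i. P i)"
  have "P m" unfolding m_def by (rule LeastI) fact
  then have m: "m > 0" "x [^] m \<otimes> \<gamma> = \<gamma> \<otimes> x [^] m" by (auto simp: P_def)
  have jm: "[j ^ m = 1] (mod M)" using m comm_iff by blast
  have ji: "\<not> [j ^ i = 1] (mod M)" if "0 < i" "i < m" for i
  proof -
    have "\<not> P i" using that(2) unfolding m_def by (rule not_less_Least)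
    then show ?thesis using that(1) comm_iff[of i] by (simp add: P_def)
  qed
  have "x [^] m \<noteq> \<zero>"
    using pU[of m] Units_eq by auto
  then obtain s :: nat where s: "x [^] m = \<gamma> [^] s"
    using centralizer[of "x [^] m"] m(2) x(1) by auto
  have "x \<otimes> \<gamma> [^] (j * s) = x \<otimes> \<gamma> [^] s"
  proof -
    have "x \<otimes> \<gamma> [^] (j * s) = x [^] m \<otimes> x"
      unfolding s using twisted_pow[OF x(1,3), of s 1] x(1) by simp
    also have "\<dots> = x \<otimes> x [^] m"
      using x(1) by (rule pow_commute) (use x in auto)
    finally show ?thesis unfolding s .
  qed
  then have js: "[j * s = s] (mod M)"
    using xU by (simp add: pow_eq_iff)
  define S where "S = (\<Sum>l<m. j ^ l)"
  define g where "g = gcd S M"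
  have g: "g dvd S" "g dvd M" "g > 0"
    using M by (auto simp: g_def)
  have norm: "[M div g * (\<Sum>l<m. j ^ l) = 0] (mod M)"
  proof -
    have "M div g * S = M * (S div g)"
      using g by (metis div_mult_swap dvd_div_mult mult.commute)
    then show ?thesis by (simp add: S_def[symmetric] cong_0_iff)
  qed
  have "\<exists>n::nat. [j * n + M div g = n] (mod M)"
    by (rule hilbert_90[OF m(1) jm _ norm xU x(3)]) (rule ji)
  then obtain n :: nat where n: "[j * n + M div g = n] (mod M)" ..
  have "[M div g * s = 0] (mod M)"
  proof -
    have "[n * s + M div g * s = n * (j * s) + M div g * s] (mod M)"
      using cong_mult[OF cong_refl[of n] cong_sym[OF js]] by (simp add: mult.commute cong_add_rcancel_nat)
    also have "n * (j * s) + M div g * s = (j * n + M div g) * s"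
      by (simp add: algebra_simps)
    also have "[\<dots> = n * s + 0] (mod M)"
      using cong_mult[OF n cong_refl, of s] by simp
    finally show ?thesis
      by (simp only: cong_add_lcancel_nat)
  qed
  then have "g dvd s"
  proof -
    obtain c where c: "M = g * c" using g by (auto elim: dvdE)
    assume "[M div g * s = 0] (mod M)"
    then have "g * c dvd c * s" using g(3) by (simp add: cong_0_iff c)
    moreover have "c > 0" using M c by (auto intro: Nat.gr0I)
    ultimately show ?thesis by (simp add: mult.commute[of g])
  qed
  then obtain s' where s': "s = g * s'" by (auto elim: dvdE)
  obtain a where a: "[S * a = g] (mod M)"
    using cong_solve_nat[of S M] unfolding g_def by blast
  define t where "t = a * s' * (M - 1)"
  have "[s + t * S = s + g * (s' * (M - 1))] (mod M)"
    using cong_add[OF cong_refl[of s] cong_mult[OF a cong_refl[of "s' * (M - 1)"]]]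
    by (simp add: t_def algebra_simps)
  also have "s + g * (s' * (M - 1)) = M * s"
    using M by (cases M) (auto simp: s')
  also have "[M * s = 0] (mod M)" by (simp add: cong_0_iff)
  finally have st: "[s + t * S = 0] (mod M)" .
  define v where "v = x \<otimes> \<gamma> [^] t"
  have vm: "v [^] m = \<one>"
    using st pow_eq_iff[of "s + t * S" 0] unfolding v_def twisted_mult_pow[OF x(1,3)]
    by (simp add: s \<gamma>_mult S_def)
  have v: "v \<in> carrier R" "\<gamma> \<otimes> v = v \<otimes> \<gamma> [^] j"
  proof -
    show "v \<in> carrier R" using x by (simp add: v_def)
    have "\<gamma> \<otimes> v = (\<gamma> \<otimes> x) \<otimes> \<gamma> [^] t"
      unfolding v_def using x(1) \<gamma> by (intro m_assoc[symmetric]) auto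
    also have "\<dots> = x \<otimes> (\<gamma> [^] j \<otimes> \<gamma> [^] t)"
      unfolding x(3) using x(1) by (intro m_assoc) auto
    also have "\<gamma> [^] j \<otimes> \<gamma> [^] t = \<gamma> [^] t \<otimes> \<gamma> [^] j"
      unfolding \<gamma>_mult by (simp only: add.commute)
    finally show "\<gamma> \<otimes> v = v \<otimes> \<gamma> [^] j"
      unfolding v_def using x(1) by (simp add: m_assoc)
  qed
  have "v \<noteq> \<one>"
  proof
    assume v1: "v = \<one>"
    have "\<gamma> [^] (1::nat) = \<gamma> [^] j"
      using v(2) v1 \<gamma> by simp
    then have "\<gamma> \<otimes> x = x \<otimes> \<gamma>"
      using x(3) \<gamma> by simp
    then show False using x(2) by simp
  qed
  show False
    by (rule no_eigenvector_root_of_unity[OF m(1) _ v vm \<open>v \<noteq> \<one>\<close>]) (rule ji)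
qed

end

context finite_division_ring
begin

theorem wedderburn:
  assumes a: "a \<in> carrier R" and b: "b \<in> carrier R"
  shows "a \<otimes> b = b \<otimes> a"
proof -
  define \<F> where "\<F> = {F. F \<subseteq> carrier R \<and> (\<forall>x\<in>F. \<forall>y\<in>F. x \<otimes> y = y \<otimes> x)}"
  have "finite \<F>" "{} \<in> \<F>"
    using finite_carrier by (auto simp: \<F>_def)
  then obtain F where F: "F \<in> \<F>" "\<And>B. B \<in> \<F> \<Longrightarrow> F \<subseteq> B \<Longrightarrow> F = B"
    using finite_has_maximal[of \<F>] by blast
  have FC: "F \<subseteq> carrier R" and Fcomm: "\<And>x y. x \<in> F \<Longrightarrow> y \<in> F \<Longrightarrow> x \<otimes> y = y \<otimes> x"
    using F(1) by (auto simp: \<F>_def)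
  have cent: "c \<in> F" if "c \<in> carrier R" "\<And>x. x \<in> F \<Longrightarrow> c \<otimes> x = x \<otimes> c" for c
  proof -
    have "insert c F \<in> \<F>"
      using that FC Fcomm by (auto simp: \<F>_def)
    then show ?thesis using F(2)[of "insert c F"] by auto
  qed
  have sub: "subring F R"
  proof (rule subringI)
    show "\<one> \<in> F" by (rule cent) (use FC in auto)
    show "\<ominus> h \<in> F" if "h \<in> F" for h
      by (rule cent) (use that FC Fcomm in \<open>auto simp: l_minus r_minus subset_iff\<close>)
    show "h1 \<otimes> h2 \<in> F" if "h1 \<in> F" "h2 \<in> F" for h1 h2
    proof (rule cent)
      fix x assume x: "x \<in> F"
      have c: "h1 \<in> carrier R" "h2 \<in> carrier R" "x \<in> carrier R" using that x FC by auto
      have "h1 \<otimes> h2 \<otimes> x = h1 \<otimes> x \<otimes> h2"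
        using c Fcomm[OF that(2) x] by (simp add: m_assoc)
      also have "\<dots> = x \<otimes> (h1 \<otimes> h2)"
        using c Fcomm[OF that(1) x] by (simp add: m_assoc)
      finally show "h1 \<otimes> h2 \<otimes> x = x \<otimes> (h1 \<otimes> h2)" .
    qed (use that FC in auto)
    show "h1 \<oplus> h2 \<in> F" if "h1 \<in> F" "h2 \<in> F" for h1 h2
      by (rule cent) (use that FC Fcomm in \<open>auto simp: l_distr r_distr subset_iff\<close>)
  qed (rule FC)
  define K where "K = R\<lparr>carrier := F\<rparr>"
  have Ks [simp]: "carrier K = F" "monoid.mult K = monoid.mult R" "monoid.one K = \<one>" "ring.zero K = \<zero>" "ring.add K = ring.add R"
    by (auto simp: K_def)
  interpret K: ring K unfolding K_def using sub by (rule subring_is_ring)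
  interpret K: cring K
    by unfold_locales (use Fcomm in auto)
  have "Units K = carrier K - {\<zero>\<^bsub>K\<^esub>}"
  proof (intro equalityI subsetI)
    fix x assume "x \<in> Units K"
    then have "x \<in> Units R" using FC by (auto simp: Units_def)
    then show "x \<in> carrier K - {\<zero>\<^bsub>K\<^esub>}" using \<open>x \<in> Units K\<close> K.Units_closed by (auto simp: Units_eq)
  next
    fix x assume "x \<in> carrier K - {\<zero>\<^bsub>K\<^esub>}"
    then have x: "x \<in> F" "x \<in> Units R" using FC by (auto simp: Units_eq)
    have "inv x \<in> F"
    proof (rule cent)
      fix y assume y: "y \<in> F"
      have yc: "y \<in> carrier R" "x \<in> carrier R" "inv x \<in> carrier R" using y x FC by auto
      have "x \<otimes> (inv x \<otimes> y) = x \<otimes> (y \<otimes> inv x)"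
      proof -
        have "x \<otimes> (y \<otimes> inv x) = (x \<otimes> y) \<otimes> inv x"
          using x yc by (simp add: m_assoc)
        also have "\<dots> = y \<otimes> (x \<otimes> inv x)"
          unfolding Fcomm[OF x(1) y] using x yc by (intro m_assoc) auto
        also have "\<dots> = (x \<otimes> inv x) \<otimes> y" using x yc by simp
        also have "\<dots> = x \<otimes> (inv x \<otimes> y)" using x yc by (intro m_assoc) auto
        finally show ?thesis ..
      qed
      then show "inv x \<otimes> y = y \<otimes> inv x" using x yc by simp
    qed (use x in auto)
    then show "x \<in> Units K"
      using x(1) Units_l_inv[OF x(2)] Units_r_inv[OF x(2)] unfolding Units_def by auto
  qed
  then interpret K: field K by (rule K.cring_fieldI)
  have finF: "finite F" using FC finite_carrier by (rule finite_subset)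
  have Kpow: "x [^]\<^bsub>K\<^esub> n = x [^] n" for x and n :: nat
    unfolding K_def by (simp add: nat_pow_def)
  interpret Km: group "Multiplicative_Group.mult_of K" by (rule K.field_mult_group)
  obtain \<gamma> where g: "\<gamma> \<in> carrier (Multiplicative_Group.mult_of K)"
    "carrier (Multiplicative_Group.mult_of K) = {\<gamma> [^]\<^bsub>K\<^esub> i | i::nat. i \<in> UNIV}"
    using K.finite_field_mult_group_has_gen finF by auto
  define M where "M = Km.ord \<gamma>"
  have gF: "\<gamma> \<in> F" "\<gamma> \<in> carrier R" "\<gamma> \<in> Units R" using g(1) FC by (auto simp: Units_eq)
  have Fpow: "x \<in> F \<longleftrightarrow> x = \<zero> \<or> (\<exists>i::nat. x = \<gamma> [^] i)" for x
    using g(2) K.zero_closed by (auto simp: Kpow)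
  have fin': "finite (carrier (Multiplicative_Group.mult_of K))" using finF by simp
  have Mcard: "M = card (F - {\<zero>})"
  proof -
    have "M = card (generate (Multiplicative_Group.mult_of K) {\<gamma>})"
      unfolding M_def by (rule Km.generate_pow_card[OF g(1)])
    also have "generate (Multiplicative_Group.mult_of K) {\<gamma>} = F - {\<zero>}"
      using Km.generate_pow_on_finite_carrier[OF fin' g(1)] g(2) by (auto simp: Multiplicative_Group.nat_pow_mult_of)
    finally show ?thesis .
  qed
  have M0: "M > 0" unfolding M_def using Km.ord_ge_1[OF fin' g(1)] by simp
  have Mone: "[M] \<cdot> \<one> \<noteq> \<zero>"
  proof
    assume z: "[M] \<cdot> \<one> = \<zero>"
    have "\<one> [^]\<^bsub>add_monoid K\<^esub> order (add_monoid K) = \<zero>"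
      using group.pow_order_eq_1[OF K.a_group, of \<one>] K.one_closed by simp
    moreover have "order (add_monoid K) = Suc M"
      using Mcard finF K.zero_closed card_Suc_Diff1[of F \<zero>] by (simp add: order_def)
    moreover have "\<one> [^]\<^bsub>add_monoid K\<^esub> n = [n] \<cdot> \<one>" for n :: nat
      by (simp add: add_pow_def nat_pow_def)
    ultimately have "[Suc M] \<cdot> \<one> = \<zero>" by simp
    then show False using z one_nonzero by simp
  qed
  have pow_eq: "\<gamma> [^] i = \<gamma> [^] k \<longleftrightarrow> [i = k] (mod M)" for i k :: nat
  proof -
    have id: "\<gamma> [^] n = \<one> \<longleftrightarrow> M dvd n" for n :: nat
      using Km.pow_eq_id[OF g(1), of n] by (simp add: Multiplicative_Group.nat_pow_mult_of Kpow M_def)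
    have le: "\<gamma> [^] i = \<gamma> [^] k \<longleftrightarrow> [i = k] (mod M)" if "i \<le> k" for i k :: nat
    proof -
      have "\<gamma> [^] k = \<gamma> [^] i \<otimes> \<gamma> [^] (k - i)"
        using that gF by (simp add: nat_pow_mult)
      moreover have "\<gamma> [^] i \<in> Units R" using gF by (simp add: Units_pow_closed)
      ultimately have "\<gamma> [^] i = \<gamma> [^] k \<longleftrightarrow> \<one> = \<gamma> [^] (k - i)"
        using gF Units_l_cancel[of "\<gamma> [^] i" \<one> "\<gamma> [^] (k - i)"] by simp
      also have "\<dots> \<longleftrightarrow> [k = i] (mod M)"
        using id[of "k - i"] that by (auto simp: cong_altdef_nat)
      finally show ?thesis by (simp add: cong_sym_eq)
    qed
    show ?thesis
      using le[of i k] le[of k i] by (metis cong_sym_eq nat_le_linear)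
  qed
  have centg: "x \<in> F" if x: "x \<in> carrier R" "x \<otimes> \<gamma> = \<gamma> \<otimes> x" for x
  proof (rule cent[OF x(1)])
    fix y assume "y \<in> F"
    then show "x \<otimes> y = y \<otimes> x"
      using Fpow[of y] pow_commute[OF gF(2) x(1)] x by auto
  qed
  interpret self_centralizing_cyclic R \<gamma> M
  proof unfold_locales
    show "\<exists>i::nat. x = \<gamma> [^] i" if "x \<in> carrier R" "x \<noteq> \<zero>" "x \<otimes> \<gamma> = \<gamma> \<otimes> x" for x
      using centg[of x] Fpow[of x] that by auto
  qed (use gF M0 Mone pow_eq in auto)
  show ?thesis
    using centg[OF a \<gamma>_central[OF a]] centg[OF b \<gamma>_central[OF b]] Fcomm by blast
qed

end

section \<open>Finite rings with central nilpotent elements\<close>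

lemma (in monoid) finite_idempotent_power:
  assumes fin: "finite (carrier G)" and x: "x \<in> carrier G"
  shows "\<exists>n::nat. n > 0 \<and> x [^] n \<otimes> x [^] n = x [^] n"
proof -
  have "\<not> inj (\<lambda>n::nat. x [^] n)"
  proof
    assume "inj (\<lambda>n::nat. x [^] n)"
    then have "infinite (range (\<lambda>n::nat. x [^] n))" by (simp add: finite_image_iff)
    moreover have "range (\<lambda>n::nat. x [^] n) \<subseteq> carrier G" using x by auto
    ultimately show False using fin finite_subset by blast
  qed
  then obtain a b :: nat where "a \<noteq> b" "x [^] a = x [^] b" by (auto simp: inj_def)
  then obtain a b :: nat where ab: "a < b" "x [^] a = x [^] b"
    by (metis linorder_neqE_nat)
  define d where "d = b - a"
  have d: "d > 0" using ab by (simp add: d_def)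
  have step: "x [^] (m + d) = x [^] m" if "m \<ge> a" for m
  proof -
    have "x [^] (m + d) = x [^] b \<otimes> x [^] (m - a)"
      using x that ab by (simp add: nat_pow_mult d_def add.commute)
    also have "\<dots> = x [^] m"
      using x that by (simp add: ab(2)[symmetric] nat_pow_mult)
    finally show ?thesis .
  qed
  have "x [^] (m + d * q) = x [^] m" if "m \<ge> a" for m q
  proof (induction q)
    case (Suc q)
    have "x [^] (m + d * Suc q) = x [^] ((m + d * q) + d)" by (simp add: algebra_simps)
    also have "\<dots> = x [^] m" using step[of "m + d * q"] that Suc by simp
    finally show ?case .
  qed simp
  moreover have "a \<le> d * Suc a" using d by (cases d) auto
  ultimately have "x [^] (d * Suc a + d * Suc a) = x [^] (d * Suc a)"
    by blast
  then show ?thesis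
    using d x by (intro exI[of _ "d * Suc a"]) (simp add: nat_pow_mult del: mult_Suc_right)
qed

lemma (in ring) corner_ring:
  assumes e: "e \<in> carrier R" "e \<otimes> e = e" and central: "\<And>x. x \<in> carrier R \<Longrightarrow> e \<otimes> x = x \<otimes> e"
  shows "ring (R\<lparr>carrier := {x \<in> carrier R. e \<otimes> x = x}, one := e\<rparr>)"
proof (rule ringI)
  show "abelian_group (R\<lparr>carrier := {x \<in> carrier R. e \<otimes> x = x}, one := e\<rparr>)"
  proof (rule abelian_groupI)
    fix x assume "x \<in> carrier (R\<lparr>carrier := {x \<in> carrier R. e \<otimes> x = x}, one := e\<rparr>)"
    then show "\<exists>y\<in>carrier (R\<lparr>carrier := {x \<in> carrier R. e \<otimes> x = x}, one := e\<rparr>).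
        y \<oplus>\<^bsub>R\<lparr>carrier := {x \<in> carrier R. e \<otimes> x = x}, one := e\<rparr>\<^esub> x
        = \<zero>\<^bsub>R\<lparr>carrier := {x \<in> carrier R. e \<otimes> x = x}, one := e\<rparr>\<^esub>"
      using e by (intro bexI[of _ "\<ominus> x"]) (auto simp: r_minus l_neg)
  qed (use e in \<open>auto simp: r_distr a_ac\<close>)
  show "monoid (R\<lparr>carrier := {x \<in> carrier R. e \<otimes> x = x}, one := e\<rparr>)"
  proof (rule monoidI)
    fix x y assume "x \<in> carrier (R\<lparr>carrier := {x \<in> carrier R. e \<otimes> x = x}, one := e\<rparr>)"
      and "y \<in> carrier (R\<lparr>carrier := {x \<in> carrier R. e \<otimes> x = x}, one := e\<rparr>)"
    then show "x \<otimes>\<^bsub>R\<lparr>carrier := {x \<in> carrier R. e \<otimes> x = x}, one := e\<rparr>\<^esub> y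
        \<in> carrier (R\<lparr>carrier := {x \<in> carrier R. e \<otimes> x = x}, one := e\<rparr>)"
      using e(1) m_assoc[of e x y] by simp
  next
    fix x assume "x \<in> carrier (R\<lparr>carrier := {x \<in> carrier R. e \<otimes> x = x}, one := e\<rparr>)"
    then show "x \<otimes>\<^bsub>R\<lparr>carrier := {x \<in> carrier R. e \<otimes> x = x}, one := e\<rparr>\<^esub>
        \<one>\<^bsub>R\<lparr>carrier := {x \<in> carrier R. e \<otimes> x = x}, one := e\<rparr>\<^esub> = x"
      using central[of x] by simp
  qed (use e in \<open>auto simp: m_assoc\<close>)
qed (auto simp: l_distr r_distr)

lemma (in ring) reduced_pow:
  assumes red: "\<And>x. x \<in> carrier R \<Longrightarrow> x \<otimes> x = \<zero> \<Longrightarrow> x = \<zero>"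
    and x: "x \<in> carrier R" "x [^] (n::nat) = \<zero>"
  shows "x = \<zero>"
  using x(2)
proof (induction n rule: less_induct)
  case (less n)
  consider "n = 0" | "n = 1" | "n \<ge> 2" by linarith
  then show ?case
  proof cases
    case 1
    then show ?thesis using less.prems x by (metis l_null l_one nat_pow_0)
  next
    case 2
    then show ?thesis using less.prems x by simp
  next
    case 3
    define h where "h = (n + 1) div 2"
    have h: "h < n" "h + h = n + (h + h - n)" using 3 by (auto simp: h_def)
    have "x [^] h \<otimes> x [^] h = x [^] n \<otimes> x [^] (h + h - n)"
      using x h by (simp add: nat_pow_mult)
    then have "x [^] h = \<zero>" using red[of "x [^] h"] less.prems x by simp
    then show ?thesis using less.IH h by blast
  qed
qed

lemma (in ring) reduced_idempotent_central:
  assumes red: "\<And>x. x \<in> carrier R \<Longrightarrow> x \<otimes> x = \<zero> \<Longrightarrow> x = \<zero>"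
    and e: "e \<in> carrier R" "e \<otimes> e = e" and r: "r \<in> carrier R"
  shows "e \<otimes> r = r \<otimes> e"
proof -
  let ?f = "\<one> \<ominus> e"
  have f: "?f \<in> carrier R" "?f \<otimes> e = \<zero>" "e \<otimes> ?f = \<zero>"
    using e by (auto simp: minus_eq l_distr r_distr l_minus r_minus r_neg)
  have "(e \<otimes> r \<otimes> ?f) \<otimes> (e \<otimes> r \<otimes> ?f) = e \<otimes> r \<otimes> (?f \<otimes> e) \<otimes> (r \<otimes> ?f)"
    using e(1) r f(1) by (simp add: m_assoc)
  then have "(e \<otimes> r \<otimes> ?f) \<otimes> (e \<otimes> r \<otimes> ?f) = \<zero>"
    using e(1) r f by simp
  then have 1: "e \<otimes> r \<otimes> ?f = \<zero>" by (rule red[rotated]) (use e r f(1) in simp)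
  have "(?f \<otimes> r \<otimes> e) \<otimes> (?f \<otimes> r \<otimes> e) = ?f \<otimes> r \<otimes> (e \<otimes> ?f) \<otimes> (r \<otimes> e)"
    using e(1) r f(1) by (simp add: m_assoc)
  then have "(?f \<otimes> r \<otimes> e) \<otimes> (?f \<otimes> r \<otimes> e) = \<zero>"
    using e(1) r f by simp
  then have 2: "?f \<otimes> r \<otimes> e = \<zero>" by (rule red[rotated]) (use e r f(1) in simp)
  have "e \<otimes> r \<ominus> e \<otimes> r \<otimes> e = \<zero>"
    using 1 e r by (simp add: minus_eq r_distr r_minus)
  moreover have "r \<otimes> e \<ominus> e \<otimes> r \<otimes> e = \<zero>"
    using 2 e r by (simp add: minus_eq l_distr l_minus)
  ultimately show ?thesis
    using e r by simp
qed

theorem reduced_finite_ring_commutative: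
  fixes R (structure)
  assumes "ring R" "finite (carrier R)"
    and "\<And>x. x \<in> carrier R \<Longrightarrow> x \<otimes> x = \<zero> \<Longrightarrow> x = \<zero>"
    and "x \<in> carrier R" "y \<in> carrier R"
  shows "x \<otimes> y = y \<otimes> x"
  using assms
proof (induction "card (carrier R)" arbitrary: R x y rule: less_induct)
  case (less R)
  interpret ring R by fact
  note fin = \<open>finite (carrier R)\<close> and red = less.prems(3) and xy = less.prems(4,5)
  show ?case
  proof (cases "\<exists>e\<in>carrier R. e \<otimes>\<^bsub>R\<^esub> e = e \<and> e \<noteq> \<zero>\<^bsub>R\<^esub> \<and> e \<noteq> \<one>\<^bsub>R\<^esub>")
    case True
    then obtain e where e: "e \<in> carrier R" "e \<otimes>\<^bsub>R\<^esub> e = e" "e \<noteq> \<zero>\<^bsub>R\<^esub>" "e \<noteq> \<one>\<^bsub>R\<^esub>" by blast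
    have corner: "f \<otimes>\<^bsub>R\<^esub> (x \<otimes>\<^bsub>R\<^esub> y) = f \<otimes>\<^bsub>R\<^esub> (y \<otimes>\<^bsub>R\<^esub> x)"
      if f: "f \<in> carrier R" "f \<otimes>\<^bsub>R\<^esub> f = f" "f \<noteq> \<one>\<^bsub>R\<^esub>" for f
    proof -
      have central: "f \<otimes>\<^bsub>R\<^esub> r = r \<otimes>\<^bsub>R\<^esub> f" if "r \<in> carrier R" for r
        using reduced_idempotent_central[OF red f(1,2) that] by blast
      let ?C = "R\<lparr>carrier := {x \<in> carrier R. f \<otimes>\<^bsub>R\<^esub> x = x}, one := f\<rparr>"
      have "\<one>\<^bsub>R\<^esub> \<notin> carrier ?C" using f(1,3) by simp
      then have "carrier ?C \<subset> carrier R" by auto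
      then have "card (carrier ?C) < card (carrier R)" using fin by (rule psubset_card_mono[rotated])
      moreover have "ring ?C" by (rule corner_ring[OF f(1,2) central])
      moreover have "finite (carrier ?C)" using fin by simp
      moreover have "z = \<zero>\<^bsub>?C\<^esub>" if "z \<in> carrier ?C" "z \<otimes>\<^bsub>?C\<^esub> z = \<zero>\<^bsub>?C\<^esub>" for z
        using that red[of z] by simp
      moreover have "f \<otimes>\<^bsub>R\<^esub> z \<in> carrier ?C" if "z \<in> carrier R" for z
        using that f by (simp flip: m_assoc)
      ultimately have "(f \<otimes>\<^bsub>R\<^esub> x) \<otimes>\<^bsub>?C\<^esub> (f \<otimes>\<^bsub>R\<^esub> y) = (f \<otimes>\<^bsub>R\<^esub> y) \<otimes>\<^bsub>?C\<^esub> (f \<otimes>\<^bsub>R\<^esub> x)"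
        using less.hyps[of ?C "f \<otimes>\<^bsub>R\<^esub> x" "f \<otimes>\<^bsub>R\<^esub> y"] xy by blast
      moreover have "(f \<otimes>\<^bsub>R\<^esub> a) \<otimes>\<^bsub>R\<^esub> (f \<otimes>\<^bsub>R\<^esub> b) = f \<otimes>\<^bsub>R\<^esub> (a \<otimes>\<^bsub>R\<^esub> b)"
        if "a \<in> carrier R" "b \<in> carrier R" for a b
      proof -
        have "(f \<otimes>\<^bsub>R\<^esub> a) \<otimes>\<^bsub>R\<^esub> (f \<otimes>\<^bsub>R\<^esub> b) = f \<otimes>\<^bsub>R\<^esub> (a \<otimes>\<^bsub>R\<^esub> f) \<otimes>\<^bsub>R\<^esub> b"
          using that f by (simp add: m_assoc)
        also have "\<dots> = (f \<otimes>\<^bsub>R\<^esub> f) \<otimes>\<^bsub>R\<^esub> a \<otimes>\<^bsub>R\<^esub> b"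
          unfolding central[OF that(1), symmetric] using that f(1) by (simp add: m_assoc)
        finally show ?thesis using that f by (simp add: m_assoc)
      qed
      ultimately show ?thesis using xy by simp
    qed
    let ?f = "\<one>\<^bsub>R\<^esub> \<ominus>\<^bsub>R\<^esub> e"
    have f: "?f \<in> carrier R" "?f \<otimes>\<^bsub>R\<^esub> ?f = ?f" "?f \<noteq> \<one>\<^bsub>R\<^esub>"
    proof -
      show "?f \<in> carrier R" using e by simp
      show "?f \<otimes>\<^bsub>R\<^esub> ?f = ?f"
        using e by (simp add: minus_eq l_distr r_distr l_minus r_minus a_assoc r_neg)
      show "?f \<noteq> \<one>\<^bsub>R\<^esub>"
      proof
        assume "?f = \<one>\<^bsub>R\<^esub>"
        then have "?f \<oplus>\<^bsub>R\<^esub> e = \<one>\<^bsub>R\<^esub> \<oplus>\<^bsub>R\<^esub> e" by simp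
        then have "\<one>\<^bsub>R\<^esub> \<oplus>\<^bsub>R\<^esub> e = \<one>\<^bsub>R\<^esub>" using e by (simp add: minus_eq a_assoc l_neg)
        then show False using e by simp
      qed
    qed
    have split: "z = e \<otimes>\<^bsub>R\<^esub> z \<oplus>\<^bsub>R\<^esub> ?f \<otimes>\<^bsub>R\<^esub> z" if "z \<in> carrier R" for z
    proof -
      have "e \<otimes>\<^bsub>R\<^esub> z \<oplus>\<^bsub>R\<^esub> ?f \<otimes>\<^bsub>R\<^esub> z = (e \<oplus>\<^bsub>R\<^esub> ?f) \<otimes>\<^bsub>R\<^esub> z"
        using that e f(1) by (simp add: l_distr)
      also have "e \<oplus>\<^bsub>R\<^esub> ?f = \<one>\<^bsub>R\<^esub>"
        using e a_lcomm[of e "\<one>\<^bsub>R\<^esub>" "\<ominus>\<^bsub>R\<^esub> e"] by (simp add: minus_eq r_neg)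
      finally show ?thesis using that by simp
    qed
    show ?thesis
      using split[of "x \<otimes>\<^bsub>R\<^esub> y"] split[of "y \<otimes>\<^bsub>R\<^esub> x"] corner[OF e(1,2,4)] corner[OF f] xy by simp
  next
    case False
    show ?thesis
    proof (cases "\<one>\<^bsub>R\<^esub> = \<zero>\<^bsub>R\<^esub>")
      case True
      then show ?thesis using xy by (metis l_null l_one)
    next
      case nz: False
      have "Units R = carrier R - {\<zero>\<^bsub>R\<^esub>}"
      proof (intro equalityI subsetI)
        fix z assume z: "z \<in> Units R"
        then have "z \<noteq> \<zero>\<^bsub>R\<^esub>" using nz Units_r_inv[OF z] by (metis Units_inv_closed l_null)
        then show "z \<in> carrier R - {\<zero>\<^bsub>R\<^esub>}" using z by auto
      next
        fix z assume z: "z \<in> carrier R - {\<zero>\<^bsub>R\<^esub>}"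
        then obtain n :: nat where n: "n > 0" "z [^]\<^bsub>R\<^esub> n \<otimes>\<^bsub>R\<^esub> z [^]\<^bsub>R\<^esub> n = z [^]\<^bsub>R\<^esub> n"
          using finite_idempotent_power[OF fin, of z] by auto
        have "z [^]\<^bsub>R\<^esub> n \<noteq> \<zero>\<^bsub>R\<^esub>" using reduced_pow[OF red, of z n] z by auto
        then have one: "z [^]\<^bsub>R\<^esub> n = \<one>\<^bsub>R\<^esub>" using False n z by auto
        obtain k where k: "n = Suc k" using n(1) by (cases n) auto
        have "z [^]\<^bsub>R\<^esub> k \<otimes>\<^bsub>R\<^esub> z = \<one>\<^bsub>R\<^esub>" "z \<otimes>\<^bsub>R\<^esub> z [^]\<^bsub>R\<^esub> k = \<one>\<^bsub>R\<^esub>"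
          using one z nat_pow_Suc2[of z k] by (auto simp: k)
        then show "z \<in> Units R" using z unfolding Units_def by auto
      qed
      then interpret finite_division_ring R by unfold_locales (use fin in auto)
      show ?thesis using wedderburn xy by blast
    qed
  qed
qed

context ring
begin

lemma add_pow_factor:
  assumes xy: "x \<in> carrier R" "y \<in> carrier R" "x \<otimes> y = y \<otimes> x"
  shows "\<exists>r\<in>carrier R. x \<otimes> r = r \<otimes> x \<and> (x \<oplus> y) [^] (k::nat) = y [^] k \<oplus> x \<otimes> r"
proof (induction k)
  case 0
  then show ?case using xy(1,2) by (intro bexI[of _ \<zero>]) auto
next
  case (Suc k)
  then obtain r where r: "r \<in> carrier R" "x \<otimes> r = r \<otimes> x" "(x \<oplus> y) [^] k = y [^] k \<oplus> x \<otimes> r" by blast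
  have c: "x \<otimes> y [^] k = y [^] k \<otimes> x" using pow_commute[of y x k] xy by simp
  have "(x \<oplus> y) [^] Suc k = (y [^] k \<oplus> x \<otimes> r) \<otimes> (x \<oplus> y)" by (simp add: r)
  also have "\<dots> = y [^] Suc k \<oplus> x \<otimes> (y [^] k \<oplus> r \<otimes> (x \<oplus> y))"
    using xy(1,2) r(1) by (simp add: l_distr r_distr c m_assoc a_ac)
  finally have e: "(x \<oplus> y) [^] Suc k = y [^] Suc k \<oplus> x \<otimes> (y [^] k \<oplus> r \<otimes> (x \<oplus> y))" .
  have s: "(x \<oplus> y) \<otimes> x = x \<otimes> (x \<oplus> y)"
    using xy by (simp add: l_distr r_distr)
  have cl: "x \<oplus> y \<in> carrier R" "y [^] k \<in> carrier R" "r \<otimes> (x \<oplus> y) \<in> carrier R"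
    using xy(1,2) r(1) by simp_all
  have "x \<otimes> (r \<otimes> (x \<oplus> y)) = (x \<otimes> r) \<otimes> (x \<oplus> y)"
    by (rule m_assoc[symmetric]) fact+
  also have "\<dots> = r \<otimes> (x \<otimes> (x \<oplus> y))"
    unfolding r(2) by (rule m_assoc) fact+
  also have "\<dots> = (r \<otimes> (x \<oplus> y)) \<otimes> x"
    unfolding s[symmetric] by (rule m_assoc[symmetric]) fact+
  finally have "x \<otimes> (y [^] k \<oplus> r \<otimes> (x \<oplus> y)) = (y [^] k \<oplus> r \<otimes> (x \<oplus> y)) \<otimes> x"
    unfolding r_distr[OF cl(2,3) xy(1)] l_distr[OF cl(2,3) xy(1)] c by simp
  then show ?case
    using e by (intro bexI[of _ "y [^] k \<oplus> r \<otimes> (x \<oplus> y)"] conjI) (use cl in simp_all)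
qed

lemma commuting_nilpotents_add:
  assumes x: "x \<in> carrier R" "x [^] (m::nat) = \<zero>" and y: "y \<in> carrier R" "y [^] (n::nat) = \<zero>"
    and xy: "x \<otimes> y = y \<otimes> x"
  shows "\<exists>k::nat. (x \<oplus> y) [^] k = \<zero>"
proof -
  obtain r where r: "r \<in> carrier R" "x \<otimes> r = r \<otimes> x" "(x \<oplus> y) [^] n = x \<otimes> r"
    using add_pow_factor[OF x(1) y(1) xy, of n] x y by auto
  have "(x \<oplus> y) [^] (n * m) = (x \<otimes> r) [^] m"
    using x y r by (simp flip: nat_pow_pow)
  also have "\<dots> = \<zero>"
    using x r by (simp add: pow_mult_distrib)
  finally show ?thesis by blast
qed

lemma commuting_nilpotent_mult:
  assumes "x \<in> carrier R" "x [^] (m::nat) = \<zero>" "y \<in> carrier R" "x \<otimes> y = y \<otimes> x"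
  shows "(x \<otimes> y) [^] m = \<zero>"
  using assms by (simp add: pow_mult_distrib)

theorem central_nilpotents_commutator:
  assumes fin: "finite (carrier R)"
    and central: "\<And>x y n. x \<in> carrier R \<Longrightarrow> x [^] (n::nat) = \<zero> \<Longrightarrow> y \<in> carrier R \<Longrightarrow> x \<otimes> y = y \<otimes> x"
    and ab: "a \<in> carrier R" "b \<in> carrier R"
  shows "\<exists>n::nat. (a \<otimes> b \<ominus> b \<otimes> a) [^] n = \<zero>"
proof -
  define N where "N = {x \<in> carrier R. \<exists>n::nat. x [^] n = \<zero>}"
  have mult: "x \<otimes> r \<in> N" if "x \<in> N" "r \<in> carrier R" for x r
    using that central commuting_nilpotent_mult[of x _ r] unfolding N_def by blast
  have "subgroup N (add_monoid R)"
  proof (rule add.subgroupI)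
    show "N \<noteq> {}" unfolding N_def by (auto intro!: exI[of _ \<zero>] exI[of _ "1::nat"])
    show "\<ominus> x \<in> N" if "x \<in> N" for x
      using mult[OF that, of "\<ominus> \<one>"] that by (simp add: N_def r_minus)
    show "x \<oplus> y \<in> N" if "x \<in> N" "y \<in> N" for x y
      using that central[of x _ y] commuting_nilpotents_add[of x _ y] unfolding N_def by blast
  qed (auto simp: N_def)
  then interpret N: ideal N R
  proof (rule idealI[OF ring_axioms])
    show "x \<otimes> r \<in> N" "r \<otimes> x \<in> N" if "x \<in> N" "r \<in> carrier R" for x r
      using mult[OF that] central[of x _ r] that by (auto simp: N_def)
  qed
  have Quot: "carrier (R Quot N) = {N +> x | x. x \<in> carrier R}" "ring.zero (R Quot N) = N"
    by (auto simp: FactRing_simps)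
  have mult_Quot: "(N +> x) \<otimes>\<^bsub>R Quot N\<^esub> (N +> y) = N +> (x \<otimes> y)"
    if "x \<in> carrier R" "y \<in> carrier R" for x y
    using N.rcoset_mult_add[OF that] by (simp add: FactRing_def)
  have "(N +> a) \<otimes>\<^bsub>R Quot N\<^esub> (N +> b) = (N +> b) \<otimes>\<^bsub>R Quot N\<^esub> (N +> a)"
  proof (rule reduced_finite_ring_commutative)
    show "ring (R Quot N)" by (rule N.quotient_is_ring)
    show "finite (carrier (R Quot N))" unfolding Quot using fin by simp
    fix Y assume Y: "Y \<in> carrier (R Quot N)" "Y \<otimes>\<^bsub>R Quot N\<^esub> Y = \<zero>\<^bsub>R Quot N\<^esub>"
    then obtain x where x: "x \<in> carrier R" "Y = N +> x" by (auto simp: Quot)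
    then have "N +> (x \<otimes> x) = N" using Y mult_Quot by (simp add: Quot)
    then have "x \<otimes> x \<in> N" using N.a_rcos_self[of "x \<otimes> x"] x by auto
    then obtain n :: nat where "(x \<otimes> x) [^] n = \<zero>" unfolding N_def by blast
    then have "x [^] (n + n) = \<zero>" using x(1) by (simp add: pow_mult_distrib nat_pow_mult)
    then have "x \<in> N" using x(1) unfolding N_def by blast
    then show "Y = \<zero>\<^bsub>R Quot N\<^esub>" using x N.a_rcos_const by (simp add: Quot)
  qed (use ab in \<open>auto simp: Quot\<close>)
  then have "N +> (a \<otimes> b) = N +> (b \<otimes> a)" using ab by (simp add: mult_Quot)
  then have "a \<otimes> b \<in> N +> (b \<otimes> a)" using N.a_rcos_self[of "a \<otimes> b"] ab by auto
  then have "a \<otimes> b \<ominus> b \<otimes> a \<in> N"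
    using N.a_rcos_module_minus[OF ring_axioms, of "b \<otimes> a" "a \<otimes> b"] ab by simp
  then show ?thesis unfolding N_def by blast
qed

end

section \<open>Ring elements with finitely many conjugates\<close>

lemma (in monoid) Units_factor:
  assumes "x \<in> carrier G" "y \<in> carrier G" "z \<in> carrier G" "x \<otimes> y \<in> Units G" "z \<otimes> x \<in> Units G"
  shows "x \<in> Units G"
proof -
  note Units_closed [simp]
  let ?r = "y \<otimes> inv (x \<otimes> y)" and ?l = "inv (z \<otimes> x) \<otimes> z"
  have c: "?r \<in> carrier G" "?l \<in> carrier G" using assms by auto
  have r: "x \<otimes> ?r = \<one>"
    using assms m_assoc[of x y "inv (x \<otimes> y)"] by simp
  have l: "?l \<otimes> x = \<one>"
    using assms m_assoc[of "inv (z \<otimes> x)" z x] by simp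
  have "?l = ?r" using inv_unique[OF l r] assms(1) c by blast
  then show ?thesis using assms(1) c l r unfolding Units_def by auto
qed

context ring
begin

context
  notes Units_closed [simp]
begin

definition conjs :: "'a \<Rightarrow> 'a set" where
  "conjs x = {y \<otimes> x \<otimes> inv y | y. y \<in> Units R}"

definition FC_elems :: "'a set" where
  "FC_elems = {x \<in> carrier R. finite (conjs x)}"

lemma FC_closed: "x \<in> FC_elems \<Longrightarrow> x \<in> carrier R"
  by (simp add: FC_elems_def)

lemma FC_center_iff: "x \<in> FC_center (units_of R) \<longleftrightarrow> x \<in> Units R \<and> x \<in> FC_elems"
proof -
  have "{y \<otimes>\<^bsub>units_of R\<^esub> x \<otimes>\<^bsub>units_of R\<^esub> inv\<^bsub>units_of R\<^esub> y | y. y \<in> carrier (units_of R)} = conjs x"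
    unfolding conjs_def units_of_carrier units_of_mult using units_of_inv by metis
  then show ?thesis
    by (auto simp: FC_center_def FC_elems_def units_of_carrier)
qed

lemma self_in_conjs: "x \<in> carrier R \<Longrightarrow> x \<in> conjs x"
  unfolding conjs_def by (intro CollectI exI[of _ \<one>]) simp

lemma FC_one: "\<one> \<in> FC_elems"
proof -
  have "conjs \<one> \<subseteq> {\<one>}" by (auto simp: conjs_def)
  then show ?thesis by (auto simp: FC_elems_def intro: finite_subset)
qed

lemma FC_zero: "\<zero> \<in> FC_elems"
proof -
  have "conjs \<zero> \<subseteq> {\<zero>}" by (auto simp: conjs_def)
  then show ?thesis by (auto simp: FC_elems_def intro: finite_subset)
qed

lemma conj_add:
  "y \<in> Units R \<Longrightarrow> a \<in> carrier R \<Longrightarrow> b \<in> carrier R \<Longrightarrow>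
    y \<otimes> (a \<oplus> b) \<otimes> inv y = (y \<otimes> a \<otimes> inv y) \<oplus> (y \<otimes> b \<otimes> inv y)"
  by (simp add: l_distr r_distr)

lemma conj_mult:
  assumes "y \<in> Units R" "a \<in> carrier R" "b \<in> carrier R"
  shows "y \<otimes> (a \<otimes> b) \<otimes> inv y = (y \<otimes> a \<otimes> inv y) \<otimes> (y \<otimes> b \<otimes> inv y)"
proof -
  have c: "y \<in> carrier R" "inv y \<in> carrier R" using assms by auto
  have "(y \<otimes> a \<otimes> inv y) \<otimes> (y \<otimes> b \<otimes> inv y) = y \<otimes> a \<otimes> (inv y \<otimes> y) \<otimes> (b \<otimes> inv y)"
    using assms(2,3) c by (simp add: m_assoc)
  then show ?thesis using assms c by (simp add: m_assoc)
qed

lemma FC_add: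
  assumes "x \<in> FC_elems" "y \<in> FC_elems"
  shows "x \<oplus> y \<in> FC_elems"
proof -
  have "conjs (x \<oplus> y) \<subseteq> (\<lambda>(a, b). a \<oplus> b) ` (conjs x \<times> conjs y)"
    using assms unfolding conjs_def FC_elems_def by (force simp: conj_add)
  then show ?thesis
    using assms by (auto simp: FC_elems_def intro: finite_subset)
qed

lemma FC_mult:
  assumes "x \<in> FC_elems" "y \<in> FC_elems"
  shows "x \<otimes> y \<in> FC_elems"
proof -
  have "conjs (x \<otimes> y) \<subseteq> (\<lambda>(a, b). a \<otimes> b) ` (conjs x \<times> conjs y)"
    using assms unfolding conjs_def FC_elems_def by (force simp: conj_mult)
  then show ?thesis
    using assms by (auto simp: FC_elems_def intro: finite_subset)
qed

lemma FC_minus: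
  assumes "x \<in> FC_elems"
  shows "\<ominus> x \<in> FC_elems"
proof -
  have "conjs (\<ominus> x) \<subseteq> a_inv R ` conjs x"
    using assms unfolding conjs_def FC_elems_def by (force simp: l_minus r_minus)
  then show ?thesis
    using assms by (auto simp: FC_elems_def intro: finite_subset)
qed

lemma FC_inv:
  assumes "x \<in> FC_elems" "x \<in> Units R"
  shows "inv x \<in> FC_elems"
proof -
  have "y \<otimes> inv x \<otimes> inv y = inv (y \<otimes> x \<otimes> inv y)" if y: "y \<in> Units R" for y
  proof (rule inv_unique'[THEN sym, symmetric])
    show "(y \<otimes> x \<otimes> inv y) \<otimes> (y \<otimes> inv x \<otimes> inv y) = \<one>"
      using conj_mult[OF y, of x "inv x"] assms y by simp
    show "(y \<otimes> inv x \<otimes> inv y) \<otimes> (y \<otimes> x \<otimes> inv y) = \<one>"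
      using conj_mult[OF y, of "inv x" x] assms y by simp
  qed (use assms y in auto)
  then have "conjs (inv x) \<subseteq> m_inv R ` conjs x"
    unfolding conjs_def by auto
  then show ?thesis
    using assms by (auto simp: FC_elems_def intro: finite_subset)
qed

lemma same_conj_commute:
  assumes u: "u \<in> Units R" and v: "v \<in> Units R" and x: "x \<in> carrier R"
    and eq: "u \<otimes> x \<otimes> inv u = v \<otimes> x \<otimes> inv v"
  shows "(inv v \<otimes> u) \<otimes> x = x \<otimes> (inv v \<otimes> u)"
proof -
  have c: "u \<in> carrier R" "v \<in> carrier R" "inv u \<in> carrier R" "inv v \<in> carrier R"
    using u v by auto
  have "(inv v \<otimes> u) \<otimes> x = inv v \<otimes> (u \<otimes> x \<otimes> inv u) \<otimes> u"
    using c x u by (simp add: m_assoc)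
  also have "\<dots> = (inv v \<otimes> v) \<otimes> x \<otimes> inv v \<otimes> u"
    unfolding eq using c x by (simp add: m_assoc)
  also have "\<dots> = x \<otimes> (inv v \<otimes> u)"
    using c x v by (simp add: m_assoc)
  finally show ?thesis .
qed

lemma inv_commute:
  assumes "u \<in> Units R" "x \<in> carrier R" "u \<otimes> x = x \<otimes> u"
  shows "inv u \<otimes> x = x \<otimes> inv u"
proof -
  have c: "u \<in> carrier R" "inv u \<in> carrier R" using assms by auto
  have "inv u \<otimes> x = inv u \<otimes> (x \<otimes> u) \<otimes> inv u"
    using c assms by (simp add: m_assoc)
  also have "\<dots> = (inv u \<otimes> u) \<otimes> x \<otimes> inv u"
    unfolding assms(3)[symmetric] using c assms(2) by (simp add: m_assoc)
  finally show ?thesis using assms by simp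
qed

lemma one_plus_nilpotent_Unit:
  assumes z: "z \<in> carrier R" "z [^] (n::nat) = \<zero>"
  shows "\<one> \<oplus> z \<in> Units R"
proof -
  let ?y = "\<ominus> z"
  define S where "S = (\<Oplus>k\<in>{..<n}. ?y [^] k)"
  have S: "S \<in> carrier R" unfolding S_def using z by (intro finsum_closed) auto
  have "?y = z \<otimes> \<ominus> \<one>" using z by (simp add: r_minus)
  then have yn: "?y [^] n = \<zero>"
    using commuting_nilpotent_mult[OF z, of "\<ominus> \<one>"] z by (simp add: r_minus l_minus)
  have "?y \<otimes> S \<oplus> \<one> = S"
    using pow_sum_step[of ?y n] z S unfolding S_def[symmetric] yn by simp
  then have "z \<otimes> S \<oplus> (?y \<otimes> S \<oplus> \<one>) = z \<otimes> S \<oplus> S" by simp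
  moreover have "z \<otimes> S \<oplus> (?y \<otimes> S \<oplus> \<one>) = \<one>"
    using z S by (simp add: l_minus a_assoc[symmetric] r_neg)
  ultimately have 1: "(\<one> \<oplus> z) \<otimes> S = \<one>"
    using z S by (simp add: l_distr a_comm)
  have "?y \<otimes> S = S \<otimes> ?y"
  proof -
    have "?y \<otimes> S = (\<Oplus>k\<in>{..<n}. ?y \<otimes> ?y [^] k)"
      unfolding S_def using z by (intro finsum_rdistr) auto
    also have "\<dots> = (\<Oplus>k\<in>{..<n}. ?y [^] k \<otimes> ?y)"
      using z by (intro finsum_cong') (auto simp: nat_pow_comm[of _ 1, simplified] pow_commute)
    also have "\<dots> = S \<otimes> ?y"
      unfolding S_def using z by (intro finsum_ldistr[symmetric]) auto
    finally show ?thesis .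
  qed
  then have "\<ominus> (z \<otimes> S) = \<ominus> (S \<otimes> z)"
    using z S by (simp add: l_minus r_minus)
  then have "z \<otimes> S = S \<otimes> z"
    using z S by (metis m_closed minus_minus)
  then have "S \<otimes> (\<one> \<oplus> z) = \<one>"
    using 1 z S by (simp add: l_distr r_distr)
  then show ?thesis
    using 1 z S unfolding Units_def by auto
qed

text \<open>The units \<open>1 + w x\<close>, with \<open>w\<close> running through the quotients of elements of \<open>V\<close> commuting
  with \<open>x\<close> and \<open>a\<close>, would give \<open>a\<close> infinitely many conjugates.\<close>

theorem nilpotent_FC_commutes:
  assumes V: "V \<subseteq> Units R" "infinite V"
    and sep: "\<And>d v. d \<in> carrier R \<Longrightarrow> d \<noteq> \<zero> \<Longrightarrow> finite {u \<in> V. u \<otimes> d = v}"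
    and x: "x \<in> FC_elems" "x [^] (n::nat) = \<zero>" and a: "a \<in> FC_elems"
  shows "x \<otimes> a = a \<otimes> x"
proof (rule ccontr)
  assume nc: "x \<otimes> a \<noteq> a \<otimes> x"
  have xc: "x \<in> carrier R" and ac: "a \<in> carrier R" using x a by (auto simp: FC_elems_def)
  define d where "d = x \<otimes> a \<ominus> a \<otimes> x"
  have dc: "d \<in> carrier R" using xc ac by (simp add: d_def)
  have d0: "d \<noteq> \<zero>" using nc xc ac by (simp add: d_def)
  define \<phi> where "\<phi> u = (u \<otimes> x \<otimes> inv u, u \<otimes> a \<otimes> inv u)" for u
  have "\<phi> ` V \<subseteq> conjs x \<times> conjs a"
    using V(1) by (auto simp: \<phi>_def conjs_def)
  moreover have "finite (conjs x \<times> conjs a)" using x a by (simp add: FC_elems_def)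
  ultimately have "finite (\<phi> ` V)" by (rule finite_subset)
  then obtain u0 where u0: "u0 \<in> V" "infinite {u \<in> V. \<phi> u = \<phi> u0}"
    using pigeonhole_infinite[OF V(2)] by blast
  define V' where "V' = {u \<in> V. \<phi> u = \<phi> u0}"
  define w where "w u = inv u0 \<otimes> u" for u
  define q where "q u = \<one> \<oplus> w u \<otimes> x" for u
  have u0U: "u0 \<in> Units R" using u0 V by blast
  have V'U: "u \<in> Units R" if "u \<in> V'" for u using that V by (auto simp: V'_def)
  have wc: "w u \<in> carrier R" if "u \<in> V'" for u
    using V'U[OF that] u0U by (simp add: w_def)
  have wx: "w u \<otimes> x = x \<otimes> w u" if "u \<in> V'" for u
    unfolding w_def by (rule same_conj_commute) (use that V'U u0U xc in \<open>auto simp: V'_def \<phi>_def\<close>)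
  have wa: "w u \<otimes> a = a \<otimes> w u" if "u \<in> V'" for u
    unfolding w_def by (rule same_conj_commute) (use that V'U u0U ac in \<open>auto simp: V'_def \<phi>_def\<close>)
  have wxc: "w u \<otimes> x \<in> carrier R" if "u \<in> V'" for u
    using wc[OF that] xc by simp
  have qU: "q u \<in> Units R" if "u \<in> V'" for u
  proof -
    have "(x \<otimes> w u) [^] n = \<zero>"
      using commuting_nilpotent_mult[OF xc x(2) wc[OF that]] wx[OF that] by simp
    then show ?thesis
      unfolding q_def wx[OF that] using xc wc[OF that] by (intro one_plus_nilpotent_Unit[of _ n]) auto
  qed
  have qc: "q u \<in> carrier R" "inv (q u) \<in> carrier R" if "u \<in> V'" for u
    using qU[OF that] by auto
  define \<psi> where "\<psi> u = q u \<otimes> a \<otimes> inv (q u)" for u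
  have "\<psi> ` V' \<subseteq> conjs a"
    using qU by (auto simp: \<psi>_def conjs_def)
  then have "finite (\<psi> ` V')" using a by (auto simp: FC_elems_def intro: finite_subset)
  then obtain u1 where u1: "u1 \<in> V'" "infinite {u \<in> V'. \<psi> u = \<psi> u1}"
    using pigeonhole_infinite[of V' \<psi>] u0(2) unfolding V'_def[symmetric] by blast
  have \<psi>_eq: "\<psi> u = a \<oplus> w u \<otimes> d \<otimes> inv (q u)" if u: "u \<in> V'" for u
  proof -
    have "q u \<otimes> a = a \<otimes> q u \<oplus> w u \<otimes> d"
    proof -
      have "a \<otimes> q u = a \<oplus> w u \<otimes> (a \<otimes> x)"
        using ac xc wc[OF u] wa[OF u] by (simp add: q_def r_distr flip: m_assoc)
      moreover have "q u \<otimes> a = a \<oplus> w u \<otimes> (x \<otimes> a)"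
        using ac xc wc[OF u] by (simp add: q_def l_distr m_assoc)
      moreover have "w u \<otimes> (a \<otimes> x) \<oplus> w u \<otimes> d = w u \<otimes> (x \<otimes> a)"
      proof -
        have "a \<otimes> x \<oplus> d = x \<otimes> a"
          using ac xc a_lcomm[of "a \<otimes> x" "x \<otimes> a" "\<ominus> (a \<otimes> x)"]
          by (simp add: d_def minus_eq r_neg)
        then show ?thesis
          using ac xc dc wc[OF u] r_distr[of "a \<otimes> x" d "w u"] by simp
      qed
      ultimately show ?thesis
        using ac xc wc[OF u] dc by (simp add: a_assoc)
    qed
    then have "\<psi> u = (a \<otimes> q u \<oplus> w u \<otimes> d) \<otimes> inv (q u)" by (simp add: \<psi>_def)
    also have "\<dots> = a \<otimes> (q u \<otimes> inv (q u)) \<oplus> w u \<otimes> d \<otimes> inv (q u)"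
      using ac dc wc[OF u] qc[OF u] by (simp add: l_distr m_assoc)
    finally show ?thesis using qU[OF u] ac by simp
  qed
  define m where "m = (LEAST k::nat. d \<otimes> x [^] k = \<zero>) - 1"
  have ex: "d \<otimes> x [^] n = \<zero>" using x dc by simp
  let ?L = "LEAST k::nat. d \<otimes> x [^] k = \<zero>"
  have L: "d \<otimes> x [^] ?L = \<zero>" using ex by (rule LeastI[of "\<lambda>k. d \<otimes> x [^] k = \<zero>"])
  have Lpos: "?L \<noteq> 0"
  proof
    assume "?L = 0"
    then show False using L d0 dc by simp
  qed
  then have LSuc: "?L = Suc m" by (simp add: m_def)
  have m1: "d \<otimes> x [^] Suc m = \<zero>" using L unfolding LSuc .
  have m0: "d \<otimes> x [^] m \<noteq> \<zero>"
  proof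
    assume "d \<otimes> x [^] m = \<zero>"
    then have "?L \<le> m" by (rule Least_le)
    then show False using LSuc by simp
  qed
  define e where "e = d \<otimes> x [^] m"
  have ec: "e \<in> carrier R" using dc xc by (simp add: e_def)
  have key: "w u \<otimes> e = w u \<otimes> d \<otimes> inv (q u) \<otimes> x [^] m" if u: "u \<in> V'" for u
  proof -
    have "q u \<otimes> x = x \<otimes> q u"
      using wc[OF u] xc wx[OF u] by (simp add: q_def l_distr r_distr m_assoc)
    then have "x [^] m \<otimes> q u = q u \<otimes> x [^] m"
      using pow_commute[OF xc qc(1)[OF u]] by simp
    then have com: "inv (q u) \<otimes> x [^] m = x [^] m \<otimes> inv (q u)"
      using inv_commute[OF qU[OF u]] xc by simp
    have "e \<otimes> q u = e \<oplus> e \<otimes> (x \<otimes> w u)"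
      using ec wc[OF u] xc wx[OF u] by (simp add: q_def r_distr)
    also have "e \<otimes> (x \<otimes> w u) = (d \<otimes> x [^] Suc m) \<otimes> w u"
      using dc wc[OF u] xc by (simp add: e_def m_assoc)
    finally have "e \<otimes> q u = e"
      unfolding m1 using ec wc[OF u] by simp
    then have "e \<otimes> inv (q u) = e \<otimes> q u \<otimes> inv (q u)" by simp
    also have "\<dots> = e \<otimes> (q u \<otimes> inv (q u))"
      using ec qc[OF u] by (rule m_assoc)
    also have "\<dots> = e" using qU[OF u] ec by simp
    finally have "e = e \<otimes> inv (q u)" ..
    also have "\<dots> = d \<otimes> inv (q u) \<otimes> x [^] m"
      using dc xc qc[OF u] by (simp add: e_def m_assoc com)
    finally have e2: "e = d \<otimes> inv (q u) \<otimes> x [^] m" .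
    show ?thesis
      using wc[OF u] dc xc qc(2)[OF u] by (subst e2) (simp only: m_assoc m_closed nat_pow_closed)
  qed
  have same: "u \<otimes> e = u0 \<otimes> (w u1 \<otimes> e)" if u: "u \<in> V'" "\<psi> u = \<psi> u1" for u
  proof -
    have "a \<oplus> w u \<otimes> d \<otimes> inv (q u) = a \<oplus> w u1 \<otimes> d \<otimes> inv (q u1)"
      unfolding \<psi>_eq[OF u(1), symmetric] \<psi>_eq[OF u1(1), symmetric] by (rule u(2))
    then have "w u \<otimes> d \<otimes> inv (q u) = w u1 \<otimes> d \<otimes> inv (q u1)"
      by (rule iffD1[OF add.Units_l_cancel, rotated -1])
        (use ac wc[OF u(1)] wc[OF u1(1)] dc qc(2)[OF u(1)] qc(2)[OF u1(1)] in simp_all)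
    then have "w u \<otimes> e = w u1 \<otimes> e" unfolding key[OF u(1)] key[OF u1(1)] by (rule arg_cong)
    moreover have "w u \<otimes> e = inv u0 \<otimes> (u \<otimes> e)"
      unfolding w_def using V'U[OF u(1)] u0U ec by (intro m_assoc) simp_all
    moreover have "u0 \<otimes> (inv u0 \<otimes> (u \<otimes> e)) = (u0 \<otimes> inv u0) \<otimes> (u \<otimes> e)"
      using V'U[OF u(1)] u0U ec by (intro m_assoc[symmetric]) simp_all
    moreover have "\<dots> = u \<otimes> e"
      using V'U[OF u(1)] u0U ec by simp
    ultimately show ?thesis by metis
  qed
  have "{u \<in> V'. \<psi> u = \<psi> u1} \<subseteq> {u \<in> V. u \<otimes> e = u0 \<otimes> (w u1 \<otimes> e)}"
    using same by (auto simp: V'_def)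
  moreover have "finite {u \<in> V. u \<otimes> e = u0 \<otimes> (w u1 \<otimes> e)}"
    using sep[OF ec] m0 by (simp add: e_def)
  ultimately show False using u1(2) finite_subset by blast
qed

end

end

lemma (in monoid) inv_mult_Units:
  assumes "x \<in> Units G" "y \<in> Units G"
  shows "inv (x \<otimes> y) = inv y \<otimes> inv x"
  using group.inv_mult_group[OF units_group, of x y] assms
  by (simp add: units_of_carrier units_of_mult units_of_inv)

context ring
begin

context
  notes Units_closed [simp]
begin

definition add_span :: "'a set \<Rightarrow> 'a set" where
  "add_span W = {monoid.list_prod (add_monoid R) ws | ws. set ws \<subseteq> W}"

lemma add_list_simps [simp]:
  "monoid.list_prod (add_monoid R) [] = \<zero>"
  "monoid.list_prod (add_monoid R) (w # ws) = w \<oplus> monoid.list_prod (add_monoid R) ws"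
  using monoid.list_prod_simps[of "add_monoid R"] add.monoid_axioms by auto

lemma zero_in_add_span: "\<zero> \<in> add_span W"
  unfolding add_span_def by (intro CollectI exI[of _ "[]"]) simp

lemma add_span_closed:
  assumes "W \<subseteq> carrier R" "x \<in> add_span W"
  shows "x \<in> carrier R"
proof -
  have "monoid.list_prod (add_monoid R) ws \<in> carrier R" if "set ws \<subseteq> W" for ws
    using that assms(1) by (induction ws) auto
  then show ?thesis using assms(2) by (auto simp: add_span_def)
qed

lemma add_span_induct [consumes 2, case_names zero add]:
  assumes W: "W \<subseteq> carrier R" and x: "x \<in> add_span W"
    and z: "P \<zero>" and a: "\<And>w y. w \<in> W \<Longrightarrow> y \<in> add_span W \<Longrightarrow> P y \<Longrightarrow> P (w \<oplus> y)"
  shows "P x"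
proof -
  have "P (monoid.list_prod (add_monoid R) ws)" if "set ws \<subseteq> W" for ws
    using that
  proof (induction ws)
    case (Cons w ws)
    then show ?case using a[of w "monoid.list_prod (add_monoid R) ws"] by (auto simp: add_span_def)
  qed (simp add: z)
  then show ?thesis using x by (auto simp: add_span_def)
qed

lemma add_span_Cons: "w \<in> W \<Longrightarrow> y \<in> add_span W \<Longrightarrow> w \<oplus> y \<in> add_span W"
  unfolding add_span_def
proof clarify
  fix ws assume "w \<in> W" "set ws \<subseteq> W"
  then show "\<exists>ws'. w \<oplus> monoid.list_prod (add_monoid R) ws = monoid.list_prod (add_monoid R) ws' \<and> set ws' \<subseteq> W"
    by (intro exI[of _ "w # ws"]) simp
qed

lemma add_span_incl: "W \<subseteq> carrier R \<Longrightarrow> w \<in> W \<Longrightarrow> w \<in> add_span W"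
  using add_span_Cons[OF _ zero_in_add_span, of w W] by (auto simp: subset_iff)

lemma add_span_add:
  assumes W: "W \<subseteq> carrier R" and x: "x \<in> add_span W" and y: "y \<in> add_span W"
  shows "x \<oplus> y \<in> add_span W"
  using W x
proof (induction rule: add_span_induct)
  case zero
  then show ?case using y add_span_closed[OF W y] by simp
next
  case (add w z)
  have "(w \<oplus> z) \<oplus> y = w \<oplus> (z \<oplus> y)"
    using add W y by (intro a_assoc) (auto intro: add_span_closed)
  then show ?case using add_span_Cons[OF add(1) add(3)] by simp
qed

lemma add_span_mult:
  assumes W: "W \<subseteq> carrier R" "\<And>u v. u \<in> W \<Longrightarrow> v \<in> W \<Longrightarrow> u \<otimes> v \<in> W"
    and x: "x \<in> add_span W" and y: "y \<in> add_span W"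
  shows "x \<otimes> y \<in> add_span W"
  using W(1) x
proof (induction rule: add_span_induct)
  case zero
  then show ?case using zero_in_add_span add_span_closed[OF W(1) y] by simp
next
  case (add w z)
  have wy: "w \<otimes> y \<in> add_span W"
    using W(1) y
  proof (induction rule: add_span_induct)
    case zero
    then show ?case using zero_in_add_span add W(1) by (simp add: subset_iff)
  next
    case (add v y')
    have "w \<otimes> (v \<oplus> y') = w \<otimes> v \<oplus> w \<otimes> y'"
      using add W(1) \<open>w \<in> W\<close> by (intro r_distr) (auto intro: add_span_closed)
    then show ?case using add_span_Cons[OF W(2)[OF \<open>w \<in> W\<close> add(1)] add(3)] by simp
  qed
  have "(w \<oplus> z) \<otimes> y = w \<otimes> y \<oplus> z \<otimes> y"
    using add W(1) y by (intro l_distr) (auto intro: add_span_closed)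
  then show ?case using add_span_add[OF W(1) wy add(3)] by simp
qed

lemma add_span_minus:
  assumes W: "W \<subseteq> carrier R" and N: "(N::nat) > 0" "\<And>x. x \<in> carrier R \<Longrightarrow> [N] \<cdot> x = \<zero>"
    and x: "x \<in> add_span W"
  shows "\<ominus> x \<in> add_span W"
proof -
  have xc: "x \<in> carrier R" using W x by (rule add_span_closed)
  have "[k] \<cdot> x \<in> add_span W" for k :: nat
    by (induction k) (use W x xc in \<open>auto intro: add_span_add zero_in_add_span\<close>)
  moreover have "\<ominus> x = ([(N - 1)] \<cdot> x)"
  proof (rule minus_equality)
    have "([(Suc (N - 1))] \<cdot> x) = ([(N - 1)] \<cdot> x) \<oplus> x" by simp
    then show "([(N - 1)] \<cdot> x) \<oplus> x = \<zero>" using N xc by simp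
  qed (use xc in auto)
  ultimately show ?thesis by simp
qed

lemma subring_add_span:
  assumes W: "W \<subseteq> carrier R" "\<And>u v. u \<in> W \<Longrightarrow> v \<in> W \<Longrightarrow> u \<otimes> v \<in> W" "\<one> \<in> W"
    and N: "(N::nat) > 0" "\<And>x. x \<in> carrier R \<Longrightarrow> [N] \<cdot> x = \<zero>"
  shows "subring (add_span W) R"
  by (rule subringI)
    (use W N in \<open>auto intro: add_span_closed add_span_incl add_span_minus add_span_mult add_span_add\<close>)

lemma finite_add_span:
  assumes W: "W \<subseteq> carrier R" "finite W" and N: "(N::nat) > 0" "\<And>x. x \<in> carrier R \<Longrightarrow> [N] \<cdot> x = \<zero>"
  shows "finite (add_span W)"
  unfolding add_span_def
proof (rule group.finite_list_prods[OF a_group])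
  fix x y assume "x \<in> W" "y \<in> carrier (add_monoid R)"
  then have "\<ominus> y \<oplus> x \<oplus> y = x"
    using W(1) by (simp add: subset_iff a_ac r_neg)
  then show "inv\<^bsub>add_monoid R\<^esub> y \<otimes>\<^bsub>add_monoid R\<^esub> x \<otimes>\<^bsub>add_monoid R\<^esub> y \<in> W"
    using \<open>x \<in> W\<close> by (simp add: a_inv_def)
next
  show "x [^]\<^bsub>add_monoid R\<^esub> N = \<one>\<^bsub>add_monoid R\<^esub>" if "x \<in> W" for x
    using N(2)[of x] that W(1) by (auto simp: add_pow_def)
qed (use W N in auto)

theorem torsion_FC_commutator_nilpotent:
  assumes V: "V \<subseteq> Units R" "infinite V"
    and sep: "\<And>d v. d \<in> carrier R \<Longrightarrow> d \<noteq> \<zero> \<Longrightarrow> finite {u \<in> V. u \<otimes> d = v}"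
    and N: "(N::nat) > 0" "\<And>x. x \<in> carrier R \<Longrightarrow> [N] \<cdot> x = \<zero>"
    and a: "a \<in> Units R" "a \<in> FC_elems" "n > 0" "a [^] (n::nat) = \<one>"
    and b: "b \<in> Units R" "b \<in> FC_elems" "m > 0" "b [^] (m::nat) = \<one>"
  shows "\<exists>k::nat. (a \<otimes> b \<ominus> b \<otimes> a) [^] k = \<zero>"
proof -
  interpret U: group "units_of R" by (rule units_group)
  have Us: "carrier (units_of R) = Units R" "monoid.mult (units_of R) = monoid.mult R"
    "monoid.one (units_of R) = \<one>"
    by (auto simp: units_of_def)
  have conj_conjs: "inv y \<otimes> x \<otimes> y \<in> conjs c" if x: "x \<in> conjs c" and "y \<in> Units R" "c \<in> Units R" for x y c
  proof -
    obtain z where z: "z \<in> Units R" "x = z \<otimes> c \<otimes> inv z"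
      using x unfolding conjs_def by blast
    have iv: "inv (inv y \<otimes> z) = inv z \<otimes> y"
      using z(1) that(2) by (simp add: inv_mult_Units)
    have "inv y \<otimes> x \<otimes> y = (inv y \<otimes> z) \<otimes> c \<otimes> inv (inv y \<otimes> z)"
      unfolding iv z(2) using z(1) that(2,3) by (simp add: m_assoc)
    moreover have "inv y \<otimes> z \<in> Units R" using z(1) that(2) by simp
    ultimately show ?thesis unfolding conjs_def by blast
  qed
  have conj_pow: "x [^] k = \<one>" if x: "x \<in> conjs c" and "c \<in> Units R" "c [^] k = \<one>" for x c and k :: nat
  proof -
    obtain z where z: "z \<in> Units R" "x = z \<otimes> c \<otimes> inv z"
      using x unfolding conjs_def by blast
    have "x [^] i = z \<otimes> c [^] i \<otimes> inv z" for i :: nat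
    proof (induction i)
      case (Suc i)
      have "x [^] Suc i = (z \<otimes> c [^] i \<otimes> inv z) \<otimes> (z \<otimes> c \<otimes> inv z)"
        by (simp only: nat_pow_Suc Suc.IH z(2)[symmetric])
      also have "\<dots> = z \<otimes> c [^] Suc i \<otimes> inv z"
        using conj_mult[OF z(1), of "c [^] i" c] that by simp
      finally show ?case .
    qed (use z in simp)
    then show ?thesis using that(3) z(1) by simp
  qed
  define Y where "Y = conjs a \<union> conjs b"
  have XU: "Y \<subseteq> Units R" using a b by (auto simp: Y_def conjs_def)
  define W where "W = {U.list_prod ws | ws. set ws \<subseteq> Y}"
  have "finite W"
    unfolding W_def
  proof (rule U.finite_list_prods)
    show "finite Y" using a b by (simp add: Y_def FC_elems_def)
    show "inv\<^bsub>units_of R\<^esub> y \<otimes>\<^bsub>units_of R\<^esub> x \<otimes>\<^bsub>units_of R\<^esub> y \<in> Y"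
      if "x \<in> Y" "y \<in> carrier (units_of R)" for x y
      using that conj_conjs[of x _ y] a(1) b(1) by (auto simp: Y_def Us units_of_inv)
    show "x [^]\<^bsub>units_of R\<^esub> (n * m) = \<one>\<^bsub>units_of R\<^esub>" if "x \<in> Y" for x
    proof -
      have xU: "x \<in> Units R" using that XU by blast
      have "x [^] n = \<one> \<or> x [^] m = \<one>"
        using that conj_pow a(1,4) b(1,4) unfolding Y_def by blast
      then have "x [^] (n * m) = \<one>"
        using xU by (metis Units_closed mult.commute nat_pow_one nat_pow_pow)
      then show ?thesis using xU by (simp add: units_of_pow Us)
    qed
  qed (use XU a(3) b(3) in \<open>auto simp: Us\<close>)
  have W_ind: "U.list_prod ws \<in> Units R \<and> U.list_prod ws \<in> FC_elems" if "set ws \<subseteq> Y" for ws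
    using that
  proof (induction ws)
    case Nil
    then show ?case using FC_one by (simp add: Us)
  next
    case (Cons x ws)
    have "x \<in> FC_elems"
    proof -
      obtain c z where c: "c \<in> FC_elems" "z \<in> Units R" "x = z \<otimes> c \<otimes> inv z"
        using Cons.prems a(2) b(2) by (auto simp: Y_def conjs_def)
      have cc: "c \<in> carrier R" using c(1) by (rule FC_closed)
      have "conjs x \<subseteq> conjs c"
      proof
        fix t assume "t \<in> conjs x"
        then obtain y where y: "y \<in> Units R" "t = y \<otimes> x \<otimes> inv y" by (auto simp: conjs_def)
        have iv: "inv (y \<otimes> z) = inv z \<otimes> inv y"
          using c(2) y(1) by (simp add: inv_mult_Units)
        have "t = (y \<otimes> z) \<otimes> c \<otimes> inv (y \<otimes> z)"
          unfolding iv y(2) c(3) using c(2) y(1) cc by (simp add: m_assoc)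
        moreover have "y \<otimes> z \<in> Units R" using y(1) c(2) by simp
        ultimately show "t \<in> conjs c" unfolding conjs_def by blast
      qed
      then show ?thesis using c cc by (auto simp: FC_elems_def intro: finite_subset)
    qed
    then show ?case using Cons XU by (auto simp: Us intro: FC_mult)
  qed
  have W: "W \<subseteq> carrier R" "W \<subseteq> FC_elems" using W_ind by (auto simp: W_def)
  have W_mult: "u \<otimes> v \<in> W" if uv: "u \<in> W" "v \<in> W" for u v
  proof -
    obtain us vs where l: "u = U.list_prod us" "set us \<subseteq> Y" "v = U.list_prod vs" "set vs \<subseteq> Y"
      using uv unfolding W_def by blast
    have "U.list_prod (us @ vs) = u \<otimes> v"
      using U.list_prod_append[of us vs] l XU by (simp add: Us)
    then show ?thesis
      using l unfolding W_def by (intro CollectI exI[of _ "us @ vs"]) auto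
  qed
  have W_one: "\<one> \<in> W" unfolding W_def by (intro CollectI exI[of _ "[]"]) (simp add: Us)
  have abX: "a \<in> Y" "b \<in> Y" using a b self_in_conjs by (auto simp: Y_def)
  have XW: "x \<in> W" if "x \<in> Y" for x
    unfolding W_def by (intro CollectI exI[of _ "[x]"]) (use that XU in \<open>auto simp: Us\<close>)
  define A where "A = add_span W"
  have sub: "subring A R"
    unfolding A_def using W(1) W_mult W_one N by (rule subring_add_span)
  have finA: "finite A"
    unfolding A_def using W(1) \<open>finite W\<close> N by (rule finite_add_span)
  have AFC: "x \<in> FC_elems" if "x \<in> A" for x
    using W(1) that unfolding A_def
    by (induction rule: add_span_induct) (use W(2) in \<open>auto intro: FC_zero FC_add\<close>)
  have abA: "a \<in> A" "b \<in> A" using abX XW add_span_incl[OF W(1)] by (auto simp: A_def)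
  define K where "K = R\<lparr>carrier := A\<rparr>"
  have Ks: "carrier K = A" "monoid.mult K = monoid.mult R" "monoid.one K = \<one>" "ring.zero K = \<zero>"
    "ring.add K = ring.add R"
    by (auto simp: K_def)
  interpret K: ring K unfolding K_def using sub by (rule subring_is_ring)
  have Kpow: "x [^]\<^bsub>K\<^esub> k = x [^] k" for x and k :: nat
    unfolding K_def by (simp add: nat_pow_def)
  have "\<exists>k::nat. (a \<otimes>\<^bsub>K\<^esub> b \<ominus>\<^bsub>K\<^esub> b \<otimes>\<^bsub>K\<^esub> a) [^]\<^bsub>K\<^esub> k = \<zero>\<^bsub>K\<^esub>"
  proof (rule K.central_nilpotents_commutator)
    show "x \<otimes>\<^bsub>K\<^esub> y = y \<otimes>\<^bsub>K\<^esub> x" if "x \<in> carrier K" "x [^]\<^bsub>K\<^esub> k = \<zero>\<^bsub>K\<^esub>" "y \<in> carrier K" for x y and k :: nat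
      using nilpotent_FC_commutes[OF V sep, of x k y] that AFC by (simp add: Ks Kpow)
  qed (use finA abA in \<open>auto simp: Ks\<close>)
  moreover have "a \<otimes>\<^bsub>K\<^esub> b \<ominus>\<^bsub>K\<^esub> b \<otimes>\<^bsub>K\<^esub> a = a \<otimes> b \<ominus> b \<otimes> a"
  proof -
    define d where "d = a \<otimes>\<^bsub>K\<^esub> b \<ominus>\<^bsub>K\<^esub> b \<otimes>\<^bsub>K\<^esub> a"
    have abK: "a \<in> carrier K" "b \<in> carrier K" using abA by (auto simp: Ks)
    have "d \<in> carrier K" using abK by (simp add: d_def)
    then have dc: "d \<in> carrier R" using AFC FC_closed by (auto simp: Ks)
    have "d \<oplus>\<^bsub>K\<^esub> b \<otimes>\<^bsub>K\<^esub> a = a \<otimes>\<^bsub>K\<^esub> b"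
      using abK by (simp add: d_def K.minus_eq K.a_assoc K.l_neg)
    then have "d \<oplus> b \<otimes> a = a \<otimes> b" by (simp add: Ks)
    then have "a \<otimes> b \<ominus> b \<otimes> a = d"
      using dc a(1) b(1) by (simp add: minus_eq a_assoc r_neg flip: \<open>d \<oplus> b \<otimes> a = a \<otimes> b\<close>)
    then show ?thesis by (simp add: d_def)
  qed
  ultimately show ?thesis by (simp add: Kpow Ks)
qed

end

end

section \<open>Torsion units of twisted group algebras\<close>

lemma (in domain) finite_roots_of_unity:
  assumes n: "n > 0"
  shows "finite {x \<in> carrier R. x [^] (n::nat) = \<one>}"
proof -
  define p where "p = \<one> # replicate (n - 1) \<zero> @ [\<ominus> \<one>]"
  have "eval (replicate k \<zero> @ [c]) x = c" if "x \<in> carrier R" "c \<in> carrier R" for k c x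
    using that by (induction k) auto
  then have eval: "eval p x = x [^] n \<ominus> \<one>" if "x \<in> carrier R" for x
    using that n by (simp add: minus_eq p_def)
  have "is_root p x" if x: "x \<in> carrier R" "x [^] n = \<one>" for x
    unfolding is_root_def eval[OF x(1)] using x by (simp add: p_def)
  then have "{x \<in> carrier R. x [^] n = \<one>} \<subseteq> {x. is_root p x}"
    by blast
  moreover have "p \<in> carrier (poly_ring R)"
    unfolding univ_poly_carrier[symmetric] polynomial_def p_def by auto
  ultimately show ?thesis
    using finite_number_of_roots finite_subset by blast
qed

context ring
begin

context
  notes Units_closed [simp]
begin

lemma torsion_minus_central_Unit:
  assumes b: "b \<in> carrier R" "b [^] (n::nat) = \<one>"
    and z: "z \<in> carrier R" "b \<otimes> z = z \<otimes> b" "\<one> \<ominus> z [^] n \<in> Units R"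
  shows "b \<ominus> z \<in> Units R"
proof -
  have c: "b \<ominus> z \<in> carrier R" "(b \<ominus> z) \<otimes> z = z \<otimes> (b \<ominus> z)"
    using b z by (auto simp: minus_eq l_distr r_distr l_minus r_minus)
  obtain r where r: "r \<in> carrier R" "(b \<ominus> z) \<otimes> r = r \<otimes> (b \<ominus> z)"
    "((b \<ominus> z) \<oplus> z) [^] n = z [^] n \<oplus> (b \<ominus> z) \<otimes> r"
    using add_pow_factor[OF c(1) z(1) c(2), of n] by blast
  have "(b \<ominus> z) \<oplus> z = b" using b z by (simp add: minus_eq a_assoc l_neg)
  then have "\<one> = z [^] n \<oplus> (b \<ominus> z) \<otimes> r" using r(3) b by simp
  then have "\<one> \<ominus> z [^] n = (z [^] n \<oplus> (b \<ominus> z) \<otimes> r) \<ominus> z [^] n" by simp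
  also have "\<dots> = (b \<ominus> z) \<otimes> r"
    using c(1) r(1) z(1) a_comm[of "z [^] n" "(b \<ominus> z) \<otimes> r"]
    by (simp add: minus_eq a_assoc r_neg)
  finally have "(b \<ominus> z) \<otimes> r \<in> Units R" using z(3) by simp
  then show ?thesis
    using Units_factor[of "b \<ominus> z" r r] c(1) r(1,2) by simp
qed

lemma FC_commutes_of_central_shifts:
  assumes Z: "Z \<subseteq> carrier R" "infinite Z"
    and central: "\<And>z y. z \<in> Z \<Longrightarrow> y \<in> carrier R \<Longrightarrow> z \<otimes> y = y \<otimes> z"
    and diff: "\<And>z z'. z \<in> Z \<Longrightarrow> z' \<in> Z \<Longrightarrow> z \<noteq> z' \<Longrightarrow> z \<ominus> z' \<in> Units R"
    and b: "b \<in> carrier R" "\<And>z. z \<in> Z \<Longrightarrow> b \<ominus> z \<in> Units R"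
    and a: "a \<in> FC_elems"
  shows "a \<otimes> b = b \<otimes> a"
proof -
  have ac: "a \<in> carrier R" using a by (rule FC_closed)
  define f where "f z = (b \<ominus> z) \<otimes> a \<otimes> inv (b \<ominus> z)" for z
  have "f ` Z \<subseteq> conjs a" using b(2) by (auto simp: f_def conjs_def)
  then have "finite (f ` Z)" using a by (auto simp: FC_elems_def intro: finite_subset)
  then obtain z where z: "z \<in> Z" "infinite {z' \<in> Z. f z' = f z}"
    using pigeonhole_infinite[OF Z(2)] by blast
  then have "infinite ({z' \<in> Z. f z' = f z} - {z})" by simp
  then have "{z' \<in> Z. f z' = f z} - {z} \<noteq> {}" by (rule infinite_imp_nonempty)
  then obtain z' where z': "z' \<in> Z" "f z' = f z" "z' \<noteq> z" by blast
  have zc: "z \<in> carrier R" "z' \<in> carrier R" using z z' Z by auto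
  define q where "q = f z"
  have qc: "q \<in> carrier R" unfolding q_def f_def using b z ac by simp
  have q: "(b \<ominus> t) \<otimes> a = q \<otimes> (b \<ominus> t)" if t: "t \<in> Z" "f t = q" for t
  proof -
    have U: "b \<ominus> t \<in> Units R" using b(2) t(1) by blast
    have "q \<otimes> (b \<ominus> t) = (b \<ominus> t) \<otimes> a \<otimes> (inv (b \<ominus> t) \<otimes> (b \<ominus> t))"
      unfolding t(2)[symmetric] f_def using U ac by (intro m_assoc) simp_all
    then show ?thesis using U ac by simp
  qed
  have e: "b \<otimes> a \<ominus> z \<otimes> a = q \<otimes> b \<ominus> q \<otimes> z" "b \<otimes> a \<ominus> z' \<otimes> a = q \<otimes> b \<ominus> q \<otimes> z'"
    using q[OF z(1)] q[OF z'(1)] z'(2) b(1) zc ac qc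
    by (simp_all add: q_def minus_eq l_distr r_distr l_minus r_minus)
  have diff_diff: "(s \<ominus> u) \<ominus> (s \<ominus> v) = v \<ominus> u"
    if "s \<in> carrier R" "u \<in> carrier R" "v \<in> carrier R" for s u v
  proof -
    have "(s \<ominus> u) \<ominus> (s \<ominus> v) = (s \<oplus> \<ominus> s) \<oplus> (v \<oplus> \<ominus> u)"
      using that by (simp add: minus_eq minus_add a_ac)
    then show ?thesis using that by (simp add: minus_eq r_neg)
  qed
  have "z' \<otimes> a \<ominus> z \<otimes> a = (b \<otimes> a \<ominus> z \<otimes> a) \<ominus> (b \<otimes> a \<ominus> z' \<otimes> a)"
    using diff_diff[of "b \<otimes> a" "z \<otimes> a" "z' \<otimes> a"] b(1) zc ac by simp
  also have "\<dots> = q \<otimes> z' \<ominus> q \<otimes> z"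
    unfolding e using diff_diff[of "q \<otimes> b" "q \<otimes> z" "q \<otimes> z'"] b(1) zc qc by simp
  also have "\<dots> = z' \<otimes> q \<ominus> z \<otimes> q"
    using central[OF z(1) qc] central[OF z'(1) qc] by simp
  finally have "(z' \<ominus> z) \<otimes> a = (z' \<ominus> z) \<otimes> q"
    using zc ac qc by (simp add: minus_eq l_distr l_minus)
  then have aq: "q = a"
    using Units_l_cancel[OF diff[OF z'(1) z(1) z'(3)] ac qc] by simp
  have "(b \<otimes> a \<ominus> z \<otimes> a) \<oplus> z \<otimes> a = (a \<otimes> b \<ominus> a \<otimes> z) \<oplus> z \<otimes> a"
    using e(1) unfolding aq by simp
  then show ?thesis
    using central[OF z(1) ac] b(1) zc(1) ac by (simp add: minus_eq a_assoc l_neg)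
qed

definition central_unipotent :: "'a \<Rightarrow> bool" where
  "central_unipotent c \<longleftrightarrow> c \<in> Units R \<and> c \<in> FC_elems \<and> (\<forall>y\<in>FC_elems. c \<otimes> y = y \<otimes> c) \<and>
     (\<exists>n::nat. (c \<ominus> \<one>) [^] n = \<zero>)"

lemma central_unipotent_one: "central_unipotent \<one>"
  unfolding central_unipotent_def using FC_one FC_closed
  by (auto intro!: exI[of _ "1::nat"] simp: minus_eq r_neg)

lemma central_unipotent_mult:
  assumes c: "central_unipotent c" and d: "central_unipotent d"
  shows "central_unipotent (c \<otimes> d)"
proof -
  have C: "c \<in> Units R" "c \<in> FC_elems" "\<And>y. y \<in> FC_elems \<Longrightarrow> c \<otimes> y = y \<otimes> c"
    and D: "d \<in> Units R" "d \<in> FC_elems" "\<And>y. y \<in> FC_elems \<Longrightarrow> d \<otimes> y = y \<otimes> d"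
    using c d by (auto simp: central_unipotent_def)
  obtain m n :: nat where mn: "(c \<ominus> \<one>) [^] m = \<zero>" "(d \<ominus> \<one>) [^] n = \<zero>"
    using c d by (auto simp: central_unipotent_def)
  have cc: "c \<in> carrier R" "d \<in> carrier R" using C D by auto
  have cd: "c \<otimes> d = d \<otimes> c" using C(3) D(2) by blast
  have com: "(c \<otimes> d) \<otimes> y = y \<otimes> (c \<otimes> d)" if y: "y \<in> FC_elems" for y
  proof -
    have yc: "y \<in> carrier R" using y by (rule FC_closed)
    have "(c \<otimes> d) \<otimes> y = c \<otimes> (y \<otimes> d)"
      using cc yc D(3)[OF y] by (simp add: m_assoc)
    also have "\<dots> = (c \<otimes> y) \<otimes> d" using cc yc by (simp add: m_assoc)
    also have "\<dots> = y \<otimes> (c \<otimes> d)" unfolding C(3)[OF y] using cc yc by (simp add: m_assoc)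
    finally show ?thesis .
  qed
  have e: "(c \<ominus> \<one>) \<otimes> d \<oplus> (d \<ominus> \<one>) = c \<otimes> d \<ominus> \<one>"
  proof -
    have "(c \<ominus> \<one>) \<otimes> d \<oplus> (d \<ominus> \<one>) = c \<otimes> d \<oplus> ((\<ominus> d \<oplus> d) \<oplus> \<ominus> \<one>)"
      using cc by (simp add: minus_eq l_distr l_minus a_assoc)
    then show ?thesis using cc by (simp add: l_neg minus_eq)
  qed
  have c1d: "(c \<ominus> \<one>) \<otimes> d = d \<otimes> (c \<ominus> \<one>)"
    using cc cd by (simp add: minus_eq l_distr r_distr l_minus r_minus)
  have k1: "((c \<ominus> \<one>) \<otimes> d) [^] m = \<zero>"
    using commuting_nilpotent_mult[OF _ mn(1) cc(2) c1d] cc by simp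
  have k2: "((c \<ominus> \<one>) \<otimes> d) \<otimes> (d \<ominus> \<one>) = (d \<ominus> \<one>) \<otimes> ((c \<ominus> \<one>) \<otimes> d)"
  proof -
    have x: "(c \<ominus> \<one>) \<otimes> d \<in> carrier R" using cc by simp
    have "((c \<ominus> \<one>) \<otimes> d) \<otimes> d = d \<otimes> ((c \<ominus> \<one>) \<otimes> d)"
      unfolding c1d using cc by (simp add: m_assoc c1d)
    then show ?thesis
      using cc(2) x by (simp add: minus_eq[of d] l_distr[of d "\<ominus> \<one>"] r_distr[of d "\<ominus> \<one>"] l_minus r_minus)
  qed
  have "\<exists>k::nat. (((c \<ominus> \<one>) \<otimes> d) \<oplus> (d \<ominus> \<one>)) [^] k = \<zero>"
    by (rule commuting_nilpotents_add[OF _ k1 _ mn(2) k2]) (use cc in simp_all)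
  then show ?thesis
    unfolding central_unipotent_def e using Units_m_closed[OF C(1) D(1)] FC_mult[OF C(2) D(2)] com by blast
qed

lemma central_unipotent_inv:
  assumes c: "central_unipotent c"
  shows "central_unipotent (inv c)"
proof -
  have C: "c \<in> Units R" "c \<in> FC_elems" "\<And>y. y \<in> FC_elems \<Longrightarrow> c \<otimes> y = y \<otimes> c"
    using c by (auto simp: central_unipotent_def)
  obtain m :: nat where m: "(c \<ominus> \<one>) [^] m = \<zero>"
    using c by (auto simp: central_unipotent_def)
  have cc: "c \<in> carrier R" "inv c \<in> carrier R" using C by auto
  have e: "(c \<ominus> \<one>) \<otimes> \<ominus> (inv c) = inv c \<ominus> \<one>"
  proof -
    have "(c \<ominus> \<one>) \<otimes> \<ominus> (inv c) = \<ominus> (c \<otimes> inv c) \<oplus> inv c"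
      using cc minus_add[of "c \<otimes> inv c" "\<ominus> (inv c)"] by (simp add: minus_eq l_distr l_minus r_minus)
    also have "\<dots> = inv c \<ominus> \<one>" using C(1) cc by (simp add: minus_eq a_comm)
    finally show ?thesis .
  qed
  have com: "(c \<ominus> \<one>) \<otimes> \<ominus> (inv c) = \<ominus> (inv c) \<otimes> (c \<ominus> \<one>)"
  proof -
    have "\<ominus> (inv c) \<otimes> (c \<ominus> \<one>) = \<ominus> (inv c \<otimes> c) \<oplus> inv c"
      using cc minus_add[of "inv c \<otimes> c" "\<ominus> (inv c)"] by (simp add: minus_eq r_distr l_minus r_minus)
    also have "\<dots> = inv c \<ominus> \<one>" using C(1) cc by (simp add: minus_eq a_comm)
    finally show ?thesis using e by simp
  qed
  have "(inv c \<ominus> \<one>) [^] m = \<zero>"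
    using commuting_nilpotent_mult[OF _ m _ com] cc unfolding e by simp
  moreover have "inv c \<otimes> y = y \<otimes> inv c" if "y \<in> FC_elems" for y
    by (rule inv_commute[OF C(1) FC_closed[OF that] C(3)[OF that]])
  ultimately show ?thesis
    unfolding central_unipotent_def using Units_inv_Units[OF C(1)] FC_inv[OF C(2,1)] by blast
qed

lemma minus_one_commute:
  assumes c: "c \<in> carrier R" "y \<in> carrier R" "(c \<ominus> \<one>) \<otimes> y = y \<otimes> (c \<ominus> \<one>)"
  shows "c \<otimes> y = y \<otimes> c"
proof -
  have "c \<otimes> y \<oplus> \<ominus> y = y \<otimes> c \<oplus> \<ominus> y"
    using c by (simp add: minus_eq l_distr r_distr l_minus r_minus)
  then show ?thesis using c(1,2) by (simp add: add.right_cancel)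
qed

lemma central_unipotent_commutator:
  assumes nil: "\<And>x y n. x \<in> FC_elems \<Longrightarrow> x [^] (n::nat) = \<zero> \<Longrightarrow> y \<in> FC_elems \<Longrightarrow> x \<otimes> y = y \<otimes> x"
    and a: "a \<in> Units R" "a \<in> FC_elems" and b: "b \<in> Units R" "b \<in> FC_elems"
    and ab: "(a \<otimes> b \<ominus> b \<otimes> a) [^] (k::nat) = \<zero>"
  shows "central_unipotent (a \<otimes> b \<otimes> inv a \<otimes> inv b)"
proof -
  let ?d = "a \<otimes> b \<ominus> b \<otimes> a" and ?v = "inv a \<otimes> inv b" and ?c = "a \<otimes> b \<otimes> inv a \<otimes> inv b"
  have cl: "a \<in> carrier R" "b \<in> carrier R" "inv a \<in> carrier R" "inv b \<in> carrier R"
    using a b by auto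
  have F: "?d \<in> FC_elems" "?v \<in> FC_elems" "?c \<in> FC_elems"
    using a b by (simp_all add: minus_eq FC_add FC_minus FC_mult FC_inv)
  have bav: "(b \<otimes> a) \<otimes> ?v = \<one>"
  proof -
    have "(b \<otimes> a) \<otimes> ?v = b \<otimes> (a \<otimes> inv a) \<otimes> inv b"
      using cl by (simp only: m_assoc m_closed)
    then show ?thesis using a b cl by simp
  qed
  have "?d \<otimes> ?v = (a \<otimes> b) \<otimes> ?v \<ominus> (b \<otimes> a) \<otimes> ?v"
    using cl by (simp add: minus_eq l_distr l_minus)
  also have "\<dots> = ?c \<ominus> \<one>"
    unfolding bav using cl by (simp add: m_assoc)
  finally have dv: "?d \<otimes> ?v = ?c \<ominus> \<one>" .
  have "(?d \<otimes> ?v) [^] k = \<zero>"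
    by (rule commuting_nilpotent_mult[OF _ ab _ nil[OF F(1) ab F(2)]]) (use cl in simp_all)
  then have n: "(?c \<ominus> \<one>) [^] k = \<zero>" unfolding dv .
  have cF: "?c \<ominus> \<one> \<in> FC_elems" using F(3) by (simp add: minus_eq FC_add FC_minus FC_one)
  have "?c \<otimes> y = y \<otimes> ?c" if y: "y \<in> FC_elems" for y
  proof -
    show ?thesis
      by (rule minus_one_commute[OF _ _ nil[OF cF n y]]) (use y F(3) FC_closed in blast)+
  qed
  moreover have "?c \<in> Units R" using a b by simp
  ultimately show ?thesis
    unfolding central_unipotent_def using n F(3) by blast
qed

lemma central_unipotent_derived:
  assumes T: "T \<subseteq> Units R"
    and com: "\<And>a b. a \<in> T \<Longrightarrow> b \<in> T \<Longrightarrow> central_unipotent (a \<otimes> b \<otimes> inv a \<otimes> inv b)"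
    and x: "x \<in> derived (units_of R) T"
  shows "central_unipotent x"
  using x unfolding derived_def
proof (induction rule: generate.induct)
  case one
  then show ?case using central_unipotent_one by (simp add: units_of_one)
next
  case (incl h)
  then show ?case using com T by (auto simp: units_of_mult units_of_inv subset_iff)
next
  case (inv h)
  then have "central_unipotent h" using com T by (auto simp: units_of_mult units_of_inv subset_iff)
  then show ?case
    using central_unipotent_inv by (auto simp: units_of_inv central_unipotent_def)
next
  case (eng h1 h2)
  then show ?case using central_unipotent_mult by (simp add: units_of_mult)
qed

lemma central_unipotent_imp:
  assumes "central_unipotent x"
  shows "unipotent R x \<and> x \<in> FC_center (units_of R) \<and>
    (\<forall>y \<in> FC_center (units_of R). x \<otimes>\<^bsub>units_of R\<^esub> y = y \<otimes>\<^bsub>units_of R\<^esub> x)"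
proof -
  have c: "x \<in> carrier R" using assms by (auto simp: central_unipotent_def)
  have "x = \<one> \<oplus> (x \<ominus> \<one>)"
    using c a_lcomm[of \<one> x "\<ominus> \<one>"] by (simp add: minus_eq r_neg)
  then have "unipotent R x"
    using assms c unfolding unipotent_def nilpotent_elem_def central_unipotent_def by blast
  then show ?thesis
    using assms by (auto simp: FC_center_iff central_unipotent_def units_of_mult)
qed

end

end

context tga
begin

sublocale ring_R: ring R by (rule ring_R)

sublocale module_R: Module.module K R by (rule module_R)

lemma smult_mult_left:
  assumes s: "s \<in> carrier K" and a: "a \<in> carrier R" and b: "b \<in> carrier R"
  shows "(s \<odot>\<^bsub>R\<^esub> a) \<otimes>\<^bsub>R\<^esub> b = s \<odot>\<^bsub>R\<^esub> (a \<otimes>\<^bsub>R\<^esub> b)"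
proof
  fix x
  let ?A = "tga_supp K a" and ?B = "tga_supp K b"
  have A: "finite ?A" "?A \<subseteq> carrier G" and B: "finite ?B" "?B \<subseteq> ?B" "?B \<subseteq> carrier G"
    using a b by (auto simp: supp_finite dest: supp_carrierD)
  have sub: "tga_supp K (s \<odot>\<^bsub>R\<^esub> a) \<subseteq> ?A"
    using s by (auto simp: tga_supp_def smult_eq)
  have "((s \<odot>\<^bsub>R\<^esub> a) \<otimes>\<^bsub>R\<^esub> b) x = (\<Oplus>\<^bsub>K\<^esub>g\<in>?A. \<Oplus>\<^bsub>K\<^esub>h\<in>?B. summand (s \<odot>\<^bsub>R\<^esub> a) b x g h)"
    by (rule mult_eq[OF smult_closed[OF s a] b A(1) sub A(2) B])
  also have "\<dots> = (\<Oplus>\<^bsub>K\<^esub>g\<in>?A. s \<otimes>\<^bsub>K\<^esub> (\<Oplus>\<^bsub>K\<^esub>h\<in>?B. summand a b x g h))"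
  proof (rule K.finsum_eqI)
    fix g assume g: "g \<in> ?A"
    have gG: "g \<in> carrier G" using g A(2) by blast
    have "(\<Oplus>\<^bsub>K\<^esub>h\<in>?B. summand (s \<odot>\<^bsub>R\<^esub> a) b x g h) = (\<Oplus>\<^bsub>K\<^esub>h\<in>?B. s \<otimes>\<^bsub>K\<^esub> summand a b x g h)"
      using s a b gG B(3)
      by (intro K.finsum_eqI) (auto simp: summand_def smult_eq coeff_closed K.m_assoc)
    also have "\<dots> = s \<otimes>\<^bsub>K\<^esub> (\<Oplus>\<^bsub>K\<^esub>h\<in>?B. summand a b x g h)"
      using s a b gG B by (intro K.finsum_rdistr[symmetric]) (auto intro!: summand_closed)
    finally show "(\<Oplus>\<^bsub>K\<^esub>h\<in>?B. summand (s \<odot>\<^bsub>R\<^esub> a) b x g h) = s \<otimes>\<^bsub>K\<^esub> (\<Oplus>\<^bsub>K\<^esub>h\<in>?B. summand a b x g h)" .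
  qed (use s a b A B in \<open>auto intro!: K.finsum_closed summand_closed\<close>)
  also have "\<dots> = s \<otimes>\<^bsub>K\<^esub> (\<Oplus>\<^bsub>K\<^esub>g\<in>?A. \<Oplus>\<^bsub>K\<^esub>h\<in>?B. summand a b x g h)"
    using s a b A B by (intro K.finsum_rdistr[symmetric]) (auto intro!: summand_closed K.finsum_closed)
  also have "\<dots> = (s \<odot>\<^bsub>R\<^esub> (a \<otimes>\<^bsub>R\<^esub> b)) x"
    unfolding smult_eq mult_eq[OF a b A(1) order_refl A(2) B] ..
  finally show "((s \<odot>\<^bsub>R\<^esub> a) \<otimes>\<^bsub>R\<^esub> b) x = (s \<odot>\<^bsub>R\<^esub> (a \<otimes>\<^bsub>R\<^esub> b)) x" .
qed

lemma smult_mult_right: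
  assumes s: "s \<in> carrier K" and a: "a \<in> carrier R" and b: "b \<in> carrier R"
  shows "a \<otimes>\<^bsub>R\<^esub> (s \<odot>\<^bsub>R\<^esub> b) = s \<odot>\<^bsub>R\<^esub> (a \<otimes>\<^bsub>R\<^esub> b)"
proof
  fix x
  let ?A = "tga_supp K a" and ?B = "tga_supp K b"
  have A: "finite ?A" "?A \<subseteq> ?A" "?A \<subseteq> carrier G" and B: "finite ?B" "?B \<subseteq> carrier G"
    using a b by (auto simp: supp_finite dest: supp_carrierD)
  have sub: "tga_supp K (s \<odot>\<^bsub>R\<^esub> b) \<subseteq> ?B"
    using s by (auto simp: tga_supp_def smult_eq)
  have "(a \<otimes>\<^bsub>R\<^esub> (s \<odot>\<^bsub>R\<^esub> b)) x = (\<Oplus>\<^bsub>K\<^esub>g\<in>?A. \<Oplus>\<^bsub>K\<^esub>h\<in>?B. summand a (s \<odot>\<^bsub>R\<^esub> b) x g h)"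
    by (rule mult_eq[OF a smult_closed[OF s b] A B(1) sub B(2)])
  also have "\<dots> = (\<Oplus>\<^bsub>K\<^esub>g\<in>?A. s \<otimes>\<^bsub>K\<^esub> (\<Oplus>\<^bsub>K\<^esub>h\<in>?B. summand a b x g h))"
  proof (rule K.finsum_eqI)
    fix g assume g: "g \<in> ?A"
    have gG: "g \<in> carrier G" using g A(3) by blast
    have "(\<Oplus>\<^bsub>K\<^esub>h\<in>?B. summand a (s \<odot>\<^bsub>R\<^esub> b) x g h) = (\<Oplus>\<^bsub>K\<^esub>h\<in>?B. s \<otimes>\<^bsub>K\<^esub> summand a b x g h)"
    proof (rule K.finsum_eqI)
      fix h assume "h \<in> ?B"
      then have hG: "h \<in> carrier G" using B(2) by blast
      have "a g \<otimes>\<^bsub>K\<^esub> (s \<otimes>\<^bsub>K\<^esub> b h) = s \<otimes>\<^bsub>K\<^esub> (a g \<otimes>\<^bsub>K\<^esub> b h)"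
        using s a b by (intro K.m_lcomm) (auto simp: coeff_closed)
      then show "summand a (s \<odot>\<^bsub>R\<^esub> b) x g h = s \<otimes>\<^bsub>K\<^esub> summand a b x g h"
        using s a b gG hG K.m_assoc[of s "a g \<otimes>\<^bsub>K\<^esub> b h" "\<Lambda> g h"]
        by (simp add: summand_def smult_eq coeff_closed)
      show "s \<otimes>\<^bsub>K\<^esub> summand a b x g h \<in> carrier K"
        using s a b gG hG by (simp add: summand_closed)
    qed
    also have "\<dots> = s \<otimes>\<^bsub>K\<^esub> (\<Oplus>\<^bsub>K\<^esub>h\<in>?B. summand a b x g h)"
      using s a b gG B by (intro K.finsum_rdistr[symmetric]) (auto intro!: summand_closed)
    finally show "(\<Oplus>\<^bsub>K\<^esub>h\<in>?B. summand a (s \<odot>\<^bsub>R\<^esub> b) x g h) = s \<otimes>\<^bsub>K\<^esub> (\<Oplus>\<^bsub>K\<^esub>h\<in>?B. summand a b x g h)" .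
  qed (use s a b A B in \<open>auto intro!: K.finsum_closed summand_closed\<close>)
  also have "\<dots> = s \<otimes>\<^bsub>K\<^esub> (\<Oplus>\<^bsub>K\<^esub>g\<in>?A. \<Oplus>\<^bsub>K\<^esub>h\<in>?B. summand a b x g h)"
    using s a b A B by (intro K.finsum_rdistr[symmetric]) (auto intro!: summand_closed K.finsum_closed)
  also have "\<dots> = (s \<odot>\<^bsub>R\<^esub> (a \<otimes>\<^bsub>R\<^esub> b)) x"
    unfolding smult_eq mult_eq[OF a b A B(1) order_refl B(2)] ..
  finally show "(a \<otimes>\<^bsub>R\<^esub> (s \<odot>\<^bsub>R\<^esub> b)) x = (s \<odot>\<^bsub>R\<^esub> (a \<otimes>\<^bsub>R\<^esub> b)) x" .
qed

definition scalar :: "'k \<Rightarrow> 'g \<Rightarrow> 'k" where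
  "scalar s = s \<odot>\<^bsub>R\<^esub> \<one>\<^bsub>R\<^esub>"

lemma scalar_closed: "s \<in> carrier K \<Longrightarrow> scalar s \<in> carrier R"
  by (simp add: scalar_def smult_closed one_closed)

lemma scalar_mult:
  assumes "s \<in> carrier K" "a \<in> carrier R"
  shows "scalar s \<otimes>\<^bsub>R\<^esub> a = s \<odot>\<^bsub>R\<^esub> a" "a \<otimes>\<^bsub>R\<^esub> scalar s = s \<odot>\<^bsub>R\<^esub> a"
  using assms by (simp_all add: scalar_def smult_mult_left smult_mult_right one_closed)

lemma scalar_scalar:
  assumes "s \<in> carrier K" "t \<in> carrier K"
  shows "scalar s \<otimes>\<^bsub>R\<^esub> scalar t = scalar (s \<otimes>\<^bsub>K\<^esub> t)"
proof -
  have "scalar s \<otimes>\<^bsub>R\<^esub> scalar t = s \<odot>\<^bsub>R\<^esub> scalar t"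
    using assms by (intro scalar_mult scalar_closed)
  also have "\<dots> = scalar (s \<otimes>\<^bsub>K\<^esub> t)"
    unfolding scalar_def using assms one_closed by (intro module_R.smult_assoc1[symmetric])
  finally show ?thesis .
qed

lemma scalar_one: "scalar \<one>\<^bsub>K\<^esub> = \<one>\<^bsub>R\<^esub>"
  by (simp add: scalar_def module_R.smult_one one_closed)

lemma scalar_pow:
  "s \<in> carrier K \<Longrightarrow> scalar s [^]\<^bsub>R\<^esub> (n::nat) = scalar (s [^]\<^bsub>K\<^esub> n)"
  by (induction n) (simp_all add: scalar_one scalar_scalar)

lemma scalar_diff:
  assumes "s \<in> carrier K" "t \<in> carrier K"
  shows "scalar s \<ominus>\<^bsub>R\<^esub> scalar t = scalar (s \<ominus>\<^bsub>K\<^esub> t)"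
  using assms unfolding scalar_def ring_R.minus_eq K.minus_eq
  by (simp add: module_R.smult_l_distr module_R.smult_l_minus one_closed)

lemma scalar_Unit:
  assumes "s \<in> carrier K" "s \<noteq> \<zero>\<^bsub>K\<^esub>"
  shows "scalar s \<in> Units R"
proof -
  have s: "s \<in> Units K" using assms by (simp add: K.field_Units)
  have "scalar s \<otimes>\<^bsub>R\<^esub> scalar (inv\<^bsub>K\<^esub> s) = \<one>\<^bsub>R\<^esub>" "scalar (inv\<^bsub>K\<^esub> s) \<otimes>\<^bsub>R\<^esub> scalar s = \<one>\<^bsub>R\<^esub>"
    using s assms by (simp_all add: scalar_scalar scalar_one)
  then show ?thesis
    using s assms scalar_closed unfolding Units_def[of R] by auto
qed

lemma scalar_inj:
  assumes "s \<in> carrier K" "t \<in> carrier K" "scalar s = scalar t"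
  shows "s = t"
proof -
  have "s \<otimes>\<^bsub>K\<^esub> inv\<^bsub>K\<^esub> (\<Lambda> \<one>\<^bsub>G\<^esub> \<one>\<^bsub>G\<^esub>) = t \<otimes>\<^bsub>K\<^esub> inv\<^bsub>K\<^esub> (\<Lambda> \<one>\<^bsub>G\<^esub> \<one>\<^bsub>G\<^esub>)"
    using fun_cong[OF assms(3), of "\<one>\<^bsub>G\<^esub>"] by (simp add: scalar_def smult_eq one_eq)
  moreover have "inv\<^bsub>K\<^esub> (\<Lambda> \<one>\<^bsub>G\<^esub> \<one>\<^bsub>G\<^esub>) \<noteq> \<zero>\<^bsub>K\<^esub>"
    using inv_L_one K.zero_not_one by (metis G.one_closed K.l_null L_closed)
  ultimately show ?thesis
    using K.m_rcancel assms(1,2) inv_L_one(2) by metis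
qed

lemma basis_Unit:
  assumes g: "g \<in> carrier G"
  shows "tga_basis K g \<in> Units R"
proof -
  have b1: "tga_basis K \<one>\<^bsub>G\<^esub> = scalar (\<Lambda> \<one>\<^bsub>G\<^esub> \<one>\<^bsub>G\<^esub>)"
    by (auto simp: fun_eq_iff tga_basis_def scalar_def smult_eq one_eq K.field_Units)
  have U: "tga_basis K h \<otimes>\<^bsub>R\<^esub> tga_basis K k \<in> Units R"
    if "h \<in> carrier G" "k \<in> carrier G" "h \<otimes>\<^bsub>G\<^esub> k = \<one>\<^bsub>G\<^esub>" for h k
  proof -
    have "tga_basis K h \<otimes>\<^bsub>R\<^esub> tga_basis K k = scalar (\<Lambda> h k) \<otimes>\<^bsub>R\<^esub> scalar (\<Lambda> \<one>\<^bsub>G\<^esub> \<one>\<^bsub>G\<^esub>)"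
      using that by (simp add: basis_mult b1 scalar_mult(1) scalar_closed)
    then show ?thesis using that by (simp add: scalar_Unit)
  qed
  show ?thesis
    by (rule ring_R.Units_factor[where y = "tga_basis K (inv\<^bsub>G\<^esub> g)" and z = "tga_basis K (inv\<^bsub>G\<^esub> g)"])
      (use g in \<open>auto intro: basis_closed U\<close>)
qed

lemma basis_inj: "inj (tga_basis K)"
proof (rule injI)
  fix g h assume "tga_basis K g = tga_basis K h"
  from fun_cong[OF this, of g] show "g = h"
    by (auto simp: tga_basis_def split: if_splits)
qed

lemma basis_mult_coeff:
  assumes g: "g \<in> carrier G" and s: "s \<in> carrier G" and d: "d \<in> carrier R"
  shows "(tga_basis K g \<otimes>\<^bsub>R\<^esub> d) (g \<otimes>\<^bsub>G\<^esub> s) = d s \<otimes>\<^bsub>K\<^esub> \<Lambda> g s"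
proof -
  let ?B = "insert s (tga_supp K d)"
  have B: "finite ?B" "tga_supp K d \<subseteq> ?B" "?B \<subseteq> carrier G"
    using d s by (auto simp: supp_finite dest: supp_carrierD)
  have "(tga_basis K g \<otimes>\<^bsub>R\<^esub> d) (g \<otimes>\<^bsub>G\<^esub> s)
      = (\<Oplus>\<^bsub>K\<^esub>g'\<in>{g}. \<Oplus>\<^bsub>K\<^esub>h\<in>?B. summand (tga_basis K g) d (g \<otimes>\<^bsub>G\<^esub> s) g' h)"
    by (rule mult_eq[OF basis_closed[OF g] d _ _ _ B]) (use g in \<open>auto simp: tga_supp_def tga_basis_def\<close>)
  also have "\<dots> = (\<Oplus>\<^bsub>K\<^esub>h\<in>?B. summand (tga_basis K g) d (g \<otimes>\<^bsub>G\<^esub> s) g h)"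
  proof (rule K.finsum_single)
    show "(\<Oplus>\<^bsub>K\<^esub>h\<in>?B. summand (tga_basis K g) d (g \<otimes>\<^bsub>G\<^esub> s) g h) \<in> carrier K"
      using g B(3) d by (intro K.finsum_closed) (blast intro: summand_closed basis_closed)
  qed auto
  also have "\<dots> = summand (tga_basis K g) d (g \<otimes>\<^bsub>G\<^esub> s) g s"
    using g s d B by (intro K.finsum_single)
      (auto intro!: summand_closed basis_closed simp: summand_def subset_iff coeff_closed basis_closed)
  finally show ?thesis
    using g s d by (simp add: summand_def tga_basis_def coeff_closed)
qed

lemma finite_basis_mult_eq:
  assumes d: "d \<in> carrier R" "d \<noteq> \<zero>\<^bsub>R\<^esub>"
  shows "finite {u \<in> tga_basis K ` carrier G. u \<otimes>\<^bsub>R\<^esub> d = v}"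
proof (cases "v \<in> carrier R")
  case False
  have "tga_basis K g \<otimes>\<^bsub>R\<^esub> d \<in> carrier R" if "g \<in> carrier G" for g
    using that d(1) by (intro mult_closed basis_closed)
  then have "{u \<in> tga_basis K ` carrier G. u \<otimes>\<^bsub>R\<^esub> d = v} = {}"
    using False by blast
  then show ?thesis by (simp only: finite.emptyI)
next
  case v: True
  obtain s where s: "d s \<noteq> \<zero>\<^bsub>K\<^esub>" using d(2) by (auto simp: zero_eq)
  then have sG: "s \<in> carrier G" using d(1) by (auto simp: tga_supp_def dest: supp_carrierD)
  have "{u \<in> tga_basis K ` carrier G. u \<otimes>\<^bsub>R\<^esub> d = v}
      \<subseteq> (\<lambda>t. tga_basis K (t \<otimes>\<^bsub>G\<^esub> inv\<^bsub>G\<^esub> s)) ` tga_supp K v"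
  proof clarify
    fix g assume g: "g \<in> carrier G" "v = tga_basis K g \<otimes>\<^bsub>R\<^esub> d"
    have "v (g \<otimes>\<^bsub>G\<^esub> s) \<noteq> \<zero>\<^bsub>K\<^esub>"
      unfolding g(2) basis_mult_coeff[OF g(1) sG d(1)]
      using K.integral_iff[of "d s" "\<Lambda> g s"] s g(1) sG d(1) coeff_closed by auto
    then have "g \<otimes>\<^bsub>G\<^esub> s \<in> tga_supp K v" by (simp add: tga_supp_def)
    moreover have "g = (g \<otimes>\<^bsub>G\<^esub> s) \<otimes>\<^bsub>G\<^esub> inv\<^bsub>G\<^esub> s"
      using g(1) sG by (simp add: G.m_assoc)
    ultimately show "tga_basis K g \<in> (\<lambda>t. tga_basis K (t \<otimes>\<^bsub>G\<^esub> inv\<^bsub>G\<^esub> s)) ` tga_supp K (tga_basis K g \<otimes>\<^bsub>R\<^esub> d)"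
      unfolding g(2) by (metis (no_types, lifting) image_eqI)
  qed
  then show ?thesis
    using supp_finite[OF v] finite_subset by blast
qed

lemma finite_carrier_R:
  assumes "finite (carrier G)" "finite (carrier K)"
  shows "finite (carrier R)"
proof (rule finite_subset)
  show "finite {f. \<forall>x. (x \<in> carrier G \<longrightarrow> f x \<in> carrier K) \<and> (x \<notin> carrier G \<longrightarrow> f x = \<zero>\<^bsub>K\<^esub>)}"
    using assms by (rule finite_set_of_finite_funs)
qed (auto simp: carrier_iff tga_supp_def)

lemma card_K_add_pow:
  assumes fin: "finite (carrier K)" and x: "x \<in> carrier R"
  shows "[(card (carrier K))] \<cdot>\<^bsub>R\<^esub> x = \<zero>\<^bsub>R\<^esub>"
proof -
  have "([n] \<cdot>\<^bsub>R\<^esub> x) g = [n] \<cdot>\<^bsub>K\<^esub> x g" for n :: nat and g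
    by (induction n) (auto simp: zero_eq add_eq)
  moreover have "[(card (carrier K))] \<cdot>\<^bsub>K\<^esub> x g = \<zero>\<^bsub>K\<^esub>" for g
    using group.pow_order_eq_1[OF K.a_group, of "x g"] coeff_closed[OF x]
    by (simp add: order_def add_pow_def)
  ultimately show ?thesis by (auto simp: zero_eq)
qed

theorem torsion_commutator_central_unipotent:
  assumes inf: "infinite (carrier R)"
    and a: "a \<in> Units R" "a \<in> ring_R.FC_elems" "n > 0" "a [^]\<^bsub>R\<^esub> (n::nat) = \<one>\<^bsub>R\<^esub>"
    and b: "b \<in> Units R" "b \<in> ring_R.FC_elems" "m > 0" "b [^]\<^bsub>R\<^esub> (m::nat) = \<one>\<^bsub>R\<^esub>"
  shows "ring_R.central_unipotent (a \<otimes>\<^bsub>R\<^esub> b \<otimes>\<^bsub>R\<^esub> inv\<^bsub>R\<^esub> a \<otimes>\<^bsub>R\<^esub> inv\<^bsub>R\<^esub> b)"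
proof (cases "finite (carrier K)")
  case True
  define V where "V = tga_basis K ` carrier G"
  have "infinite (carrier G)" using finite_carrier_R True inf by blast
  then have V: "V \<subseteq> Units R" "infinite V"
    using basis_Unit finite_imageD[OF _ inj_on_subset[OF basis_inj]] by (auto simp: V_def)
  have sep: "finite {u \<in> V. u \<otimes>\<^bsub>R\<^esub> d = v}" if "d \<in> carrier R" "d \<noteq> \<zero>\<^bsub>R\<^esub>" for d v
    unfolding V_def using that by (rule finite_basis_mult_eq)
  have N: "card (carrier K) > 0" using True K.zero_closed by (auto simp: card_gt_0_iff)
  obtain k :: nat where "(a \<otimes>\<^bsub>R\<^esub> b \<ominus>\<^bsub>R\<^esub> b \<otimes>\<^bsub>R\<^esub> a) [^]\<^bsub>R\<^esub> k = \<zero>\<^bsub>R\<^esub>"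
    using ring_R.torsion_FC_commutator_nilpotent[OF V sep N card_K_add_pow[OF True] a b] by blast
  then show ?thesis
    using a(1,2) b(1,2)
    by (intro ring_R.central_unipotent_commutator ring_R.nilpotent_FC_commutes[OF V sep])
next
  case False
  define C where "C = {s \<in> carrier K. s [^]\<^bsub>K\<^esub> m \<noteq> \<one>\<^bsub>K\<^esub>}"
  define Z where "Z = scalar ` C"
  have Cc: "C \<subseteq> carrier K" by (auto simp: C_def)
  have "carrier K - C = {s \<in> carrier K. s [^]\<^bsub>K\<^esub> m = \<one>\<^bsub>K\<^esub>}" by (auto simp: C_def)
  then have "finite (carrier K - C)" using K.finite_roots_of_unity[OF b(3)] by simp
  then have "infinite C" using False Cc by (metis finite_Diff2)
  moreover have "inj_on scalar C" using scalar_inj Cc by (auto intro!: inj_onI)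
  ultimately have Z: "infinite Z" unfolding Z_def by (simp add: finite_image_iff)
  have bc: "b \<in> carrier R" using b(1) by (rule ring_R.Units_closed)
  have "a \<otimes>\<^bsub>R\<^esub> b = b \<otimes>\<^bsub>R\<^esub> a"
  proof (rule ring_R.FC_commutes_of_central_shifts[OF _ Z _ _ bc _ a(2)])
    show "Z \<subseteq> carrier R" using scalar_closed Cc by (auto simp: Z_def)
    show "z \<otimes>\<^bsub>R\<^esub> y = y \<otimes>\<^bsub>R\<^esub> z" if "z \<in> Z" "y \<in> carrier R" for z y
      using that Cc scalar_mult by (auto simp: Z_def)
    show "z \<ominus>\<^bsub>R\<^esub> z' \<in> Units R" if zz: "z \<in> Z" "z' \<in> Z" "z \<noteq> z'" for z z'
    proof -
      obtain s t where st: "s \<in> C" "t \<in> C" "z = scalar s" "z' = scalar t" using zz by (auto simp: Z_def)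
      then have "s \<noteq> t" "s \<in> carrier K" "t \<in> carrier K" using zz Cc by auto
      then show ?thesis unfolding st by (simp add: scalar_diff scalar_Unit)
    qed
    show "b \<ominus>\<^bsub>R\<^esub> z \<in> Units R" if zZ: "z \<in> Z" for z
    proof -
      obtain s where s: "s \<in> carrier K" "s [^]\<^bsub>K\<^esub> m \<noteq> \<one>\<^bsub>K\<^esub>" "z = scalar s"
        using zZ by (auto simp: Z_def C_def)
      have "\<one>\<^bsub>R\<^esub> \<ominus>\<^bsub>R\<^esub> z [^]\<^bsub>R\<^esub> m = scalar (\<one>\<^bsub>K\<^esub> \<ominus>\<^bsub>K\<^esub> s [^]\<^bsub>K\<^esub> m)"
        using s(1) by (simp add: s(3) scalar_pow scalar_diff flip: scalar_one)
      then have U: "\<one>\<^bsub>R\<^esub> \<ominus>\<^bsub>R\<^esub> z [^]\<^bsub>R\<^esub> m \<in> Units R"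
        using s(1,2) by (simp add: scalar_Unit)
      show ?thesis
        by (rule ring_R.torsion_minus_central_Unit[OF bc b(4) _ _ U])
          (use s(1) bc in \<open>simp_all only: s(3) scalar_mult scalar_closed\<close>)
    qed
  qed
  then have "a \<otimes>\<^bsub>R\<^esub> b \<otimes>\<^bsub>R\<^esub> inv\<^bsub>R\<^esub> a \<otimes>\<^bsub>R\<^esub> inv\<^bsub>R\<^esub> b = b \<otimes>\<^bsub>R\<^esub> (a \<otimes>\<^bsub>R\<^esub> inv\<^bsub>R\<^esub> a) \<otimes>\<^bsub>R\<^esub> inv\<^bsub>R\<^esub> b"
    using a(1) b(1) bc by (simp add: ring_R.m_assoc ring_R.Units_closed)
  also have "\<dots> = \<one>\<^bsub>R\<^esub>" using a(1) b(1) bc by simp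
  finally show ?thesis using ring_R.central_unipotent_one by simp
qed

end

theorem theorem1:
  fixes G :: "('g, 'a) monoid_scheme" and K :: "('k, 'b) ring_scheme"
    and \<Lambda> :: "'g \<Rightarrow> 'g \<Rightarrow> 'k"
  assumes "group G" and "field K" and "two_cocycle G K \<Lambda>"
    and "infinite (carrier (twisted_group_algebra G K \<Lambda>))"
  shows "let R = twisted_group_algebra G K \<Lambda>;
             U = units_of R;
             \<Delta>U = FC_center U;
             T = torsion_elems U \<Delta>U
         in \<forall>x \<in> derived U T.
              unipotent R x \<and> x \<in> \<Delta>U \<and> (\<forall>y \<in> \<Delta>U. x \<otimes>\<^bsub>U\<^esub> y = y \<otimes>\<^bsub>U\<^esub> x)"
proof -
  interpret tga G K \<Lambda>
    using assms by (intro tga.intro tga_axioms.intro)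
  define T where "T = torsion_elems (units_of R) (FC_center (units_of R))"
  have T: "a \<in> Units R \<and> a \<in> ring_R.FC_elems \<and> (\<exists>n::nat. n > 0 \<and> a [^]\<^bsub>R\<^esub> n = \<one>\<^bsub>R\<^esub>)" if "a \<in> T" for a
    using that unfolding T_def torsion_elems_def
    by (auto simp: ring_R.FC_center_iff ring_R.units_of_pow units_of_one)
  have "ring_R.central_unipotent x" if "x \<in> derived (units_of R) T" for x
  proof (rule ring_R.central_unipotent_derived[OF _ _ that])
    show "T \<subseteq> Units R" using T by blast
    show "ring_R.central_unipotent (a \<otimes>\<^bsub>R\<^esub> b \<otimes>\<^bsub>R\<^esub> inv\<^bsub>R\<^esub> a \<otimes>\<^bsub>R\<^esub> inv\<^bsub>R\<^esub> b)"
      if "a \<in> T" "b \<in> T" for a b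
      using T[OF that(1)] T[OF that(2)] torsion_commutator_central_unipotent[OF assms(4)] by blast
  qed
  then show ?thesis
    unfolding Let_def T_def using ring_R.central_unipotent_imp by blast
qed

end
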